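(* Let $\mathscr{H}$ and $\mathscr{U}$ be complex Hilbert spaces, $\mathbb{T}$ a strongly continuous semigroup on $\mathscr{H}$ with generator $\mathcal{A}$, $\mathcal{B}$ an admissible control operator for $\mathbb{T}$, $T>0$, $x_0,x_T\in\mathscr{H}$, $U\subseteq L^2((0,T);\mathscr{U})$ a closed convex set, and $\theta\colon\mathscr{H}\times\mathscr{U}\times[0,T]\to\mathbb{R}$. Consider $$\min_{(x,u)}\ \mathcal{I}(x,u)=\int_0^T\theta(x(t),u(t),t)\,dt\quad\text{subject to}\quad\dot x(t)=\mathcal{A}x(t)+\mathcal{B}u(t),\ t\in[0,T],\ u\in U,\ x(0)=x_0,\ x(T)=x_T.\qquad(\ast)$$ Let $X=C([0,T];\mathscr{H})\times L^2((0,T);\mathscr{U})$, let $A$ be the set of all $(x,u)\in X$ with $u\in U$ and $x(t)=\mathbb{T}_tx_0+F_tu$ for all $t\in[0,T]$, and put $\varphi(x,u)=\|x(T)-x_T\|_{\mathscr{H}}$, $\Phi_\lambda=\mathcal{I}+\lambda\varphi$. Suppose that: 1. $\theta$ is continuous, and for any $R>0$ there exist $C_R>0$ and an a.e. nonnegative $\omega_R\in L^1(0,T)$ such that $|\theta(x,u,t)|\le C_R\|u\|_{\mathscr{U}}^2+\omega_R(t)$ for all $x\in\mathscr{H}$, $u\in\mathscr{U}$, $t\in(0,T)$ with $\|x\|_{\mathscr{H}}\le R$; 2. either $U$ is bounded in $L^2((0,T);\mathscr{U})$, or there exist $C_1>0$ and $\omega\in L^1(0,T)$ such that $\theta(x,u,t)\ge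 C_1\|u\|_{\mathscr{U}}^2+\omega(t)$ for all $x\in\mathscr{H}$, $u\in\mathscr{U}$, $t\in[0,T]$; 3. $\theta$ is differentiable in $x$ and $u$, the functions $\nabla_x\theta$ and $\nabla_u\theta$ are continuous, and for any $R>0$ there exist $C_R>0$ and a.e. nonnegative functions $\omega_R\in L^1(0,T)$, $\eta_R\in L^2(0,T)$ such that $\|\nabla_x\theta(x,u,t)\|_{\mathscr{H}}\le C_R\|u\|_{\mathscr{U}}^2+\omega_R(t)$ and $\|\nabla_u\theta(x,u,t)\|_{\mathscr{U}}\le C_R\|u\|_{\mathscr{U}}+\eta_R(t)$ for all $x\in\mathscr{H}$, $u\in\mathscr{U}$, $t\in(0,T)$ with $\|x\|_{\mathscr{H}}\le R$; 4. there exists a globally optimal solution of $(\ast)$, $\operatorname{relint}\mathcal{R}(x_0,T)\ne\emptyset$ and $x_T\in\operatorname{relint}\mathcal{R}(x_0,T)$. Then for all $c\in\mathbb{R}$ there exists $\lambda^*(c)\ge0$ such that for any $\lambda\ge\lambda^*(c)$ the penalty function $\Phi_\lambda$ for problem $(\ast)$ is completely exact on the set $S_\lambda(c)$.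
   Context: Control system: let $\mathscr{H}_{-1}$ be the extrapolation space of $\mathscr{H}$ (completion of $\mathscr{H}$ in the norm $\|(\beta I-\mathcal{A})^{-1}\cdot\|$, $\beta$ in the resolvent set of $\mathcal{A}$), to which $\mathbb{T}$ extends. A bounded linear $\mathcal{B}\colon\mathscr{U}\to\mathscr{H}_{-1}$ is an admissible control operator for $\mathbb{T}$ if for some $\tau>0$ the map $F_\tau u=\int_0^\tau\mathbb{T}_{\tau-\sigma}\mathcal{B}u(\sigma)\,d\sigma$ takes values in $\mathscr{H}$ for all $u\in L^2((0,\infty);\mathscr{U})$. Then for each $t\ge0$ the input map $F_tu=\int_0^t\mathbb{T}_{t-\sigma}\mathcal{B}u(\sigma)\,d\sigma$ is a bounded operator into $\mathscr{H}$, and for $u\in L^2((0,T);\mathscr{U})$ the unique solution in $C([0,T];\mathscr{H})$ of $\dot x=\mathcal{A}x+\mathcal{B}u$, $x(0)=x_0$ is $x(t)=\mathbb{T}_tx_0+F_tu$. $L^2((0,T);\mathscr{U})$ has its standard norm; $X$ carries the sum norm. Gradients of the real-valued $\theta$ are taken with respect to the underlying real Hilbert space structure. Reachable set: $\mathcal{R}(x_0,T)=\{x(T)\mid(x,u)\in A\}=\mathbb{T}_Tx_0+F_T(U)$, a convex set. The relative interior $\operatorname{relint}C$ of a convex subset $C$ of a Banach space is the interior of $C$ relative to the closed affine hull of $C$. $\Omega=\{(x,u)\in A\mid\varphi(x,u)=0\}$ is the feasible set of $(\ast)$, $S_\lambda(c)=\{(x,u)\in A\mid\Phi_\lambda(x,u)<c\}$.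 For $K\subseteq X$, $f\colon X\to\mathbb{R}$ and $z\in K$, $f^{\downarrow}_K(z)=\liminf_{y\to z,\,y\in K}\frac{f(y)-f(z)}{\|y-z\|_X}$ ($+\infty$ if $z$ is isolated in $K$); $z$ is an inf-stationary point of $f$ on $K$ if $f^{\downarrow}_K(z)\ge0$. $\Phi_\lambda$ is completely exact on $S_\lambda(c)$ if: (1) the optimal values of $\min_\Omega\mathcal{I}$ and $\min_A\Phi_\lambda$ coincide; (2) their globally optimal solutions coincide; (3) $z\in S_\lambda(c)$ is a locally optimal solution of $\min_A\Phi_\lambda$ iff $z\in\Omega$ and $z$ is a locally optimal solution of $\min_\Omega\mathcal{I}$; (4) $z\in S_\lambda(c)$ is an inf-stationary point of $\Phi_\lambda$ on $A$ iff $z\in\Omega$ and $z$ is an inf-stationary point of $\mathcal{I}$ on $\Omega$. Local optimality is with respect to the norm of $X$. *)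

theory Defs
  imports "HOL-Analysis.Analysis"
begin

section \<open>Complex Banach and Hilbert spaces\<close>

class complex_vector = real_vector +
  fixes scaleC :: "complex \<Rightarrow> 'a \<Rightarrow> 'a" (infixr "*\<^sub>C" 75)
  assumes scaleC_add_right: "a *\<^sub>C (x + y) = a *\<^sub>C x + a *\<^sub>C y"
    and scaleC_add_left: "(a + b) *\<^sub>C x = a *\<^sub>C x + b *\<^sub>C x"
    and scaleC_scaleC: "a *\<^sub>C b *\<^sub>C x = (a * b) *\<^sub>C x"
    and scaleC_of_real: "complex_of_real r *\<^sub>C x = r *\<^sub>R x"

class complex_banach = complex_vector + banach +
  assumes norm_scaleC: "norm (c *\<^sub>C x) = cmod c * norm x"

text \<open>A complex Hilbert space comes with its underlying real Hilbert space, whose inner product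
  is the real part of the complex one; the norm is the one of class \<^class>\<open>real_inner\<close>.\<close>

class complex_hilbert = complex_vector + real_inner + complete_space +
  fixes cinner :: "'a \<Rightarrow> 'a \<Rightarrow> complex"
  assumes cinner_commute: "cinner x y = cnj (cinner y x)"
    and cinner_add_left: "cinner (x + y) z = cinner x z + cinner y z"
    and cinner_scaleC_left: "cinner (c *\<^sub>C x) y = c * cinner x y"
    and inner_eq_Re_cinner: "inner x y = Re (cinner x y)"

subclass (in complex_hilbert) banach ..

instance complex_hilbert \<subseteq> complex_banach
proof
  fix c :: complex and x :: 'a
  have r: "cinner y (c *\<^sub>C z) = cnj c * cinner y z" for y z :: 'a
    by (subst cinner_commute) (simp add: cinner_scaleC_left cinner_commute[of y z])
  have "Im (cinner x x) = 0"
    using arg_cong[OF cinner_commute[of x x], of Im] by simp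
  then have "inner (c *\<^sub>C x) (c *\<^sub>C x) = (cmod c)\<^sup>2 * inner x x"
    by (simp add: inner_eq_Re_cinner cinner_scaleC_left r cmod_power2)
      (simp add: algebra_simps power2_eq_square)
  then show "norm (c *\<^sub>C x) = cmod c * norm x"
    by (simp add: norm_eq_sqrt_inner real_sqrt_mult)
qed

instantiation complex :: complex_hilbert
begin
definition scaleC_complex :: "complex \<Rightarrow> complex \<Rightarrow> complex" where
  "scaleC_complex c x = c * x"
definition cinner_complex :: "complex \<Rightarrow> complex \<Rightarrow> complex" where
  "cinner_complex x y = x * cnj y"
instance
  by standard (auto simp: scaleC_complex_def cinner_complex_def inner_complex_def algebra_simps
      scaleR_conv_of_real)
end

definition clinear :: "('a::complex_vector \<Rightarrow> 'b::complex_vector) \<Rightarrow> bool" where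
  "clinear f \<longleftrightarrow> linear f \<and> (\<forall>c x. f (c *\<^sub>C x) = c *\<^sub>C f x)"

definition bounded_clinear :: "('a::complex_banach \<Rightarrow> 'b::complex_banach) \<Rightarrow> bool" where
  "bounded_clinear f \<longleftrightarrow> clinear f \<and> bounded_linear f"

section \<open>Vector-valued integration\<close>

text \<open>The library's \<^const>\<open>has_bochner_integral\<close> is restricted to second countable
  (i.e. separable) spaces. This is the same definition without that restriction. The existence of
  the approximating simple functions forces the integrand to be almost separably valued.\<close>

definition has_bochner :: "'a measure \<Rightarrow> ('a \<Rightarrow> 'b::real_normed_vector) \<Rightarrow> 'b \<Rightarrow> bool" where
  "has_bochner M f I \<longleftrightarrow>
     f \<in> borel_measurable M \<and>
     (\<exists>s. (\<forall>i::nat. Bochner_Integration.simple_bochner_integrable M (s i)) \<and>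
          (\<lambda>i. \<integral>\<^sup>+x. norm (f x - s i x) \<partial>M) \<longlonglongrightarrow> 0 \<and>
          (\<lambda>i. Bochner_Integration.simple_bochner_integral M (s i)) \<longlonglongrightarrow> I)"

definition bochner :: "'a measure \<Rightarrow> ('a \<Rightarrow> 'b::real_normed_vector) \<Rightarrow> 'b" where
  "bochner M f = (THE I. has_bochner M f I)"

lemma has_bochner_iff_has_bochner_integral:
  fixes f :: "'a \<Rightarrow> 'b::{real_normed_vector, second_countable_topology}"
  shows "has_bochner M f I \<longleftrightarrow> has_bochner_integral M f I"
  unfolding has_bochner_def has_bochner_integral.simps by blast

definition strongly_measurable :: "'a measure \<Rightarrow> ('a \<Rightarrow> 'b::real_normed_vector) \<Rightarrow> bool" where
  "strongly_measurable M f \<longleftrightarrow>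
     (\<exists>s. (\<forall>i::nat. simple_function M (s i)) \<and> (AE x in M. (\<lambda>i. s i x) \<longlonglongrightarrow> f x))"

section \<open>The space $X$\<close>

text \<open>Elements of $L^2(J;V)$ and of $C([0,T];V)$ are represented by functions on the whole real
  line, and all topological notions are expressed through the corresponding seminorms; functions at
  distance $0$ represent the same element. Every notion below is invariant under replacing a
  function by another one at distance $0$.\<close>

definition L2 :: "real set \<Rightarrow> (real \<Rightarrow> 'a::real_normed_vector) set" where
  "L2 J = {u. strongly_measurable (lebesgue_on J) u \<and>
              integrable (lebesgue_on J) (\<lambda>t. (norm (u t))\<^sup>2)}"

definition L2_norm :: "real set \<Rightarrow> (real \<Rightarrow> 'a::real_normed_vector) \<Rightarrow> real" where
  "L2_norm J u = sqrt (LINT t|lebesgue_on J. (norm (u t))\<^sup>2)"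

definition L2_convex :: "(real \<Rightarrow> 'a::real_normed_vector) set \<Rightarrow> bool" where
  "L2_convex U \<longleftrightarrow>
     (\<forall>u\<in>U. \<forall>v\<in>U. \<forall>s\<in>{0..1}. (\<lambda>t. (1 - s) *\<^sub>R u t + s *\<^sub>R v t) \<in> U)"

text \<open>Taking constant sequences, one sees that a closed set contains with a function all
  functions that are equal to it almost everywhere, so it is a set of equivalence classes.\<close>

definition L2_closed :: "real set \<Rightarrow> (real \<Rightarrow> 'a::real_normed_vector) set \<Rightarrow> bool" where
  "L2_closed J U \<longleftrightarrow>
     (\<forall>v u. (\<forall>n::nat. v n \<in> U) \<and> u \<in> L2 J \<and> (\<lambda>n. L2_norm J (\<lambda>t. v n t - u t)) \<longlonglongrightarrow> 0 \<longrightarrow> u \<in> U)"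

definition L2_bounded :: "real set \<Rightarrow> (real \<Rightarrow> 'a::real_normed_vector) set \<Rightarrow> bool" where
  "L2_bounded J U \<longleftrightarrow> (\<exists>M. \<forall>u\<in>U. L2_norm J u \<le> M)"

definition spaceX :: "real \<Rightarrow> ((real \<Rightarrow> 'h::real_normed_vector) \<times> (real \<Rightarrow> 'u::real_normed_vector)) set" where
  "spaceX T = {x. continuous_on {0..T} x} \<times> L2 {0<..<T}"

definition distX ::
    "real \<Rightarrow> (real \<Rightarrow> 'h::real_normed_vector) \<times> (real \<Rightarrow> 'u::real_normed_vector) \<Rightarrow>
     (real \<Rightarrow> 'h) \<times> (real \<Rightarrow> 'u) \<Rightarrow> real" where
  "distX T = (\<lambda>(x, u) (y, v).
     (SUP t\<in>{0..T}. norm (x t - y t)) + L2_norm {0<..<T} (\<lambda>t. u t - v t))"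

section \<open>Semigroups and control operators\<close>

definition strongly_continuous_semigroup :: "(real \<Rightarrow> 'h::complex_banach \<Rightarrow> 'h) \<Rightarrow> bool" where
  "strongly_continuous_semigroup S \<longleftrightarrow>
     (\<forall>t\<ge>0. bounded_clinear (S t)) \<and>
     (\<forall>x. S 0 x = x) \<and>
     (\<forall>s\<ge>0. \<forall>t\<ge>0. \<forall>x. S (s + t) x = S s (S t x)) \<and>
     (\<forall>x. ((\<lambda>t. S t x) \<longlongrightarrow> x) (at_right 0))"

definition generator_dom :: "(real \<Rightarrow> 'h::complex_banach \<Rightarrow> 'h) \<Rightarrow> 'h set" where
  "generator_dom S = {x. \<exists>y. ((\<lambda>t. (S t x - x) /\<^sub>R t) \<longlongrightarrow> y) (at_right 0)}"

definition generator :: "(real \<Rightarrow> 'h::complex_banach \<Rightarrow> 'h) \<Rightarrow> 'h \<Rightarrow> 'h" where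
  "generator S x = Lim (at_right 0) (\<lambda>t. (S t x - x) /\<^sub>R t)"

definition resolvent :: "(real \<Rightarrow> 'h::complex_banach \<Rightarrow> 'h) \<Rightarrow> complex \<Rightarrow> 'h \<Rightarrow> 'h" where
  "resolvent S \<beta> = inv_into (generator_dom S) (\<lambda>x. \<beta> *\<^sub>C x - generator S x)"

definition resolvent_set :: "(real \<Rightarrow> 'h::complex_banach \<Rightarrow> 'h) \<Rightarrow> complex set" where
  "resolvent_set S =
     {\<beta>. bij_betw (\<lambda>x. \<beta> *\<^sub>C x - generator S x) (generator_dom S) UNIV \<and>
         bounded_clinear (resolvent S \<beta>)}"

text \<open>The Banach space \<^typ>\<open>'e\<close>, together with the embedding \<open>\<iota>\<close>, is a completion of
  \<^typ>\<open>'h\<close> in the norm $\|(\beta I - A)^{-1}\cdot\|$.\<close>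

definition extrapolation_space ::
    "(real \<Rightarrow> 'h::complex_banach \<Rightarrow> 'h) \<Rightarrow> complex \<Rightarrow> ('h \<Rightarrow> 'e::complex_banach) \<Rightarrow> bool" where
  "extrapolation_space S \<beta> \<iota> \<longleftrightarrow>
     \<beta> \<in> resolvent_set S \<and> clinear \<iota> \<and>
     (\<forall>x. norm (\<iota> x) = norm (resolvent S \<beta> x)) \<and> closure (range \<iota>) = UNIV"

definition extended_semigroup ::
    "(real \<Rightarrow> 'h::complex_banach \<Rightarrow> 'h) \<Rightarrow> ('h \<Rightarrow> 'e::complex_banach) \<Rightarrow> real \<Rightarrow> 'e \<Rightarrow> 'e" where
  "extended_semigroup S \<iota> t = (THE E. bounded_clinear E \<and> (\<forall>x. E (\<iota> x) = \<iota> (S t x)))"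

definition input_integral ::
    "(real \<Rightarrow> 'h::complex_banach \<Rightarrow> 'h) \<Rightarrow> ('h \<Rightarrow> 'e::complex_banach) \<Rightarrow> ('u \<Rightarrow> 'e) \<Rightarrow>
     real \<Rightarrow> (real \<Rightarrow> 'u) \<Rightarrow> 'e" where
  "input_integral S \<iota> B t u =
     bochner (lebesgue_on {0<..<t}) (\<lambda>\<sigma>. extended_semigroup S \<iota> (t - \<sigma>) (B (u \<sigma>)))"

definition admissible_control ::
    "(real \<Rightarrow> 'h::complex_banach \<Rightarrow> 'h) \<Rightarrow> ('h \<Rightarrow> 'e::complex_banach) \<Rightarrow>
     ('u::complex_banach \<Rightarrow> 'e) \<Rightarrow> bool" where
  "admissible_control S \<iota> B \<longleftrightarrow>
     bounded_clinear B \<and> (\<exists>\<tau>>0. \<forall>u\<in>L2 {0<..}. input_integral S \<iota> B \<tau> u \<in> range \<iota>)"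

text \<open>The input map, with its values regarded as elements of the original space.\<close>

definition input_map ::
    "(real \<Rightarrow> 'h::complex_banach \<Rightarrow> 'h) \<Rightarrow> ('h \<Rightarrow> 'e::complex_banach) \<Rightarrow> ('u \<Rightarrow> 'e) \<Rightarrow>
     real \<Rightarrow> (real \<Rightarrow> 'u) \<Rightarrow> 'h" where
  "input_map S \<iota> B t u = inv \<iota> (input_integral S \<iota> B t u)"

definition trajectories ::
    "(real \<Rightarrow> 'h::complex_banach \<Rightarrow> 'h) \<Rightarrow> ('h \<Rightarrow> 'e::complex_banach) \<Rightarrow> ('u::complex_banach \<Rightarrow> 'e) \<Rightarrow>
     real \<Rightarrow> 'h \<Rightarrow> (real \<Rightarrow> 'u) set \<Rightarrow> ((real \<Rightarrow> 'h) \<times> (real \<Rightarrow> 'u)) set" where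
  "trajectories S \<iota> B T x0 U =
     {(x, u). (x, u) \<in> spaceX T \<and> u \<in> U \<and> (\<forall>t\<in>{0..T}. x t = S t x0 + input_map S \<iota> B t u)}"

definition reachable_set ::
    "(real \<Rightarrow> 'h::complex_banach \<Rightarrow> 'h) \<Rightarrow> ('h \<Rightarrow> 'e::complex_banach) \<Rightarrow> ('u::complex_banach \<Rightarrow> 'e) \<Rightarrow>
     real \<Rightarrow> 'h \<Rightarrow> (real \<Rightarrow> 'u) set \<Rightarrow> 'h set" where
  "reachable_set S \<iota> B T x0 U = {x T | x u. (x, u) \<in> trajectories S \<iota> B T x0 U}"

text \<open>In contrast to \<^const>\<open>rel_interior\<close>, the interior is relative to the \<^emph>\<open>closed\<close> affine hull.\<close>

definition relint :: "'a::real_normed_vector set \<Rightarrow> 'a set" where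
  "relint C = {x. \<exists>V. openin (top_of_set (closure (affine hull C))) V \<and> x \<in> V \<and> V \<subseteq> C}"

definition cost ::
    "('h \<Rightarrow> 'u \<Rightarrow> real \<Rightarrow> real) \<Rightarrow> real \<Rightarrow> (real \<Rightarrow> 'h) \<times> (real \<Rightarrow> 'u) \<Rightarrow> real" where
  "cost \<theta> T = (\<lambda>(x, u). LINT t|lebesgue_on {0<..<T}. \<theta> (x t) (u t) t)"

definition terminal_error ::
    "real \<Rightarrow> 'h::real_normed_vector \<Rightarrow> (real \<Rightarrow> 'h) \<times> (real \<Rightarrow> 'u) \<Rightarrow> real" where
  "terminal_error T xT = (\<lambda>(x, u). norm (x T - xT))"

section \<open>Optimality and exact penalty functions\<close>

text \<open>Here \<open>d\<close> is the (pseudo)metric of the ambient space.\<close>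

definition globally_optimal :: "('z \<Rightarrow> real) \<Rightarrow> 'z set \<Rightarrow> 'z \<Rightarrow> bool" where
  "globally_optimal f K z \<longleftrightarrow> z \<in> K \<and> (\<forall>y\<in>K. f z \<le> f y)"

definition locally_optimal :: "('z \<Rightarrow> 'z \<Rightarrow> real) \<Rightarrow> ('z \<Rightarrow> real) \<Rightarrow> 'z set \<Rightarrow> 'z \<Rightarrow> bool" where
  "locally_optimal d f K z \<longleftrightarrow> z \<in> K \<and> (\<exists>\<epsilon>>0. \<forall>y\<in>K. d y z < \<epsilon> \<longrightarrow> f z \<le> f y)"

text \<open>The lower limit along the trivial filter is \<open>\<infinity>\<close>, as required at isolated points.\<close>

definition rate_of_descent :: "('z \<Rightarrow> 'z \<Rightarrow> real) \<Rightarrow> ('z \<Rightarrow> real) \<Rightarrow> 'z set \<Rightarrow> 'z \<Rightarrow> ereal" where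
  "rate_of_descent d f K z =
     Liminf (INF \<epsilon>\<in>{0<..}. principal {y \<in> K. 0 < d y z \<and> d y z < \<epsilon>})
       (\<lambda>y. ereal ((f y - f z) / d y z))"

definition inf_stationary :: "('z \<Rightarrow> 'z \<Rightarrow> real) \<Rightarrow> ('z \<Rightarrow> real) \<Rightarrow> 'z set \<Rightarrow> 'z \<Rightarrow> bool" where
  "inf_stationary d f K z \<longleftrightarrow> z \<in> K \<and> 0 \<le> rate_of_descent d f K z"

definition penalty :: "('z \<Rightarrow> real) \<Rightarrow> ('z \<Rightarrow> real) \<Rightarrow> real \<Rightarrow> 'z \<Rightarrow> real" where
  "penalty f \<phi> lam z = f z + lam * \<phi> z"

definition feasible_set :: "'z set \<Rightarrow> ('z \<Rightarrow> real) \<Rightarrow> 'z set" where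
  "feasible_set A \<phi> = {z \<in> A. \<phi> z = 0}"

definition sublevel :: "'z set \<Rightarrow> ('z \<Rightarrow> real) \<Rightarrow> real \<Rightarrow> 'z set" where
  "sublevel A f c = {z \<in> A. f z < c}"

definition completely_exact ::
    "('z \<Rightarrow> 'z \<Rightarrow> real) \<Rightarrow> 'z set \<Rightarrow> ('z \<Rightarrow> real) \<Rightarrow> ('z \<Rightarrow> real) \<Rightarrow> real \<Rightarrow> 'z set \<Rightarrow> bool" where
  "completely_exact d A f \<phi> lam Z \<longleftrightarrow>
     (INF z\<in>feasible_set A \<phi>. ereal (f z)) = (INF z\<in>A. ereal (penalty f \<phi> lam z)) \<and>
     (\<forall>z. globally_optimal f (feasible_set A \<phi>) z \<longleftrightarrow> globally_optimal (penalty f \<phi> lam) A z) \<and>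
     (\<forall>z\<in>Z. locally_optimal d (penalty f \<phi> lam) A z \<longleftrightarrow>
              z \<in> feasible_set A \<phi> \<and> locally_optimal d f (feasible_set A \<phi>) z) \<and>
     (\<forall>z\<in>Z. inf_stationary d (penalty f \<phi> lam) A z \<longleftrightarrow>
              z \<in> feasible_set A \<phi> \<and> inf_stationary d f (feasible_set A \<phi>) z)"

end

theory Submission
  imports Defs
begin

text \<open>The penalty function is exact because of a uniform error bound. By a Robinson-Ursescu argument
  (Baire's theorem and a convex series), every point of the closed affine hull of the reachable set
  in some ball around $x_T$ is attained by a control of uniformly bounded norm. Hence, from any
  non-feasible $z = (x, u) \in A$, one can move along a segment in $A$ to a trajectory that overshoots
  the target slightly in the direction $x_T - x(T)$; this decreases $\varphi$ at a rate proportional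
  to the distance covered, and reaches a feasible point at a distance proportional to $\varphi(z)$.
  On bounded subsets of $A$ the cost is Lipschitz continuous by the mean value theorem and the
  growth conditions, and sublevel sets are bounded, so a large multiple of $\varphi$ dominates the
  possible loss of cost.

  The segments have controlled length since the input maps $F_t$ are linear and bounded uniformly in
  $t \in [0,T]$. This follows from admissibility by translations in time and the uniform boundedness
  principle. All vector-valued integrals are identified by testing against functionals after applying
  the isometry $J$ of $\mathscr{H}_{-1}$ into $\mathscr{H}$ that extends the resolvent. Continuity of $t \mapsto F_t u$ is not
  needed: the controls for which it holds form a closed convex set.\<close>

section \<open>Exact penalties from descent paths\<close>

text \<open>Moving towards a feasible trajectory would only shrink \<phi> by the factor 1 - s, at a
  rate that vanishes as \<phi>(z) tends to 0. Aiming at a point at a fixed distance r/2 beyond x_T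
  yields a rate of at least r/2 at every infeasible z. This point must be reachable by a control
  whose norm does not depend on z, since otherwise the distance covered is not under control. The
  position of x_T in the relative interior only provides reachability; the bound on the controls has
  to come from completeness, both of the closed affine hull (Baire) and of L^2 (the convex series).
  The integrals in the extrapolation space are brought under control by J: its values lie in H,
  where inner products separate points, so that identities between input maps become identities
  between real Lebesgue integrals. Moreover J turns "the integral lies in H" into "its image lies in
  the domain of the generator", a subspace invariant under the semigroup. This is how admissibility
  at one time spreads to all times.\<close>

lemma inf_stationary_iff:
  "inf_stationary d f K z \<longleftrightarrow>
     z \<in> K \<and> (\<forall>e>0. \<exists>\<delta>>0. \<forall>y\<in>K. 0 < d y z \<and> d y z < \<delta> \<longrightarrow> f z - e * d y z \<le> f y)"
proof -
  define F where "F = (INF \<epsilon>\<in>{0::real<..}. principal {y \<in> K. 0 < d y z \<and> d y z < \<epsilon>})"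
  have ev: "eventually P F \<longleftrightarrow> (\<exists>\<delta>>0. \<forall>y\<in>K. 0 < d y z \<and> d y z < \<delta> \<longrightarrow> P y)" for P
    unfolding F_def
  proof (subst eventually_INF_base)
    show "\<exists>x\<in>{0<..}. principal {y \<in> K. 0 < d y z \<and> d y z < x}
        \<le> inf (principal {y \<in> K. 0 < d y z \<and> d y z < a}) (principal {y \<in> K. 0 < d y z \<and> d y z < b})"
      if "a \<in> {0<..}" "b \<in> {0<..}" for a b
      using that by (intro bexI[of _ "min a b"]) auto
  qed (auto simp: eventually_principal)
  \<comment> \<open>Multiplying by the positive distance turns the bound on the quotient into a
    lower bound on \<open>f\<close>. Points at distance 0 from \<open>z\<close> are left out on both
    sides, so a point isolated in \<open>K\<close> qualifies vacuously.\<close>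
  have "0 \<le> Liminf F (\<lambda>y. ereal ((f y - f z) / d y z)) \<longleftrightarrow>
      (\<forall>e>0. \<exists>\<delta>>0. \<forall>y\<in>K. 0 < d y z \<and> d y z < \<delta> \<longrightarrow> f z - e * d y z \<le> f y)"
    unfolding le_Liminf_iff ev
  proof safe
    fix e :: real
    assume *: "\<forall>y<0. \<exists>\<delta>>0. \<forall>x\<in>K. 0 < d x z \<and> d x z < \<delta> \<longrightarrow> y < ereal ((f x - f z) / d x z)"
      and "0 < e"
    then obtain \<delta> where "\<delta> > 0"
      and \<delta>: "\<forall>x\<in>K. 0 < d x z \<and> d x z < \<delta> \<longrightarrow> ereal (-e) < ereal ((f x - f z) / d x z)"
      by (metis ereal_less(1) neg_less_0_iff_less zero_ereal_def less_ereal.simps(1))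
    show "\<exists>\<delta>>0. \<forall>y\<in>K. 0 < d y z \<and> d y z < \<delta> \<longrightarrow> f z - e * d y z \<le> f y"
      using \<delta> \<open>\<delta> > 0\<close> by (intro exI[of _ \<delta>]) (auto simp: field_simps)
  next
    fix y :: ereal
    assume *: "\<forall>e>0. \<exists>\<delta>>0. \<forall>y\<in>K. 0 < d y z \<and> d y z < \<delta> \<longrightarrow> f z - e * d y z \<le> f y"
      and "y < 0"
    then obtain e where e: "e > 0" "y < ereal (-e)"
      by (metis ereal_dense2 less_ereal.simps(1) minus_minus neg_0_less_iff_less zero_ereal_def)
    then obtain \<delta> where "\<delta> > 0" and \<delta>: "\<forall>y\<in>K. 0 < d y z \<and> d y z < \<delta> \<longrightarrow> f z - e * d y z \<le> f y"
      using * by blast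
    have "y < ereal ((f x - f z) / d x z)" if "x \<in> K" "0 < d x z" "d x z < \<delta>" for x
    proof -
      have "-e \<le> (f x - f z) / d x z"
        using \<delta> that by (auto simp: field_simps)
      then show ?thesis using e(2) by (meson ereal_less_eq(3) less_le_trans)
    qed
    then show "\<exists>\<delta>>0. \<forall>x\<in>K. 0 < d x z \<and> d x z < \<delta> \<longrightarrow> y < ereal ((f x - f z) / d x z)"
      using \<open>\<delta> > 0\<close> by blast
  qed
  then show ?thesis
    unfolding inf_stationary_def rate_of_descent_def F_def by blast
qed

text \<open>The endpoint of a path gives an error bound, namely a feasible point at a distance of at
  most a multiple of \<phi>; its initial piece gives a slope of descent that does not degenerate
  near the feasible set. The gauge \<nu> singles out the sets on which \<open>f\<close> is
  Lipschitz. A path may leave the set where \<nu> is at most \<open>M\<close>, but stays in another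
  set of this kind.\<close>

lemma completely_exact_of_descent_paths:
  fixes d :: "'z \<Rightarrow> 'z \<Rightarrow> real" and f \<phi> \<nu> :: "'z \<Rightarrow> real"
  assumes d_refl: "\<And>x. x \<in> A \<Longrightarrow> d x x = 0"
    and d_sym: "\<And>x y. x \<in> A \<Longrightarrow> y \<in> A \<Longrightarrow> d x y = d y x"
    and d_triangle: "\<And>x y z. x \<in> A \<Longrightarrow> y \<in> A \<Longrightarrow> z \<in> A \<Longrightarrow> d x z \<le> d x y + d y z"
    and \<phi>_nonneg: "\<And>x. 0 \<le> \<phi> x"
    and \<phi>_lip: "\<And>x y. x \<in> A \<Longrightarrow> y \<in> A \<Longrightarrow> \<phi> x - \<phi> y \<le> d x y"
    and \<nu>_lip: "\<And>x y. x \<in> A \<Longrightarrow> y \<in> A \<Longrightarrow> \<nu> x - \<nu> y \<le> d x y"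
    and f_lip: "\<And>M. \<exists>L\<ge>0. \<forall>x\<in>A. \<forall>y\<in>A. \<nu> x \<le> M \<longrightarrow> \<nu> y \<le> M \<longrightarrow> f x - f y \<le> L * d x y"
    and coercive: "\<And>c. \<exists>M. \<forall>x\<in>A. f x < c \<longrightarrow> \<nu> x \<le> M"
    and paths: "\<And>M. \<exists>D>0. \<exists>r>0. \<exists>M'. \<forall>z\<in>A. \<nu> z \<le> M \<longrightarrow> 0 < \<phi> z \<longrightarrow>
      (\<exists>p. \<exists>\<sigma>>0. \<phi> (p \<sigma>) = 0 \<and> (\<forall>s\<in>{0..\<sigma>}. p s \<in> A \<and> \<nu> (p s) \<le> M' \<and> d (p s) z \<le> s * D \<and>
          \<phi> (p s) \<le> \<phi> z - s * r))"
    and opt: "\<exists>z. globally_optimal f (feasible_set A \<phi>) z"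
  shows "\<forall>c. \<exists>lam0\<ge>0. \<forall>lam\<ge>lam0. completely_exact d A f \<phi> lam (sublevel A (penalty f \<phi> lam) c)"
proof
  fix c
  define \<Omega> where "\<Omega> = feasible_set A \<phi>"
  obtain z0 where z0: "z0 \<in> \<Omega>" "\<And>y. y \<in> \<Omega> \<Longrightarrow> f z0 \<le> f y"
    using opt by (auto simp: globally_optimal_def \<Omega>_def)
  have \<Omega>: "z \<in> \<Omega> \<longleftrightarrow> z \<in> A \<and> \<phi> z = 0" for z by (auto simp: \<Omega>_def feasible_set_def)
  \<comment> \<open>The level \<open>f z0 + 1\<close> serves the clauses on global optimality: they
    concern all of \<open>A\<close>, so points with a nearly optimal penalty must be covered for
    every \<open>c\<close>.\<close>
  obtain M where M: "\<And>x. x \<in> A \<Longrightarrow> f x < max c (f z0 + 1) \<Longrightarrow> \<nu> x \<le> M"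
    using coercive by blast
  \<comment> \<open>The margin 1 admits the points at distance below 1 from a point where \<nu> is
    at most \<open>M\<close>; see \<open>near\<close> below.\<close>
  obtain D r M' where D: "D > 0" and r: "r > 0"
    and path: "\<And>z. z \<in> A \<Longrightarrow> \<nu> z \<le> M + 1 \<Longrightarrow> 0 < \<phi> z \<Longrightarrow>
      (\<exists>p. \<exists>\<sigma>>0. \<phi> (p \<sigma>) = 0 \<and> (\<forall>s\<in>{0..\<sigma>}. p s \<in> A \<and> \<nu> (p s) \<le> M' \<and> d (p s) z \<le> s * D \<and>
          \<phi> (p s) \<le> \<phi> z - s * r))"
    using paths[of "M + 1"] by blast
  obtain L where L: "L \<ge> 0"
    and lip: "\<And>x y. x \<in> A \<Longrightarrow> y \<in> A \<Longrightarrow> \<nu> x \<le> max (M + 1) M' \<Longrightarrow> \<nu> y \<le> max (M + 1) M' \<Longrightarrow>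
      f x - f y \<le> L * d x y"
    using f_lip by blast
  \<comment> \<open>The constant of the error bound: a path with \<phi> = 0 at its end \<sigma>
    satisfies \<sigma> r \<le> \<phi> z, so it ends at distance at most \<sigma> D \<le> k \<phi>
    z.\<close>
  define k where "k = D / r"
  have k: "k > 0" using D r by (simp add: k_def)
  have d_nonneg: "0 \<le> d x y" if "x \<in> A" "y \<in> A" for x y
    using d_triangle[of x y x] d_refl d_sym[of x y] that by simp
  have project: "\<exists>w\<in>\<Omega>. d w z \<le> k * \<phi> z \<and> f w \<le> f z + L * k * \<phi> z"
    if z: "z \<in> A" "\<nu> z \<le> M + 1" for z
  proof (cases "\<phi> z = 0")
    case True
    then show ?thesis using z d_refl by (intro bexI[of _ z]) (auto simp: \<Omega>)
  next
    case False
    then have pos: "\<phi> z > 0" using \<phi>_nonneg[of z] by simp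
    obtain p \<sigma> where \<sigma>: "\<sigma> > 0" "\<phi> (p \<sigma>) = 0"
      and p: "p \<sigma> \<in> A" "\<nu> (p \<sigma>) \<le> M'" "d (p \<sigma>) z \<le> \<sigma> * D" "\<phi> (p \<sigma>) \<le> \<phi> z - \<sigma> * r"
      using path[OF z pos] by force
    have "\<sigma> \<le> \<phi> z / r" using p(4) \<sigma> r by (simp add: field_simps)
    then have "\<sigma> * D \<le> \<phi> z / r * D" using D by (intro mult_right_mono) auto
    then have dk: "d (p \<sigma>) z \<le> k * \<phi> z" using p(3) by (simp add: k_def field_simps)
    have "f (p \<sigma>) - f z \<le> L * d (p \<sigma>) z" using lip p z by auto
    also have "\<dots> \<le> L * (k * \<phi> z)" using dk L by (rule mult_left_mono)
    finally show ?thesis using \<sigma> p dk by (intro bexI[of _ "p \<sigma>"]) (auto simp: \<Omega> mult.assoc)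
  qed
  show "\<exists>lam0\<ge>0. \<forall>lam\<ge>lam0. completely_exact d A f \<phi> lam (sublevel A (penalty f \<phi> lam) c)"
  \<comment> \<open>The part \<open>L * k\<close> pays for the increase of \<open>f\<close> under
    projection to the feasible set. The additional 1 leaves a surplus of \<phi> z, which makes
    infeasible points strictly worse.\<close>
  proof (intro exI[of _ "L * k + 1"] conjI allI impI)
    show "0 \<le> L * k + 1" using L k by simp
    fix lam assume lam: "L * k + 1 \<le> lam"
    then have lam0: "lam \<ge> 0" using L k by (smt (verit) mult_nonneg_nonneg)
    define P where "P = penalty f \<phi> lam"
    have P: "P z = f z + lam * \<phi> z" for z by (simp add: P_def penalty_def)
    have P_ge: "f z \<le> P z" for z using \<phi>_nonneg[of z] lam0 by (simp add: P)
    have P_\<Omega>: "P z = f z" if "z \<in> \<Omega>" for z using that by (simp add: P \<Omega>)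
    have bounded: "\<nu> z \<le> M" if "z \<in> A" "P z < max c (f z0 + 1)" for z
      using M that P_ge[of z] by simp
    have exact: "\<exists>w\<in>\<Omega>. d w z \<le> k * \<phi> z \<and> f w + \<phi> z \<le> P z" if z: "z \<in> A" "\<nu> z \<le> M + 1" for z
    proof -
      have "(L * k + 1) * \<phi> z \<le> lam * \<phi> z" using lam \<phi>_nonneg by (intro mult_right_mono)
      then show ?thesis using project[OF z] by (force simp: P algebra_simps)
    qed
    \<comment> \<open>The minimum with 1 takes care of points whose penalty is at least
      \<open>f z0 + 1\<close>, where \<nu> need not be bounded by \<open>M\<close>.\<close>
    have lower: "f z0 + min 1 (\<phi> z) \<le> P z" if z: "z \<in> A" for z
    proof (cases "P z < f z0 + 1")
      case True
      then obtain w where "w \<in> \<Omega>" "f w + \<phi> z \<le> P z"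
        using exact[OF z] bounded[OF z] by force
      then show ?thesis using z0(2)[of w] by linarith
    qed auto
    have lower': "f z0 \<le> P z" if "z \<in> A" for z
      using lower[OF that] \<phi>_nonneg[of z] by linarith
    \<comment> \<open>The slope 1/k is the same at all these infeasible points and occurs at
      arbitrarily small distances, so such a point is neither locally optimal nor
      inf-stationary.\<close>
    have descent: "\<exists>y\<in>A. 0 < d y z \<and> d y z < e \<and> P y \<le> P z - d y z / k"
      if z: "z \<in> A" "\<nu> z \<le> M + 1" "\<phi> z > 0" "e > 0" for z e
    proof -
      obtain p \<sigma> where \<sigma>: "\<sigma> > 0"
        and p: "\<And>s. 0 \<le> s \<Longrightarrow> s \<le> \<sigma> \<Longrightarrow> p s \<in> A \<and> \<nu> (p s) \<le> M' \<and> d (p s) z \<le> s * D \<and>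
          \<phi> (p s) \<le> \<phi> z - s * r"
        using path[OF z(1-3)] by force
      define s where "s = min \<sigma> (e / (2 * D))"
      have s: "0 < s" "s \<le> \<sigma>" "s * D < e"
      proof -
        have "s * D \<le> e / (2 * D) * D" using D by (intro mult_right_mono) (auto simp: s_def)
        also have "\<dots> < e" using D z(4) by simp
        finally show "s * D < e" .
      qed (use \<sigma> D z in \<open>auto simp: s_def\<close>)
      let ?y = "p s"
      have y: "?y \<in> A" "\<nu> ?y \<le> M'" "d ?y z \<le> s * D" "\<phi> ?y \<le> \<phi> z - s * r"
        using p[of s] s by auto
      have "s * r > 0" using s r by simp
      then have "0 < \<phi> z - \<phi> ?y" using y by linarith
      then have "0 < d ?y z" using \<phi>_lip[of z ?y] d_sym y z by fastforce
      have "d ?y z / k \<le> s * r" using y(3) D r by (simp add: k_def field_simps)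
      then have \<phi>d: "\<phi> ?y \<le> \<phi> z - d ?y z / k" using y(4) by linarith
      have "f ?y - f z \<le> L * d ?y z" using lip y z by auto
      moreover have "lam * (d ?y z / k) \<le> lam * (\<phi> z - \<phi> ?y)"
        using \<phi>d lam0 by (intro mult_left_mono) auto
      moreover have "(L * k + 1) * (d ?y z / k) \<le> lam * (d ?y z / k)"
        using lam \<open>0 < d ?y z\<close> k by (intro mult_right_mono) auto
      moreover have "(L * k + 1) * (d ?y z / k) = L * d ?y z + d ?y z / k"
        using k by (simp add: field_simps)
      ultimately have "P ?y \<le> P z - d ?y z / k" unfolding P right_diff_distrib by linarith
      then show ?thesis using y s \<open>0 < d ?y z\<close> by (intro bexI[of _ ?y]) auto
    qed
    \<comment> \<open>Since \<open>d\<close> is only a pseudometric, a projection may end at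
      distance 0 from \<open>z\<close> without being \<open>z\<close>. Inf-stationarity says nothing
      about such a point; the Lipschitz bound does.\<close>
    have f0: "f w = f z" if "w \<in> A" "z \<in> A" "\<nu> z \<le> M" "d w z = 0" for w z
    proof -
      have "\<nu> w \<le> M" using \<nu>_lip[of w z] that by simp
      then have "\<nu> w \<le> max (M + 1) M'" "\<nu> z \<le> max (M + 1) M'" using that by linarith+
      then show ?thesis using lip[of w z] lip[of z w] d_sym[of z w] that by auto
    qed
    have near: "\<nu> y \<le> M + 1" if "y \<in> A" "z \<in> A" "\<nu> z \<le> M" "d y z < 1" for y z
      using \<nu>_lip[of y z] that by linarith
    \<comment> \<open>Projection of \<open>y\<close> enlarges its distance to a feasible
      \<open>z\<close> at most by the factor k + 1. Radii and tolerances are divided by this factor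
      below.\<close>
    have dist_project: "d w z \<le> (k + 1) * d y z"
      if "w \<in> A" "y \<in> A" "z \<in> \<Omega>" "d w y \<le> k * \<phi> y" for w y z
    proof -
      have "\<phi> y \<le> d y z" using \<phi>_lip[of y z] that by (simp add: \<Omega>)
      then have "k * \<phi> y \<le> k * d y z" using k by (intro mult_left_mono) auto
      moreover have "d w z \<le> d w y + d y z" using d_triangle that by (auto simp: \<Omega>)
      ultimately show ?thesis using that(4) by (simp add: algebra_simps)
    qed
    have 1: "(INF z\<in>\<Omega>. ereal (f z)) = (INF z\<in>A. ereal (P z))"
    proof -
      have "(INF z\<in>\<Omega>. ereal (f z)) = ereal (f z0)"
        using z0 by (intro INF_eqI) auto
      moreover have "(INF z\<in>A. ereal (P z)) = ereal (f z0)"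
        using z0 lower' P_\<Omega> by (intro INF_eqI) (auto simp: \<Omega>, metis \<Omega> P_\<Omega>)
      ultimately show ?thesis by simp
    qed
    have 2: "globally_optimal f \<Omega> z \<longleftrightarrow> globally_optimal P A z" for z
    proof
      assume "globally_optimal f \<Omega> z"
      then have "z \<in> \<Omega>" "f z = f z0" using z0 by (auto simp: globally_optimal_def intro: antisym)
      then show "globally_optimal P A z"
        using lower' P_\<Omega>[of z] by (auto simp: globally_optimal_def \<Omega>)
    next
      assume *: "globally_optimal P A z"
      then have z: "z \<in> A" "P z \<le> f z0"
        using z0 P_\<Omega>[of z0] by (auto simp: globally_optimal_def \<Omega>)
      then have "\<phi> z = 0" using lower[of z] \<phi>_nonneg[of z] by linarith
      then have "z \<in> \<Omega>" using z by (simp add: \<Omega>)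
      then show "globally_optimal f \<Omega> z"
        using z P_\<Omega>[of z] z0 by (force simp: globally_optimal_def)
    qed
    have 3: "locally_optimal d P A z \<longleftrightarrow> z \<in> \<Omega> \<and> locally_optimal d f \<Omega> z"
      if z: "z \<in> A" "P z < c" for z
    proof
      assume *: "locally_optimal d P A z"
      then obtain e where e: "e > 0" "\<And>y. y \<in> A \<Longrightarrow> d y z < e \<Longrightarrow> P z \<le> P y"
        by (auto simp: locally_optimal_def)
      have "\<phi> z = 0"
      proof (rule ccontr)
        assume "\<phi> z \<noteq> 0"
        then obtain y where "y \<in> A" "0 < d y z" "d y z < e" "P y \<le> P z - d y z / k"
          using descent[of z e] z e bounded[of z] \<phi>_nonneg[of z] by force
        moreover have "d y z / k > 0" using k calculation by simp
        ultimately show False using e(2)[of y] by linarith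
      qed
      then have "z \<in> \<Omega>" using z by (simp add: \<Omega>)
      then show "z \<in> \<Omega> \<and> locally_optimal d f \<Omega> z"
        using e P_\<Omega> by (fastforce simp: locally_optimal_def \<Omega>)
    next
      assume *: "z \<in> \<Omega> \<and> locally_optimal d f \<Omega> z"
      then obtain e where e: "e > 0" "\<And>y. y \<in> \<Omega> \<Longrightarrow> d y z < e \<Longrightarrow> f z \<le> f y"
        by (auto simp: locally_optimal_def)
      have "P z \<le> P y" if y: "y \<in> A" "d y z < min 1 (e / (k + 1))" for y
      proof -
        have "\<nu> y \<le> M + 1" using near[of y z] y z bounded[of z] by auto
        then obtain w where w: "w \<in> \<Omega>" "d w y \<le> k * \<phi> y" "f w + \<phi> y \<le> P y"
          using exact y by blast
        then have "d w z \<le> (k + 1) * d y z" using dist_project * y by (auto simp: \<Omega>)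
        also have "\<dots> < e" using y(2) k by (simp add: field_simps)
        finally have "f z \<le> f w" using e w by blast
        then show ?thesis using w(3) \<phi>_nonneg[of y] P_\<Omega>[of z] * by simp
      qed
      moreover have "min 1 (e / (k + 1)) > 0" using e k by simp
      ultimately show "locally_optimal d P A z" using z unfolding locally_optimal_def by blast
    qed
    have 4: "inf_stationary d P A z \<longleftrightarrow> z \<in> \<Omega> \<and> inf_stationary d f \<Omega> z"
      if z: "z \<in> A" "P z < c" for z
    proof
      assume *: "inf_stationary d P A z"
      have "\<phi> z = 0"
      proof (rule ccontr)
        assume "\<phi> z \<noteq> 0"
        \<comment> \<open>Any tolerance below the slope 1/k from \<open>descent\<close> yields a
          contradiction; half of it is taken.\<close>
        have "1 / (2 * k) > 0" using k by simp
        then obtain \<delta> where \<delta>: "\<delta> > 0"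
          "\<And>y. y \<in> A \<Longrightarrow> 0 < d y z \<Longrightarrow> d y z < \<delta> \<Longrightarrow> P z - 1 / (2 * k) * d y z \<le> P y"
          using * unfolding inf_stationary_iff by blast
        obtain y where y: "y \<in> A" "0 < d y z" "d y z < \<delta>" "P y \<le> P z - d y z / k"
          using descent[of z \<delta>] z \<delta> bounded[of z] \<phi>_nonneg[of z] \<open>\<phi> z \<noteq> 0\<close> by force
        have "d y z / k \<le> 1 / (2 * k) * d y z" using \<delta>(2)[OF y(1-3)] y(4) by linarith
        then show False using k y(2) by (simp add: field_simps)
      qed
      then have "z \<in> \<Omega>" using z by (simp add: \<Omega>)
      moreover have "inf_stationary d f \<Omega> z"
        unfolding inf_stationary_iff
      proof (intro conjI allI impI)
        fix e :: real assume "e > 0"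
        then obtain \<delta> where "\<delta> > 0"
          "\<And>y. y \<in> A \<Longrightarrow> 0 < d y z \<and> d y z < \<delta> \<Longrightarrow> P z - e * d y z \<le> P y"
          using * unfolding inf_stationary_iff by blast
        then show "\<exists>\<delta>>0. \<forall>y\<in>\<Omega>. 0 < d y z \<and> d y z < \<delta> \<longrightarrow> f z - e * d y z \<le> f y"
          using \<open>z \<in> \<Omega>\<close> P_\<Omega> \<Omega> by (metis (no_types, lifting))
      qed fact
      ultimately show "z \<in> \<Omega> \<and> inf_stationary d f \<Omega> z" by blast
    next
      assume *: "z \<in> \<Omega> \<and> inf_stationary d f \<Omega> z"
      show "inf_stationary d P A z"
        unfolding inf_stationary_iff
      proof (intro conjI allI impI)
        fix e :: real assume e: "e > 0"
        then have e': "e / (k + 1) > 0" using k by simp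
        then obtain \<delta> where "\<delta> > 0"
          and \<delta>: "\<And>y. y \<in> \<Omega> \<Longrightarrow> 0 < d y z \<and> d y z < \<delta> \<Longrightarrow> f z - e / (k + 1) * d y z \<le> f y"
          using * unfolding inf_stationary_iff by blast
        have "P z - e * d y z \<le> P y" if y: "y \<in> A" "d y z < min 1 (\<delta> / (k + 1))" for y
        proof -
          have "\<nu> y \<le> M + 1" using near[of y z] y z bounded[of z] by auto
          then obtain w where w: "w \<in> \<Omega>" "d w y \<le> k * \<phi> y" "f w + \<phi> y \<le> P y"
            using exact y by blast
          then have dw: "d w z \<le> (k + 1) * d y z" using dist_project * y by (auto simp: \<Omega>)
          also have "\<dots> < \<delta>" using y(2) k by (simp add: field_simps)
          finally have "d w z < \<delta>" .
          have "0 \<le> d w z" using d_nonneg w z by (simp add: \<Omega>)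
          have "f z - e / (k + 1) * d w z \<le> f w"
          proof (cases "d w z = 0")
            case True
            then show ?thesis using f0[of w z] w z bounded[of z] by (auto simp: \<Omega>)
          next
            case False
            then show ?thesis using \<delta>[of w] w \<open>0 \<le> d w z\<close> \<open>d w z < \<delta>\<close> by auto
          qed
          moreover have "e / (k + 1) * d w z \<le> e / (k + 1) * ((k + 1) * d y z)"
            using dw e' by (intro mult_left_mono) auto
          moreover have "e / (k + 1) * ((k + 1) * d y z) = e * d y z" using k by simp
          ultimately show ?thesis using w(3) \<phi>_nonneg[of y] P_\<Omega>[of z] * by simp
        qed
        moreover have "min 1 (\<delta> / (k + 1)) > 0" using \<open>\<delta> > 0\<close> k by simp
        ultimately show "\<exists>\<delta>>0. \<forall>y\<in>A. 0 < d y z \<and> d y z < \<delta> \<longrightarrow> P z - e * d y z \<le> P y"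
          by blast
      qed fact
    qed
    show "completely_exact d A f \<phi> lam (sublevel A (penalty f \<phi> lam) c)"
      using 1 2 3 4 unfolding completely_exact_def sublevel_def P_def \<Omega>_def by blast
  qed
qed

section \<open>Strong measurability\<close>

text \<open>The condition in Pettis' theorem, required everywhere and not only almost everywhere.
  Strong measurability is this property up to a null set.\<close>

definition separably_measurable :: "'a measure \<Rightarrow> ('a \<Rightarrow> 'b::real_normed_vector) \<Rightarrow> bool" where
  "separably_measurable M f \<longleftrightarrow>
     f \<in> borel_measurable M \<and> (\<exists>D. countable D \<and> (\<forall>x\<in>space M. f x \<in> closure D))"

lemma separably_measurable_limit:
  assumes "\<And>n. separably_measurable M (f n)" "\<And>x. x \<in> space M \<Longrightarrow> (\<lambda>n. f n x) \<longlonglongrightarrow> g x"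
  shows "separably_measurable M g"
proof -
  have "\<forall>n. \<exists>D. countable D \<and> (\<forall>x\<in>space M. f n x \<in> closure D)"
    using assms(1) by (auto simp: separably_measurable_def)
  then obtain D where D: "\<And>n. countable (D n)" "\<And>n x. x \<in> space M \<Longrightarrow> f n x \<in> closure (D n)"
    by metis
  have "g \<in> borel_measurable M"
    using assms by (intro borel_measurable_LIMSEQ_metric[of f M g]) (auto simp: separably_measurable_def)
  moreover have "g x \<in> closure (\<Union>n. D n)" if "x \<in> space M" for x
  proof -
    have "f n x \<in> closure (\<Union>n. D n)" for n
      using D(2)[OF that, of n] closure_mono[of "D n" "\<Union>n. D n"] by blast
    then show ?thesis using assms(2)[OF that] closed_closure by (metis closed_sequentially)
  qed
  ultimately show ?thesis
    using D(1) unfolding separably_measurable_def by (intro conjI exI[of _ "\<Union>n. D n"]) auto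
qed

lemma separably_measurable_simple: "simple_function M f \<Longrightarrow> separably_measurable M f"
  unfolding separably_measurable_def
  by (intro conjI exI[of _ "f ` space M"] borel_measurable_simple_function)
    (auto simp: simple_function_def countable_finite intro: closure_subset[THEN subsetD])

text \<open>Approximate \<open>f x\<close> by a nearest point among the first members of a sequence
  whose closure contains the range. Choosing the least index that attains the minimum makes the
  choice measurable, and only finitely many indices compete at each stage.\<close>

lemma separably_measurable_simple_limit:
  assumes "separably_measurable M f"
  obtains s where "\<And>i::nat. simple_function M (s i)" "\<And>x. x \<in> space M \<Longrightarrow> (\<lambda>i. s i x) \<longlonglongrightarrow> f x"
proof (cases "space M = {}")
  case True
  then show ?thesis by (intro that[of "\<lambda>_ _. 0"]) auto
next
  case False
  obtain D where f[measurable]: "f \<in> borel_measurable M" and D: "countable D" "\<And>x. x \<in> space M \<Longrightarrow> f x \<in> closure D"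
    using assms by (auto simp: separably_measurable_def)
  have "D \<noteq> {}" using False D(2) by auto
  then obtain d :: "nat \<Rightarrow> 'b" where d: "range d = D" using D(1) uncountable_def by metis
  define k where "k i x = (LEAST m. m \<le> i \<and> (\<forall>j\<in>{..i}. dist (f x) (d m) \<le> dist (f x) (d j)))" for i x
  have k: "k i x \<le> i \<and> (\<forall>j\<in>{..i}. dist (f x) (d (k i x)) \<le> dist (f x) (d j))" for i x
    unfolding k_def
  proof (rule LeastI_ex)
    obtain m where "m \<in> {..i}" "\<And>j. j \<in> {..i} \<Longrightarrow> dist (f x) (d m) \<le> dist (f x) (d j)"
      using ex_is_arg_min_if_finite[of "{..i}" "\<lambda>j. dist (f x) (d j)"]
      by (auto simp: is_arg_min_linorder)
    then show "\<exists>m\<le>i. \<forall>j\<in>{..i}. dist (f x) (d m) \<le> dist (f x) (d j)" by auto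
  qed
  have [measurable]: "(\<lambda>x. dist (f x) c) \<in> borel_measurable M" for c
    by (rule measurable_compose[OF f, of "\<lambda>y. dist y c" borel])
      (intro borel_measurable_continuous_onI continuous_intros)
  have [measurable]: "k i \<in> measurable M (count_space UNIV)" for i
    unfolding k_def by measurable
  show ?thesis
  proof
    show "simple_function M (\<lambda>x. d (k i x))" for i
    proof (rule simple_function_compose1[where f="k i" and g=d])
      show "simple_function M (k i)"
        unfolding simple_function_def
      proof (intro conjI ballI)
        have "k i ` space M \<subseteq> {..i}" using k by blast
        then show "finite (k i ` space M)" by (rule finite_subset) simp
        show "k i -` {y} \<inter> space M \<in> sets M" for y
          by (rule measurable_sets[of "k i" M "count_space UNIV"]) auto
      qed
    qed
    show "(\<lambda>i. d (k i x)) \<longlonglongrightarrow> f x" if x: "x \<in> space M" for x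
      unfolding lim_sequentially
    proof (intro allI impI)
      fix e :: real assume "e > 0"
      then obtain y where "y \<in> D" "dist y (f x) < e"
        using D(2)[OF x] by (auto simp: closure_approachable)
      then obtain m where m: "dist (d m) (f x) < e" using d by auto
      show "\<exists>no. \<forall>n\<ge>no. dist (d (k n x)) (f x) < e"
      proof (intro exI allI impI)
        fix n assume "m \<le> n"
        then have "dist (f x) (d (k n x)) \<le> dist (f x) (d m)" using k by auto
        then show "dist (d (k n x)) (f x) < e" using m by (simp add: dist_commute)
      qed
    qed
  qed
qed

lemma strongly_measurable_simple: "simple_function M f \<Longrightarrow> strongly_measurable M f"
  unfolding strongly_measurable_def by (intro exI[of _ "\<lambda>_. f"]) auto

text \<open>Resetting functions to 0 on a null set turns almost everywhere limits into everywhere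
  limits. Through the right-hand side, limits of strongly measurable functions are treated without a
  diagonal choice of simple functions.\<close>

lemma strongly_measurable_iff:
  "strongly_measurable M f \<longleftrightarrow> (\<exists>g. separably_measurable M g \<and> (AE x in M. f x = g x))"
proof
  assume "strongly_measurable M f"
  then obtain s where s: "\<And>i::nat. simple_function M (s i)" "AE x in M. (\<lambda>i. s i x) \<longlonglongrightarrow> f x"
    by (auto simp: strongly_measurable_def)
  obtain N where N: "N \<in> null_sets M" "\<And>x. x \<in> space M \<Longrightarrow> x \<notin> N \<Longrightarrow> (\<lambda>i. s i x) \<longlonglongrightarrow> f x"
    by (rule AE_E3[OF s(2)]) blast
  have "separably_measurable M (\<lambda>x. if x \<in> N then 0 else f x)"
  proof (rule separably_measurable_limit)
    show "separably_measurable M (\<lambda>x. if x \<in> N then 0 else s n x)" for n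
      using N(1) s(1) by (intro separably_measurable_simple simple_function_If_set)
        (auto simp: Int_absorb1 Int_absorb2 null_setsD2 sets.sets_into_space)
  qed (use N in auto)
  then show "\<exists>g. separably_measurable M g \<and> (AE x in M. f x = g x)"
    using AE_not_in[OF N(1)] by (intro exI conjI) (assumption, auto)
next
  assume "\<exists>g. separably_measurable M g \<and> (AE x in M. f x = g x)"
  then obtain g where g: "separably_measurable M g" "AE x in M. f x = g x" by blast
  obtain s where s: "\<And>i::nat. simple_function M (s i)" "\<And>x. x \<in> space M \<Longrightarrow> (\<lambda>i. s i x) \<longlonglongrightarrow> g x"
    using separably_measurable_simple_limit[OF g(1)] by blast
  have "AE x in M. (\<lambda>i. s i x) \<longlonglongrightarrow> f x"
    using g(2) AE_space by eventually_elim (use s in auto)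
  then show "strongly_measurable M f" using s unfolding strongly_measurable_def by blast
qed

lemma strongly_measurable_cong_AE:
  assumes "strongly_measurable M f" "AE x in M. g x = f x"
  shows "strongly_measurable M g"
proof -
  obtain h where "separably_measurable M h" "AE x in M. f x = h x"
    using assms(1) strongly_measurable_iff by blast
  moreover have "AE x in M. g x = h x" using assms(2) calculation(2) by eventually_elim simp
  ultimately show ?thesis using strongly_measurable_iff by blast
qed

lemma strongly_measurable_limit_AE:
  assumes "\<And>n. strongly_measurable M (f n)" "AE x in M. (\<lambda>n. f n x) \<longlonglongrightarrow> g x"
  shows "strongly_measurable M g"
proof -
  have "\<forall>n. \<exists>g. separably_measurable M g \<and> (AE x in M. f n x = g x)"
    using assms(1) unfolding strongly_measurable_iff by blast
  then obtain h where h: "\<And>n. separably_measurable M (h n)" "\<And>n. AE x in M. f n x = h n x"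
    using choice[of "\<lambda>n g. separably_measurable M g \<and> (AE x in M. f n x = g x)"] by blast
  have "AE x in M. (\<forall>n. f n x = h n x)" using h(2) by (subst AE_all_countable) auto
  then have lim: "AE x in M. (\<lambda>n. h n x) \<longlonglongrightarrow> g x" using assms(2) by eventually_elim simp
  obtain N where N: "N \<in> null_sets M" "\<And>x. x \<in> space M \<Longrightarrow> x \<notin> N \<Longrightarrow> (\<lambda>n. h n x) \<longlonglongrightarrow> g x"
    by (rule AE_E3[OF lim]) blast
  have "separably_measurable M (\<lambda>x. if x \<in> N then 0 else g x)"
  proof (rule separably_measurable_limit)
    fix n
    obtain D where hb[measurable]: "h n \<in> borel_measurable M"
      and D: "countable D" "\<And>x. x \<in> space M \<Longrightarrow> h n x \<in> closure D"
      using h(1)[of n] by (auto simp: separably_measurable_def)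
    have [measurable]: "N \<in> sets M" using N(1) by auto
    show "separably_measurable M (\<lambda>x. if x \<in> N then 0 else h n x)"
      unfolding separably_measurable_def
    proof (intro conjI exI[of _ "insert 0 D"])
      show "\<forall>x\<in>space M. (if x \<in> N then 0 else h n x) \<in> closure (insert 0 D)"
        using D(2) closure_mono[of D "insert 0 D"] closure_subset[of "insert 0 D"] by auto
    qed (use D in auto)
  qed (use N in auto)
  then show ?thesis
    using AE_not_in[OF N(1)] unfolding strongly_measurable_iff by (intro exI conjI) (assumption, auto)
qed

lemma strongly_measurable_compose2:
  assumes "strongly_measurable M f" "strongly_measurable M g"
    and "continuous_on UNIV (\<lambda>(x, y). h x y)"
  shows "strongly_measurable M (\<lambda>x. h (f x) (g x))"
proof -
  obtain s where s: "\<And>i::nat. simple_function M (s i)" "AE x in M. (\<lambda>i. s i x) \<longlonglongrightarrow> f x"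
    using assms(1) by (auto simp: strongly_measurable_def)
  obtain t where t: "\<And>i::nat. simple_function M (t i)" "AE x in M. (\<lambda>i. t i x) \<longlonglongrightarrow> g x"
    using assms(2) by (auto simp: strongly_measurable_def)
  have "AE x in M. (\<lambda>i. h (s i x) (t i x)) \<longlonglongrightarrow> h (f x) (g x)"
    using s(2) t(2)
  proof eventually_elim
    case (elim x)
    have "(\<lambda>i. (\<lambda>(x, y). h x y) (s i x, t i x)) \<longlonglongrightarrow> (\<lambda>(x, y). h x y) (f x, g x)"
      using assms(3) elim
      by (intro isCont_tendsto_compose[where g="\<lambda>(x, y). h x y"] tendsto_Pair)
        (auto simp: continuous_on_eq_continuous_within)
    then show ?case by simp
  qed
  then show ?thesis
    unfolding strongly_measurable_def
    by (intro exI[of _ "\<lambda>i x. h (s i x) (t i x)"]) (auto intro: simple_function_compose2[OF s(1) t(1)])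
qed

lemma strongly_measurable_compose:
  assumes "strongly_measurable M f" "continuous_on UNIV h"
  shows "strongly_measurable M (\<lambda>x. h (f x))"
  using strongly_measurable_compose2[OF assms(1,1), of "\<lambda>x _. h x"]
    continuous_on_compose2[OF assms(2) continuous_on_fst[OF continuous_on_id]]
  by (auto simp: case_prod_beta)

lemma strongly_measurable_add:
  "strongly_measurable M f \<Longrightarrow> strongly_measurable M g \<Longrightarrow> strongly_measurable M (\<lambda>x. f x + g x)"
  by (rule strongly_measurable_compose2[where h="(+)"])
    (auto simp: case_prod_beta intro!: continuous_intros)

lemma strongly_measurable_diff:
  "strongly_measurable M f \<Longrightarrow> strongly_measurable M g \<Longrightarrow> strongly_measurable M (\<lambda>x. f x - g x)"
  by (rule strongly_measurable_compose2[where h="(-)"])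
    (auto simp: case_prod_beta intro!: continuous_intros)

lemma strongly_measurable_scaleR_const:
  "strongly_measurable M f \<Longrightarrow> strongly_measurable M (\<lambda>x. c *\<^sub>R f x)"
  by (rule strongly_measurable_compose) (auto intro!: continuous_intros)

lemma strongly_measurable_indicator:
  assumes "strongly_measurable M f" "A \<inter> space M \<in> sets M"
  shows "strongly_measurable M (\<lambda>x. indicator A x *\<^sub>R f x)"
proof -
  have "simple_function M (indicator (A \<inter> space M) :: _ \<Rightarrow> real)"
    using assms(2) by auto
  then have "simple_function M (indicator A :: _ \<Rightarrow> real)"
    by (subst simple_function_cong[where g="indicator (A \<inter> space M)"]) (auto simp: indicator_def)
  from strongly_measurable_simple[OF this] assms(1) show ?thesis
    by (rule strongly_measurable_compose2) (auto simp: case_prod_beta intro!: continuous_intros)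
qed

lemma strongly_measurable_sum:
  "(\<And>i. i \<in> I \<Longrightarrow> strongly_measurable M (f i)) \<Longrightarrow> strongly_measurable M (\<lambda>x. \<Sum>i\<in>I. f i x)"
proof (induction I rule: infinite_finite_induct)
  case (insert i I)
  then show ?case by (simp add: strongly_measurable_add)
qed (auto intro!: strongly_measurable_simple)

text \<open>Superposition with a Caratheodory function \<open>V\<close>: for simple \<open>u\<close>
  the composition is a finite sum of functions \<open>V t c\<close> cut off by indicators, and
  continuity in the second argument passes to the limit. It serves both the input integrand and the
  running cost.\<close>

lemma strongly_measurable_parametric:
  assumes u: "strongly_measurable M u"
    and V: "\<And>c. strongly_measurable M (\<lambda>t. V t c)" "\<And>t. t \<in> space M \<Longrightarrow> continuous_on UNIV (V t)"
  shows "strongly_measurable M (\<lambda>t. V t (u t))"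
proof -
  obtain s where s: "\<And>i::nat. simple_function M (s i)" "AE x in M. (\<lambda>i. s i x) \<longlonglongrightarrow> u x"
    using u by (auto simp: strongly_measurable_def)
  show ?thesis
  proof (rule strongly_measurable_limit_AE)
    fix i
    have fin: "finite (s i ` space M)" using s(1) by (auto simp: simple_function_def)
    have sum: "strongly_measurable M (\<lambda>t. \<Sum>c\<in>s i ` space M. indicator (s i -` {c}) t *\<^sub>R V t c)"
      using s(1) V(1) by (intro strongly_measurable_sum strongly_measurable_indicator)
        (auto simp: simple_function_def)
    have "V t (s i t) = (\<Sum>c\<in>s i ` space M. indicator (s i -` {c}) t *\<^sub>R V t c)"
      if "t \<in> space M" for t
    proof -
      have "(\<Sum>c\<in>s i ` space M. indicator (s i -` {c}) t *\<^sub>R V t c) =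
          (\<Sum>c\<in>s i ` space M. if c = s i t then V t c else 0)"
        by (intro sum.cong) (auto simp: indicator_def)
      then show ?thesis using fin that by (simp add: sum.delta')
    qed
    then show "strongly_measurable M (\<lambda>t. V t (s i t))"
      by (intro strongly_measurable_cong_AE[OF sum]) (auto intro!: AE_I2)
  next
    show "AE t in M. (\<lambda>i. V t (s i t)) \<longlonglongrightarrow> V t (u t)"
      using s(2) AE_space
    proof eventually_elim
      case (elim t)
      then show ?case
        using V(2)[of t]
        by (intro isCont_tendsto_compose[where g="V t"]) (auto simp: continuous_on_eq_continuous_within)
    qed
  qed
qed

text \<open>Completeness of Lebesgue measure: all subsets of the exceptional null set are
  measurable, and preimages under \<open>f\<close> and \<open>g\<close> differ only by such
  subsets.\<close>

lemma measurable_lebesgue_on_AE: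
  assumes J: "J \<in> sets lebesgue" and g: "g \<in> borel_measurable (lebesgue_on J)"
    and ae: "AE x in lebesgue_on J. f x = g x"
  shows "f \<in> borel_measurable (lebesgue_on J)"
proof (rule measurableI)
  fix A :: "'b set" assume "A \<in> sets borel"
  then have gA: "g -` A \<inter> J \<in> sets (lebesgue_on J)" using measurable_sets[OF g] by fastforce
  obtain N where N: "N \<in> null_sets (lebesgue_on J)" "\<And>x. x \<in> J \<Longrightarrow> x \<notin> N \<Longrightarrow> f x = g x"
    by (rule AE_E3[OF ae]) auto
  have NJ: "N \<in> null_sets lebesgue" "N \<subseteq> J"
    using N(1) null_sets_restrict_space[OF J] by (auto simp: null_sets_restrict_space J)
  have sub: "B \<in> sets (lebesgue_on J)" if "B \<subseteq> N" for B
    using that NJ null_sets_completion_subset[of B N lborel] J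
    by (auto simp: sets_restrict_space_iff)
  have "f -` A \<inter> J = (g -` A \<inter> J - (g -` A \<inter> N)) \<union> (f -` A \<inter> N)"
    using N(2) NJ(2) by auto
  moreover have "\<dots> \<in> sets (lebesgue_on J)"
    using gA sub[of "g -` A \<inter> N"] sub[of "f -` A \<inter> N"] by (intro sets.Un sets.Diff) auto
  ultimately show "f -` A \<inter> space (lebesgue_on J) \<in> sets (lebesgue_on J)" by simp
qed simp

lemma borel_measurable_of_strongly_measurable:
  assumes "J \<in> sets lebesgue" "strongly_measurable (lebesgue_on J) f"
  shows "f \<in> borel_measurable (lebesgue_on J)"
  using assms measurable_lebesgue_on_AE unfolding strongly_measurable_iff separably_measurable_def by metis

text \<open>A subset of the real line is separable, hence so is its continuous image, whatever the
  codomain.\<close>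

lemma strongly_measurable_continuous:
  fixes f :: "real \<Rightarrow> 'a::real_normed_vector"
  assumes "continuous_on J f"
  shows "strongly_measurable (lebesgue_on J) f"
proof -
  obtain D where D: "countable D" "D \<subseteq> J" "J \<subseteq> closure D" using separable by blast
  have "f \<in> borel_measurable (restrict_space borel J)"
    using assms by (rule borel_measurable_continuous_on_restrict)
  then have "f \<in> borel_measurable (lebesgue_on J)"
    by (rule measurable_compose[rotated])
      (auto intro!: measurable_restrict_space3 measurable_completion simp: measurable_lborel1)
  moreover have "f x \<in> closure (f ` D)" if x: "x \<in> J" for x
  proof -
    obtain d where d: "\<And>n::nat. d n \<in> D" "d \<longlonglongrightarrow> x"
      using D(3) x by (meson closure_sequential subsetD)
    then have "(\<lambda>n. f (d n)) \<longlonglongrightarrow> f x"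
      using assms x D(2) by (auto simp: continuous_on_sequentially o_def subset_iff)
    then show ?thesis using d(1) closure_sequential by (metis image_eqI)
  qed
  ultimately show ?thesis
    unfolding strongly_measurable_iff separably_measurable_def using D(1)
    by (intro exI[of _ f] conjI exI[of _ "f ` D"]) auto
qed

section \<open>Square integrable functions and Bochner integrals\<close>

lemma integrable_mult_of_squares:
  fixes a b :: "'a \<Rightarrow> real"
  assumes "a \<in> borel_measurable M" "b \<in> borel_measurable M"
    and "integrable M (\<lambda>x. (a x)\<^sup>2)" "integrable M (\<lambda>x. (b x)\<^sup>2)"
  shows "integrable M (\<lambda>x. a x * b x)"
proof (rule Bochner_Integration.integrable_bound)
  show "integrable M (\<lambda>x. (a x)\<^sup>2 + (b x)\<^sup>2)" using assms by simp
  have "\<bar>p * q\<bar> \<le> \<bar>p\<^sup>2 + q\<^sup>2\<bar>" for p q :: real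
    using sum_squares_bound[of p q] sum_squares_bound[of p "- q"] by (simp add: abs_le_iff)
  then show "AE x in M. norm (a x * b x) \<le> norm ((a x)\<^sup>2 + (b x)\<^sup>2)" by simp
qed (use assms in simp)

lemma Cauchy_Schwarz_integral:
  fixes a b :: "'a \<Rightarrow> real"
  assumes ab: "a \<in> borel_measurable M" "b \<in> borel_measurable M"
    and a2: "integrable M (\<lambda>x. (a x)\<^sup>2)" and b2: "integrable M (\<lambda>x. (b x)\<^sup>2)"
  shows "(\<integral>x. a x * b x \<partial>M) \<le> sqrt (\<integral>x. (a x)\<^sup>2 \<partial>M) * sqrt (\<integral>x. (b x)\<^sup>2 \<partial>M)"
proof -
  define A B C where "A = (\<integral>x. (a x)\<^sup>2 \<partial>M)" and "B = (\<integral>x. (b x)\<^sup>2 \<partial>M)"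
    and "C = (\<integral>x. a x * b x \<partial>M)"
  note int = a2 b2 integrable_mult_of_squares[OF assms]
  have "A \<ge> 0" "B \<ge> 0" by (auto simp: A_def B_def)
  have quad: "0 \<le> A - 2 * y * C + y\<^sup>2 * B" for y
  proof -
    have "0 \<le> (\<integral>x. (a x - y * b x)\<^sup>2 \<partial>M)" by simp
    also have "(\<lambda>x. (a x - y * b x)\<^sup>2) = (\<lambda>x. (a x)\<^sup>2 - 2 * y * (a x * b x) + y\<^sup>2 * (b x)\<^sup>2)"
      by (auto simp: power2_eq_square algebra_simps)
    finally show ?thesis using int by (simp add: A_def B_def C_def)
  qed
  have "C\<^sup>2 \<le> A * B"
  proof (cases "B = 0")
    case True
    have "C = 0"
    proof (rule ccontr)
      assume "C \<noteq> 0"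
      \<comment> \<open>For B = 0 the quadratic is affine in \<open>y\<close>, and this
        \<open>y\<close> gives it the value -1.\<close>
      then show False using quad[of "(A + 1) / (2 * C)"] True by (simp add: field_simps)
    qed
    then show ?thesis using True by simp
  next
    case False
    then show ?thesis using quad[of "C / B"] \<open>B \<ge> 0\<close> by (simp add: power2_eq_square field_simps)
  qed
  then have "\<bar>C\<bar> \<le> sqrt (A * B)" by (metis real_sqrt_abs real_sqrt_le_iff)
  then show ?thesis by (simp add: A_def B_def C_def real_sqrt_mult)
qed

lemma L2_norm_measurable:
  assumes "J \<in> sets lebesgue" "u \<in> L2 J"
  shows "(\<lambda>t. norm (u t)) \<in> borel_measurable (lebesgue_on J)"
  using assms by (intro measurable_compose[OF borel_measurable_of_strongly_measurable borel_measurable_norm])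
    (auto simp: L2_def)

lemma L2_norm_nonneg [simp]: "0 \<le> L2_norm J u" by (simp add: L2_norm_def)

lemma L2_norm_squared: "(L2_norm J u)\<^sup>2 = (LINT t|lebesgue_on J. (norm (u t))\<^sup>2)"
  by (simp add: L2_norm_def)

lemma L2_integrable_mult:
  assumes "J \<in> sets lebesgue" "u \<in> L2 J" "v \<in> L2 J"
  shows "integrable (lebesgue_on J) (\<lambda>t. norm (u t) * norm (v t))"
    and "(LINT t|lebesgue_on J. norm (u t) * norm (v t)) \<le> L2_norm J u * L2_norm J v"
  using assms integrable_mult_of_squares[of "\<lambda>t. norm (u t)" "lebesgue_on J" "\<lambda>t. norm (v t)"]
    Cauchy_Schwarz_integral[of "\<lambda>t. norm (u t)" "lebesgue_on J" "\<lambda>t. norm (v t)"]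
    L2_norm_measurable[OF assms(1,2)] L2_norm_measurable[OF assms(1,3)]
  by (auto simp: L2_def L2_norm_def)

lemma L2_cmult:
  assumes "u \<in> L2 J"
  shows "(\<lambda>t. c *\<^sub>R u t) \<in> L2 J" and "L2_norm J (\<lambda>t. c *\<^sub>R u t) = \<bar>c\<bar> * L2_norm J u"
  using assms strongly_measurable_scaleR_const[of "lebesgue_on J" u c]
  by (auto simp: L2_def L2_norm_def power_mult_distrib real_sqrt_mult)

lemma L2_plus:
  assumes J: "J \<in> sets lebesgue" and u: "u \<in> L2 J" and v: "v \<in> L2 J"
  shows "(\<lambda>t. u t + v t) \<in> L2 J" and "L2_norm J (\<lambda>t. u t + v t) \<le> L2_norm J u + L2_norm J v"
proof -
  note int = L2_integrable_mult[OF assms]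
  have sm: "strongly_measurable (lebesgue_on J) (\<lambda>t. u t + v t)"
    using u v by (auto simp: L2_def intro: strongly_measurable_add)
  let ?g = "\<lambda>t. (norm (u t))\<^sup>2 + 2 * (norm (u t) * norm (v t)) + (norm (v t))\<^sup>2"
  have g: "integrable (lebesgue_on J) ?g" using int u v by (auto simp: L2_def)
  have le: "(norm (u t + v t))\<^sup>2 \<le> ?g t" for t
  proof -
    have "(norm (u t + v t))\<^sup>2 \<le> (norm (u t) + norm (v t))\<^sup>2"
      by (intro power_mono norm_triangle_ineq) simp
    then show ?thesis by (simp add: power2_sum)
  qed
  have i: "integrable (lebesgue_on J) (\<lambda>t. (norm (u t + v t))\<^sup>2)"
  proof (rule Bochner_Integration.integrable_bound[OF g])
    have "(\<lambda>t. norm (u t + v t)) \<in> borel_measurable (lebesgue_on J)"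
      by (rule measurable_compose[OF borel_measurable_of_strongly_measurable[OF J sm] borel_measurable_norm])
    then show "(\<lambda>t. (norm (u t + v t))\<^sup>2) \<in> borel_measurable (lebesgue_on J)" by simp
    show "AE t in lebesgue_on J. norm ((norm (u t + v t))\<^sup>2) \<le> norm (?g t)"
      using le by (intro AE_I2) (simp add: abs_of_nonneg)
  qed
  with sm show "(\<lambda>t. u t + v t) \<in> L2 J" by (simp add: L2_def)
  have "(L2_norm J (\<lambda>t. u t + v t))\<^sup>2 \<le> (LINT t|lebesgue_on J. ?g t)"
    unfolding L2_norm_squared using le g i by (intro integral_mono) auto
  also have "\<dots> = (L2_norm J u)\<^sup>2 + 2 * (LINT t|lebesgue_on J. norm (u t) * norm (v t)) + (L2_norm J v)\<^sup>2"
    unfolding L2_norm_squared using int(1) u v by (simp add: L2_def)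
  also have "\<dots> \<le> (L2_norm J u + L2_norm J v)\<^sup>2"
    using int(2) by (simp add: power2_sum)
  finally show "L2_norm J (\<lambda>t. u t + v t) \<le> L2_norm J u + L2_norm J v"
    by (rule power2_le_imp_le) simp
qed

lemma L2_minus:
  assumes "J \<in> sets lebesgue" "u \<in> L2 J" "v \<in> L2 J"
  shows "(\<lambda>t. u t - v t) \<in> L2 J" and "L2_norm J (\<lambda>t. u t - v t) \<le> L2_norm J u + L2_norm J v"
  using L2_plus[OF assms(1,2) L2_cmult(1)[OF assms(3), of "-1"]] L2_cmult(2)[OF assms(3), of "-1"]
  by auto

lemma L2_norm_minus_commute: "L2_norm J (\<lambda>t. u t - v t) = L2_norm J (\<lambda>t. v t - u t)"
  by (simp add: L2_norm_def norm_minus_commute)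

lemma L2_norm_triangle:
  assumes "J \<in> sets lebesgue" "u \<in> L2 J" "v \<in> L2 J" "w \<in> L2 J"
  shows "L2_norm J (\<lambda>t. u t - w t) \<le> L2_norm J (\<lambda>t. u t - v t) + L2_norm J (\<lambda>t. v t - w t)"
  using L2_plus(2)[OF assms(1) L2_minus(1)[OF assms(1,2,3)] L2_minus(1)[OF assms(1,3,4)]] by simp

lemma L2_zero: "(\<lambda>_. 0) \<in> L2 J" and L2_norm_zero: "L2_norm J (\<lambda>_. 0) = 0"
  by (auto simp: L2_def L2_norm_def intro!: strongly_measurable_simple)

lemma L2_nn_integral:
  assumes "u \<in> L2 J"
  shows "(\<integral>\<^sup>+t. ennreal ((norm (u t))\<^sup>2) \<partial>lebesgue_on J) = ennreal ((L2_norm J u)\<^sup>2)"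
  unfolding L2_norm_squared using assms by (intro nn_integral_eq_integral) (auto simp: L2_def)

text \<open>Riesz-Fischer: the integral of the telescoping series of norms is finite, hence the sequence
  converges almost everywhere; the distance to the limit is estimated by Fatou's lemma.\<close>

lemma L2_geometric_limit:
  fixes v :: "nat \<Rightarrow> real \<Rightarrow> 'a::banach"
  assumes J: "J \<in> lmeasurable" and v: "\<And>n. v n \<in> L2 J" and q: "0 \<le> q" "q < 1"
    and step: "\<And>n. L2_norm J (\<lambda>t. v (Suc n) t - v n t) \<le> c * q ^ n"
  obtains u where "u \<in> L2 J" "\<And>n. L2_norm J (\<lambda>t. v n t - u t) \<le> c / (1 - q) * q ^ n"
proof -
  have Js: "J \<in> sets lebesgue" using J by blast
  have c: "c \<ge> 0" using order_trans[OF L2_norm_nonneg step[of 0]] by simp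
  have c': "c / (1 - q) \<ge> 0" using c q by simp
  define w where "w n t = v (Suc n) t - v n t" for n t
  have w: "w n \<in> L2 J" for n unfolding w_def by (rule L2_minus[OF Js v v])
  \<comment> \<open>On a set of finite measure the constant 1 is square integrable. By
    Cauchy-Schwarz the steps are then summable in L^1, which gives convergence almost
    everywhere.\<close>
  have one: "(\<lambda>_. 1::real) \<in> L2 J"
    using J by (auto simp: L2_def intro!: strongly_measurable_simple integrable_const
        finite_measure_lebesgue_on finite_measure.integrable_const)
  define K where "K = L2_norm J (\<lambda>_. 1::real)"
  have wm: "(\<lambda>t. norm (w n t)) \<in> borel_measurable (lebesgue_on J)" for n
    by (rule L2_norm_measurable[OF Js w])
  have int1: "(\<integral>\<^sup>+t. norm (w n t) \<partial>lebesgue_on J) \<le> ennreal (K * c * q ^ n)" for n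
  proof -
    have "(\<integral>\<^sup>+t. norm (w n t) \<partial>lebesgue_on J) = ennreal (LINT t|lebesgue_on J. norm (w n t) * norm (1::real))"
      using L2_integrable_mult(1)[OF Js w one, of n] by (subst nn_integral_eq_integral) auto
    also have "(LINT t|lebesgue_on J. norm (w n t) * norm (1::real)) \<le> L2_norm J (w n) * K"
      unfolding K_def by (rule L2_integrable_mult(2)[OF Js w one])
    also have "L2_norm J (w n) * K \<le> c * q ^ n * K"
      using step[of n] by (intro mult_right_mono) (auto simp: w_def[abs_def] K_def)
    finally show ?thesis by (simp add: ac_simps ennreal_leI)
  qed
  have "(\<integral>\<^sup>+t. (\<Sum>n. ennreal (norm (w n t))) \<partial>lebesgue_on J) = (\<Sum>n. \<integral>\<^sup>+t. norm (w n t) \<partial>lebesgue_on J)"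
    using wm by (intro nn_integral_suminf) auto
  also have "\<dots> \<le> (\<Sum>n. ennreal (K * c * q ^ n))" using int1 by (intro suminf_le) auto
  also have "\<dots> < top"
  proof -
    have "summable (\<lambda>n. K * c * q ^ n)" using q by (intro summable_mult summable_geometric) simp
    then have "(\<Sum>n. ennreal (K * c * q ^ n)) \<noteq> top"
      by (rule ennreal_suminf_neq_top) (use q c in \<open>simp add: K_def\<close>)
    then show ?thesis by (simp add: less_top)
  qed
  finally have "(\<integral>\<^sup>+t. (\<Sum>n. ennreal (norm (w n t))) \<partial>lebesgue_on J) \<noteq> \<infinity>" by auto
  then have "AE t in lebesgue_on J. (\<Sum>n. ennreal (norm (w n t))) \<noteq> \<infinity>"
    using wm by (intro nn_integral_noteq_infinite) auto
  then have conv: "AE t in lebesgue_on J. convergent (\<lambda>n. v n t)"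
  proof eventually_elim
    case (elim t)
    then have "summable (\<lambda>n. norm (w n t))" by (intro summable_suminf_not_top) auto
    then have "summable (\<lambda>n. w n t)" by (rule summable_norm_cancel)
    then have "convergent (\<lambda>n. (\<Sum>k<n. w k t) + v 0 t)"
      by (intro convergent_add convergent_const) (simp add: summable_iff_convergent)
    moreover have "(\<Sum>k<n. w k t) + v 0 t = v n t" for n
      by (induction n) (auto simp: w_def algebra_simps)
    ultimately show ?case by simp
  qed
  define u where "u t = lim (\<lambda>n. v n t)" for t
  have lim: "AE t in lebesgue_on J. (\<lambda>n. v n t) \<longlonglongrightarrow> u t"
    using conv unfolding u_def by eventually_elim (rule convergent_LIMSEQ_iff[THEN iffD1])
  have u: "strongly_measurable (lebesgue_on J) u"
    using v by (intro strongly_measurable_limit_AE[OF _ lim]) (simp add: L2_def)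
  have dist: "L2_norm J (\<lambda>t. v n t - v (n + m) t) \<le> c / (1 - q) * q ^ n" for n m
  proof -
    \<comment> \<open>With the exact partial geometric sum as bound the induction closes; the bound
      is weakened afterwards.\<close>
    have "L2_norm J (\<lambda>t. v n t - v (n + m) t) \<le> c / (1 - q) * (q ^ n - q ^ (n + m))"
    proof (induction m)
      case (Suc m)
      have "L2_norm J (\<lambda>t. v n t - v (n + Suc m) t) \<le>
          L2_norm J (\<lambda>t. v n t - v (n + m) t) + L2_norm J (\<lambda>t. v (n + m) t - v (n + Suc m) t)"
        by (rule L2_norm_triangle[OF Js v v v])
      also have "L2_norm J (\<lambda>t. v (n + m) t - v (n + Suc m) t) \<le> c * q ^ (n + m)"
        using step[of "n + m"] by (simp add: L2_norm_minus_commute)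
      finally have "L2_norm J (\<lambda>t. v n t - v (n + Suc m) t) \<le>
          c / (1 - q) * (q ^ n - q ^ (n + m)) + c * q ^ (n + m)" using Suc by simp
      also have "\<dots> = c / (1 - q) * (q ^ n - q ^ (n + Suc m))" using q by (simp add: field_simps)
      finally show ?case .
    qed (simp add: L2_norm_zero)
    also have "\<dots> \<le> c / (1 - q) * q ^ n" using c' q by (intro mult_left_mono) auto
    finally show ?thesis .
  qed
  have vu_sm: "strongly_measurable (lebesgue_on J) (\<lambda>t. v n t - u t)" for n
    using v u by (auto simp: L2_def intro: strongly_measurable_diff)
  have vu_meas: "(\<lambda>t. norm (v n t - u t)) \<in> borel_measurable (lebesgue_on J)" for n
    by (rule measurable_compose[OF borel_measurable_of_strongly_measurable[OF Js vu_sm] borel_measurable_norm])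
  have fatou: "(\<integral>\<^sup>+t. ennreal ((norm (v n t - u t))\<^sup>2) \<partial>lebesgue_on J) \<le> ennreal ((c / (1 - q) * q ^ n)\<^sup>2)" for n
  proof -
    have "AE t in lebesgue_on J. ennreal ((norm (v n t - u t))\<^sup>2) =
        liminf (\<lambda>m. ennreal ((norm (v n t - v (n + m) t))\<^sup>2))"
      using lim
    proof eventually_elim
      case (elim t)
      then have "(\<lambda>m. v (n + m) t) \<longlonglongrightarrow> u t"
        using LIMSEQ_ignore_initial_segment[of "\<lambda>m. v m t" "u t" n] by (simp add: add.commute)
      then have "(\<lambda>m. ennreal ((norm (v n t - v (n + m) t))\<^sup>2)) \<longlonglongrightarrow> ennreal ((norm (v n t - u t))\<^sup>2)"
        by (intro tendsto_ennrealI tendsto_intros)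
      then show ?case by (intro lim_imp_Liminf[symmetric]) auto
    qed
    then have "(\<integral>\<^sup>+t. ennreal ((norm (v n t - u t))\<^sup>2) \<partial>lebesgue_on J) =
        (\<integral>\<^sup>+t. liminf (\<lambda>m. ennreal ((norm (v n t - v (n + m) t))\<^sup>2)) \<partial>lebesgue_on J)"
      by (rule nn_integral_cong_AE)
    also have "\<dots> \<le> liminf (\<lambda>m. \<integral>\<^sup>+t. ennreal ((norm (v n t - v (n + m) t))\<^sup>2) \<partial>lebesgue_on J)"
    proof (rule nn_integral_liminf)
      fix m
      have "(\<lambda>t. norm (v n t - v (n + m) t)) \<in> borel_measurable (lebesgue_on J)"
        by (rule L2_norm_measurable[OF Js L2_minus(1)[OF Js v v]])
      then show "(\<lambda>t. ennreal ((norm (v n t - v (n + m) t))\<^sup>2)) \<in> borel_measurable (lebesgue_on J)"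
        by simp
    qed
    also have "\<dots> \<le> ennreal ((c / (1 - q) * q ^ n)\<^sup>2)"
    proof (rule Liminf_le)
      show "\<forall>\<^sub>F m in sequentially. (\<integral>\<^sup>+t. ennreal ((norm (v n t - v (n + m) t))\<^sup>2) \<partial>lebesgue_on J)
          \<le> ennreal ((c / (1 - q) * q ^ n)\<^sup>2)"
        using dist L2_nn_integral[OF L2_minus(1)[OF Js v v]]
        by (intro always_eventually allI) (simp add: ennreal_leI power_mono)
    qed simp
    finally show ?thesis .
  qed
  \<comment> \<open>Fatou's lemma controls the difference before \<open>u\<close> is known to be
    square integrable; membership of \<open>u\<close> follows by subtraction.\<close>
  have vu: "(\<lambda>t. v n t - u t) \<in> L2 J" for n
    unfolding L2_def
  proof (intro CollectI conjI vu_sm integrableI_bounded)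
    show "(\<lambda>t. (norm (v n t - u t))\<^sup>2) \<in> borel_measurable (lebesgue_on J)" using vu_meas[of n] by simp
    show "(\<integral>\<^sup>+t. ennreal (norm ((norm (v n t - u t))\<^sup>2)) \<partial>lebesgue_on J) < \<infinity>"
      using fatou[of n] by (simp add: le_less_trans[OF _ ennreal_less_top])
  qed
  show ?thesis
  proof
    show "u \<in> L2 J" using L2_minus(1)[OF Js v vu, of 0 0] by simp
    show "L2_norm J (\<lambda>t. v n t - u t) \<le> c / (1 - q) * q ^ n" for n
    proof (rule power2_le_imp_le)
      show "(L2_norm J (\<lambda>t. v n t - u t))\<^sup>2 \<le> (c / (1 - q) * q ^ n)\<^sup>2"
        using fatou[of n] by (simp add: L2_nn_integral[OF vu])
      show "0 \<le> c / (1 - q) * q ^ n" using c' q by (intro mult_nonneg_nonneg) auto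
    qed
  qed
qed

section \<open>Existence of Bochner integrals and their behaviour under bounded linear maps\<close>

lemma simple_bochner_integral_dist:
  fixes f :: "'a \<Rightarrow> 'b::real_normed_vector"
  assumes s: "Bochner_Integration.simple_bochner_integrable M s" and t: "Bochner_Integration.simple_bochner_integrable M t"
    and [measurable]: "(\<lambda>x. norm (f x - s x)) \<in> borel_measurable M" "(\<lambda>x. norm (f x - t x)) \<in> borel_measurable M"
  shows "ennreal (norm (Bochner_Integration.simple_bochner_integral M s - Bochner_Integration.simple_bochner_integral M t)) \<le>
    (\<integral>\<^sup>+x. norm (f x - s x) \<partial>M) + (\<integral>\<^sup>+x. norm (f x - t x) \<partial>M)"
proof -
  have "ennreal (norm (Bochner_Integration.simple_bochner_integral M s - Bochner_Integration.simple_bochner_integral M t)) =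
      norm (Bochner_Integration.simple_bochner_integral M (\<lambda>x. s x - t x))"
    using s t by (subst simple_bochner_integral_diff) auto
  also have "\<dots> \<le> Bochner_Integration.simple_bochner_integral M (\<lambda>x. norm (s x - t x))"
    using simple_bochner_integrable_compose2[of "(-)" M s t] s t
    by (auto intro!: simple_bochner_integral_norm_bound)
  also have "\<dots> = (\<integral>\<^sup>+x. norm (s x - t x) \<partial>M)"
    using simple_bochner_integrable_compose2[of "\<lambda>x y. norm (x - y)" M s t] s t
    by (auto intro!: simple_bochner_integral_eq_nn_integral)
  also have "\<dots> \<le> (\<integral>\<^sup>+x. ennreal (norm (f x - s x)) + ennreal (norm (f x - t x)) \<partial>M)"
  proof (intro nn_integral_mono)
    fix x
    have "norm (s x - t x) \<le> norm (f x - s x) + norm (f x - t x)"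
      by (metis dual_order.refl norm_diff_triangle_le norm_minus_commute)
    then show "ennreal (norm (s x - t x)) \<le> ennreal (norm (f x - s x)) + ennreal (norm (f x - t x))"
      by (simp flip: ennreal_plus add: ennreal_leI)
  qed
  also have "\<dots> = (\<integral>\<^sup>+x. norm (f x - s x) \<partial>M) + (\<integral>\<^sup>+x. norm (f x - t x) \<partial>M)"
    by (rule nn_integral_add) auto
  finally show ?thesis .
qed

text \<open>Bochner's criterion. Truncated simple approximants are dominated by a multiple of the
  norm of the function, so they converge to it in L^1, and their integrals form a Cauchy
  sequence.\<close>

lemma has_bochner_exists:
  fixes f :: "real \<Rightarrow> 'b::banach"
  assumes J: "J \<in> sets lebesgue" and f: "strongly_measurable (lebesgue_on J) f"
    and int: "integrable (lebesgue_on J) (\<lambda>x. norm (f x))"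
  shows "\<exists>I. has_bochner (lebesgue_on J) f I"
proof -
  let ?M = "lebesgue_on J"
  have fb: "f \<in> borel_measurable ?M" by (rule borel_measurable_of_strongly_measurable[OF J f])
  obtain h where h: "separably_measurable ?M h" "AE x in ?M. f x = h x"
    using f unfolding strongly_measurable_iff by blast
  have hb: "h \<in> borel_measurable ?M" using h(1) by (simp add: separably_measurable_def)
  have nhb [measurable]: "(\<lambda>x. norm (h x)) \<in> borel_measurable ?M"
    by (rule measurable_compose[OF hb borel_measurable_norm])
  obtain s where s: "\<And>i::nat. simple_function ?M (s i)" "\<And>x. x \<in> space ?M \<Longrightarrow> (\<lambda>i. s i x) \<longlonglongrightarrow> h x"
    using separably_measurable_simple_limit[OF h(1)] by blast
  have ns [measurable]: "(\<lambda>x. norm (s i x)) \<in> borel_measurable ?M" for i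
    by (rule borel_measurable_simple_function[OF simple_function_compose1[OF s(1)]])
  \<comment> \<open>Any factor above 1 would do: where \<open>h x\<close> is not 0 the truncation is
    eventually inactive, and where \<open>h x\<close> is 0 the truncated functions vanish.\<close>
  define r where "r i x = (if norm (s i x) \<le> 2 * norm (h x) then s i x else 0)" for i x
  have r: "simple_function ?M (r i)" for i
  proof -
    have "{x \<in> space ?M. norm (s i x) \<le> 2 * norm (h x)} \<in> sets ?M" by measurable
    then show ?thesis unfolding r_def[abs_def] by (intro simple_function_If s(1)) auto
  qed
  have r_lim: "(\<lambda>i. r i x) \<longlonglongrightarrow> h x" if x: "x \<in> space ?M" for x
  proof (cases "h x = 0")
    case True
    then have "r i x = 0" for i by (simp add: r_def)
    then show ?thesis using True by simp
  next
    case False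
    have "(\<lambda>i. norm (s i x)) \<longlonglongrightarrow> norm (h x)" using s(2)[OF x] by (rule tendsto_norm)
    moreover have "norm (h x) < 2 * norm (h x)" using False by simp
    ultimately have "\<forall>\<^sub>F i in sequentially. norm (s i x) < 2 * norm (h x)" by (rule order_tendstoD)
    then have "\<forall>\<^sub>F i in sequentially. s i x = r i x"
      by eventually_elim (simp add: r_def)
    then show ?thesis using s(2)[OF x] by (rule Lim_transform_eventually[rotated])
  qed
  have r_bound: "norm (r i x) \<le> 2 * norm (h x)" for i x by (simp add: r_def)
  have fin: "(\<integral>\<^sup>+x. ennreal (3 * norm (h x)) \<partial>?M) < \<infinity>"
  proof -
    have "integrable ?M (\<lambda>x. norm (h x))"
      using int h(2) by (subst integrable_cong_AE[of _ _ "\<lambda>x. norm (f x)"])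
        (auto intro: measurable_compose[OF fb borel_measurable_norm])
    then have "integrable ?M (\<lambda>x. 3 * norm (h x))" by simp
    then show ?thesis by (simp add: nn_integral_eq_integral)
  qed
  have sbi: "Bochner_Integration.simple_bochner_integrable ?M (r i)" for i
  proof (rule simple_bochner_integrableI_bounded[OF r])
    have "(\<integral>\<^sup>+x. norm (r i x) \<partial>?M) \<le> (\<integral>\<^sup>+x. ennreal (3 * norm (h x)) \<partial>?M)"
    proof (intro nn_integral_mono ennreal_leI)
      show "norm (r i x) \<le> 3 * norm (h x)" for x using r_bound[of i x] norm_ge_zero[of "h x"] by linarith
    qed
    then show "(\<integral>\<^sup>+x. norm (r i x) \<partial>?M) < \<infinity>" using fin by (rule le_less_trans)
  qed
  have fr [measurable]: "(\<lambda>x. norm (f x - r i x)) \<in> borel_measurable ?M" for i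
    by (rule measurable_compose[OF borel_measurable_of_strongly_measurable[OF J
            strongly_measurable_diff[OF f strongly_measurable_simple[OF r]]] borel_measurable_norm])
  have lim0: "(\<lambda>i. \<integral>\<^sup>+x. norm (f x - r i x) \<partial>?M) \<longlonglongrightarrow> 0"
  proof -
    have "(\<lambda>i. \<integral>\<^sup>+x. ennreal (norm (f x - r i x)) \<partial>?M) \<longlonglongrightarrow> (\<integral>\<^sup>+x. 0 \<partial>?M)"
    proof (rule nn_integral_dominated_convergence[where w="\<lambda>x. ennreal (3 * norm (h x))"])
      fix i
      show "AE x in ?M. ennreal (norm (f x - r i x)) \<le> ennreal (3 * norm (h x))"
        using h(2)
      proof eventually_elim
        case (elim x)
        have "norm (f x - r i x) \<le> norm (f x) + norm (r i x)" by (rule norm_triangle_ineq4)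
        then show ?case using r_bound[of i x] elim by (intro ennreal_leI) simp
      qed
    next
      show "AE x in ?M. (\<lambda>i. ennreal (norm (f x - r i x))) \<longlonglongrightarrow> 0"
        using h(2) AE_space
      proof eventually_elim
        case (elim x)
        then have "(\<lambda>i. norm (f x - r i x)) \<longlonglongrightarrow> norm (f x - f x)"
          using r_lim[of x] by (intro tendsto_intros) auto
        then show ?case by (auto dest: tendsto_ennrealI)
      qed
    qed (use fin in auto)
    then show ?thesis by simp
  qed
  have "Cauchy (\<lambda>i. Bochner_Integration.simple_bochner_integral ?M (r i))"
  proof (rule metric_CauchyI)
    fix e :: real assume "0 < e"
    then have "0 < ennreal (e / 2)" by simp
    then have "\<forall>\<^sub>F i in sequentially. (\<integral>\<^sup>+x. norm (f x - r i x) \<partial>?M) < ennreal (e / 2)"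
      using order_tendstoD(2)[OF lim0] by blast
    then obtain N where N: "\<And>i. i \<ge> N \<Longrightarrow> (\<integral>\<^sup>+x. norm (f x - r i x) \<partial>?M) < ennreal (e / 2)"
      by (auto simp: eventually_sequentially)
    show "\<exists>N. \<forall>i\<ge>N. \<forall>j\<ge>N. dist (Bochner_Integration.simple_bochner_integral ?M (r i)) (Bochner_Integration.simple_bochner_integral ?M (r j)) < e"
    proof (intro exI allI impI)
      fix i j assume "N \<le> i" "N \<le> j"
      have "ennreal (norm (Bochner_Integration.simple_bochner_integral ?M (r i) - Bochner_Integration.simple_bochner_integral ?M (r j))) \<le>
          (\<integral>\<^sup>+x. norm (f x - r i x) \<partial>?M) + (\<integral>\<^sup>+x. norm (f x - r j x) \<partial>?M)"
        by (rule simple_bochner_integral_dist[OF sbi sbi fr fr])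
      also have "\<dots> < ennreal (e / 2) + ennreal (e / 2)"
        using N[OF \<open>N \<le> i\<close>] N[OF \<open>N \<le> j\<close>] by (rule add_strict_mono)
      also have "\<dots> = ennreal e" using \<open>0 < e\<close> by (simp flip: ennreal_plus)
      finally show "dist (Bochner_Integration.simple_bochner_integral ?M (r i)) (Bochner_Integration.simple_bochner_integral ?M (r j)) < e"
        using \<open>0 < e\<close> by (simp add: dist_norm ennreal_less_iff)
    qed
  qed
  then obtain I where "(\<lambda>i. Bochner_Integration.simple_bochner_integral ?M (r i)) \<longlonglongrightarrow> I"
    by (auto simp: convergent_def dest!: Cauchy_convergent)
  then show ?thesis using fb sbi lim0 unfolding has_bochner_def by blast
qed

text \<open>The passage from vector-valued integrals to ordinary ones: with a real functional
  \<open>g\<close> the whole theory of Lebesgue integrals applies to the right-hand side.\<close>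

lemma has_bochner_bounded_linear:
  fixes g :: "'b::real_normed_vector \<Rightarrow> 'c::{banach, second_countable_topology}"
  assumes f: "has_bochner M f I" and g: "bounded_linear g"
  shows "has_bochner_integral M (\<lambda>x. g (f x)) (g I)"
proof -
  interpret g: bounded_linear g by fact
  obtain K where K: "K > 0" "\<And>x. norm (g x) \<le> norm x * K" using g.pos_bounded by blast
  obtain s where fb: "f \<in> borel_measurable M" and s: "\<And>i::nat. Bochner_Integration.simple_bochner_integrable M (s i)"
    and lim: "(\<lambda>i. \<integral>\<^sup>+x. norm (f x - s i x) \<partial>M) \<longlonglongrightarrow> 0"
      "(\<lambda>i. Bochner_Integration.simple_bochner_integral M (s i)) \<longlonglongrightarrow> I"
    using f unfolding has_bochner_def by blast
  have gcont: "continuous_on UNIV g" by (rule g.continuous_on) (rule continuous_on_id)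
  show ?thesis
  proof (rule has_bochner_integral.intros[where s="\<lambda>i x. g (s i x)"])
    show "(\<lambda>x. g (f x)) \<in> borel_measurable M"
      by (rule measurable_compose[OF fb borel_measurable_continuous_onI[OF gcont]])
    show "Bochner_Integration.simple_bochner_integrable M (\<lambda>x. g (s i x))" for i
      using simple_bochner_integrable_compose2[of "\<lambda>x _. g x" M "s i" "s i"] s g.zero by simp
    show "(\<lambda>i. Bochner_Integration.simple_bochner_integral M (\<lambda>x. g (s i x))) \<longlonglongrightarrow> g I"
      using g.tendsto[OF lim(2)] by (simp add: simple_bochner_integral_linear[OF g.linear s])
    show "(\<lambda>i. \<integral>\<^sup>+x. norm (g (f x) - g (s i x)) \<partial>M) \<longlonglongrightarrow> 0"
    proof (rule tendsto_sandwich[OF _ _ tendsto_const])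
      have "(\<lambda>i. ennreal K * (\<integral>\<^sup>+x. norm (f x - s i x) \<partial>M)) \<longlonglongrightarrow> ennreal K * 0"
        by (intro ennreal_tendsto_cmult lim) auto
      then show "(\<lambda>i. ennreal K * (\<integral>\<^sup>+x. norm (f x - s i x) \<partial>M)) \<longlonglongrightarrow> 0" by simp
      have "(\<integral>\<^sup>+x. norm (g (f x) - g (s i x)) \<partial>M) \<le> ennreal K * (\<integral>\<^sup>+x. norm (f x - s i x) \<partial>M)" for i
      proof -
        have si: "simple_function M (s i)" using s[of i] by (auto elim: simple_bochner_integrable.cases)
        have m: "(\<lambda>x. norm (f x - s i x)) \<in> borel_measurable M"
        proof -
          \<comment> \<open>In a non-separable space subtraction need not be measurable for the
            product sigma-algebra. The finitely many values of \<open>s i\<close> form a countable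
            space, over which measurability may be checked for each value separately.\<close>
          have "(\<lambda>x. (s i x, f x)) \<in> measurable M (count_space (s i ` space M) \<Otimes>\<^sub>M borel)"
            using fb si by (intro measurable_Pair)
              (auto simp: simple_function_def intro!: measurable_count_space_eq2[THEN iffD2])
          moreover have "(\<lambda>(c, y). norm (y - c)) \<in> borel_measurable (count_space (s i ` space M) \<Otimes>\<^sub>M borel)"
            using si by (intro measurable_pair_measure_countable1)
              (auto simp: simple_function_def countable_finite intro!: borel_measurable_continuous_onI continuous_intros)
          ultimately show ?thesis by (auto dest: measurable_compose)
        qed
        have "(\<integral>\<^sup>+x. norm (g (f x) - g (s i x)) \<partial>M) \<le> (\<integral>\<^sup>+x. ennreal K * norm (f x - s i x) \<partial>M)"
          using K by (intro nn_integral_mono) (simp flip: g.diff ennreal_mult' add: ennreal_leI mult.commute)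
        also have "\<dots> = ennreal K * (\<integral>\<^sup>+x. norm (f x - s i x) \<partial>M)" using m by (intro nn_integral_cmult) simp
        finally show ?thesis .
      qed
      then show "\<forall>\<^sub>F i in sequentially. (\<integral>\<^sup>+x. norm (g (f x) - g (s i x)) \<partial>M)
          \<le> ennreal K * (\<integral>\<^sup>+x. norm (f x - s i x) \<partial>M)" by simp
    qed simp
  qed
qed

section \<open>Translation, extension by zero and restriction of square integrable functions\<close>

lemma translation_measurable: "(\<lambda>t::real. t + a) \<in> lebesgue \<rightarrow>\<^sub>M lebesgue"
  using lebesgue_affine_measurable[where c="\<lambda>_::real. 1" and t=a] by (simp add: add.commute)

lemma distr_lebesgue_translation: "distr lebesgue lebesgue (\<lambda>t::real. t + a) = lebesgue"
  using lebesgue_real_affine[of 1 a] by (simp add: density_1 add.commute)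

lemma L2_UNIV_shift:
  assumes "u \<in> L2 UNIV"
  shows "(\<lambda>t. u (t + a)) \<in> L2 UNIV" and "L2_norm UNIV (\<lambda>t. u (t + a)) = L2_norm UNIV u"
proof -
  obtain s where s: "\<And>i::nat. simple_function lebesgue (s i)" "AE t in lebesgue. (\<lambda>i. s i t) \<longlonglongrightarrow> u t"
    using assms by (auto simp: L2_def strongly_measurable_def lebesgue_on_UNIV_eq)
  have "AE t in distr lebesgue lebesgue (\<lambda>t. t + a). (\<lambda>i. s i t) \<longlonglongrightarrow> u t"
    using s(2) by (subst distr_lebesgue_translation)
  then have "AE t in lebesgue. (\<lambda>i. s i (t + a)) \<longlonglongrightarrow> u (t + a)"
    by (rule AE_distrD[OF translation_measurable])
  then have "strongly_measurable lebesgue (\<lambda>t. u (t + a))"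
    using simple_function_comp[OF translation_measurable s(1)]
    unfolding strongly_measurable_def by (intro exI[of _ "\<lambda>i t. s i (t + a)"]) auto
  then show "(\<lambda>t. u (t + a)) \<in> L2 UNIV" "L2_norm UNIV (\<lambda>t. u (t + a)) = L2_norm UNIV u"
    using assms lebesgue_integrable_real_affine_iff[of 1 "\<lambda>t. (norm (u t))\<^sup>2" a]
      lebesgue_integral_real_affine[of 1 "\<lambda>t. (norm (u t))\<^sup>2" a]
    by (auto simp: L2_def L2_norm_def lebesgue_on_UNIV_eq add.commute)
qed

lemma L2_extend:
  assumes J: "J \<in> sets lebesgue" and u: "u \<in> L2 J"
  shows "(\<lambda>t. indicator J t *\<^sub>R u t) \<in> L2 UNIV"
    and "L2_norm UNIV (\<lambda>t. indicator J t *\<^sub>R u t) = L2_norm J u"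
proof -
  obtain s where s: "\<And>i::nat. simple_function (lebesgue_on J) (s i)"
      "AE t in lebesgue_on J. (\<lambda>i. s i t) \<longlonglongrightarrow> u t"
    using u by (auto simp: L2_def strongly_measurable_def)
  have "AE t in lebesgue. t \<in> J \<longrightarrow> (\<lambda>i. s i t) \<longlonglongrightarrow> u t"
    using s(2) J by (subst (asm) AE_restrict_space_iff) auto
  then have "AE t in lebesgue. (\<lambda>i. indicator J t *\<^sub>R s i t) \<longlonglongrightarrow> indicator J t *\<^sub>R u t"
    by eventually_elim (auto simp: indicator_def)
  moreover have "simple_function lebesgue (\<lambda>t. indicator J t *\<^sub>R s i t)" for i
    using s(1)[of i] J by (subst (asm) simple_function_restrict_space) auto
  ultimately have sm: "strongly_measurable lebesgue (\<lambda>t. indicator J t *\<^sub>R u t)"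
    unfolding strongly_measurable_def by (intro exI[of _ "\<lambda>i t. indicator J t *\<^sub>R s i t"]) auto
  have eq: "(norm (indicator J t *\<^sub>R u t))\<^sup>2 = indicator J t *\<^sub>R (norm (u t))\<^sup>2" for t
    by (auto simp: indicator_def)
  show "(\<lambda>t. indicator J t *\<^sub>R u t) \<in> L2 UNIV"
  proof -
    have "integrable lebesgue (\<lambda>t. (norm (indicator J t *\<^sub>R u t))\<^sup>2)"
      unfolding eq using u J by (simp add: L2_def integrable_restrict_space)
    with sm show ?thesis unfolding L2_def lebesgue_on_UNIV_eq by blast
  qed
  show "L2_norm UNIV (\<lambda>t. indicator J t *\<^sub>R u t) = L2_norm J u"
    using J unfolding L2_norm_def eq by (simp add: lebesgue_on_UNIV_eq integral_restrict_space)
qed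

lemma L2_restrict:
  assumes J: "J \<in> sets lebesgue" and u: "u \<in> L2 UNIV"
  shows "u \<in> L2 J" and "L2_norm J u \<le> L2_norm UNIV u"
proof -
  obtain s where s: "\<And>i::nat. simple_function lebesgue (s i)" "AE t in lebesgue. (\<lambda>i. s i t) \<longlonglongrightarrow> u t"
    using u by (auto simp: L2_def strongly_measurable_def lebesgue_on_UNIV_eq)
  have "AE t in lebesgue_on J. (\<lambda>i. s i t) \<longlonglongrightarrow> u t"
    using s(2) J by (subst AE_restrict_space_iff) auto
  moreover have "simple_function (lebesgue_on J) (s i)" for i
    by (rule simple_function_comp[OF _ s(1), of "\<lambda>x. x", simplified])
      (auto intro: measurable_restrict_space1)
  ultimately have sm: "strongly_measurable (lebesgue_on J) u"
    unfolding strongly_measurable_def by blast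
  have int: "integrable lebesgue (\<lambda>t. (norm (u t))\<^sup>2)" using u by (simp add: L2_def lebesgue_on_UNIV_eq)
  then have int': "integrable lebesgue (\<lambda>t. indicator J t *\<^sub>R (norm (u t))\<^sup>2)"
    using J by (intro integrable_mult_indicator) auto
  then show "u \<in> L2 J" using sm J by (simp add: L2_def integrable_restrict_space)
  show "L2_norm J u \<le> L2_norm UNIV u"
    unfolding L2_norm_def using int int' J
    by (auto simp: lebesgue_on_UNIV_eq integral_restrict_space indicator_def intro!: real_sqrt_le_mono integral_mono)
qed

section \<open>Uniform boundedness and the Robinson-Ursescu theorem\<close>

text \<open>A complete seminormed space of functions, so that L^2 can be used without passing to
  equivalence classes. Completeness is stated for sequences with geometrically decaying steps and
  includes the rate, in the form in which the two series constructions below use it.\<close>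

locale complete_function_space =
  fixes X :: "('b \<Rightarrow> 'a::real_vector) set" and p :: "('b \<Rightarrow> 'a) \<Rightarrow> real"
  assumes zero: "(\<lambda>_. 0) \<in> X"
    and add: "x \<in> X \<Longrightarrow> y \<in> X \<Longrightarrow> (\<lambda>t. x t + y t) \<in> X"
    and scale: "x \<in> X \<Longrightarrow> (\<lambda>t. c *\<^sub>R x t) \<in> X"
    and p_add: "x \<in> X \<Longrightarrow> y \<in> X \<Longrightarrow> p (\<lambda>t. x t + y t) \<le> p x + p y"
    and p_scale: "x \<in> X \<Longrightarrow> p (\<lambda>t. c *\<^sub>R x t) = \<bar>c\<bar> * p x"
    and complete: "\<lbrakk>\<And>n::nat. v n \<in> X; 0 \<le> q; q < 1; \<And>n. p (\<lambda>t. v (Suc n) t - v n t) \<le> c * q ^ n\<rbrakk>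
      \<Longrightarrow> \<exists>u\<in>X. \<forall>n. p (\<lambda>t. v n t - u t) \<le> c / (1 - q) * q ^ n"
begin

lemma diff: "x \<in> X \<Longrightarrow> y \<in> X \<Longrightarrow> (\<lambda>t. x t - y t) \<in> X"
  using add[of x "\<lambda>t. (-1) *\<^sub>R y t"] scale[of y "-1"] by simp

lemma p_diff: "x \<in> X \<Longrightarrow> y \<in> X \<Longrightarrow> p (\<lambda>t. x t - y t) \<le> p x + p y"
  using p_add[of x "\<lambda>t. (-1) *\<^sub>R y t"] p_scale[of y "-1"] scale[of y "-1"] by simp

lemma p_nonneg: "x \<in> X \<Longrightarrow> 0 \<le> p x"
  using p_diff[of x x] p_scale[of x 0] by simp

text \<open>The gliding hump proof of Sokal: an element on which the operators are unbounded is
  constructed as the sum of a series $\sum_k \pm 3^{-k} y_k$.\<close>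

lemma uniform_boundedness:
  fixes F :: "nat \<Rightarrow> ('b \<Rightarrow> 'a) \<Rightarrow> 'c::real_normed_vector"
  assumes F_add: "\<And>n x y. x \<in> X \<Longrightarrow> y \<in> X \<Longrightarrow> F n (\<lambda>t. x t + y t) = F n x + F n y"
    and F_scale: "\<And>n x c. x \<in> X \<Longrightarrow> F n (\<lambda>t. c *\<^sub>R x t) = c *\<^sub>R F n x"
    and bounded: "\<And>n. \<exists>C. \<forall>x\<in>X. norm (F n x) \<le> C * p x"
    and pointwise: "\<And>x. x \<in> X \<Longrightarrow> \<exists>C. \<forall>n. norm (F n x) \<le> C"
  shows "\<exists>C. \<forall>n. \<forall>x\<in>X. norm (F n x) \<le> C * p x"
proof (rule ccontr)
  assume unbounded: "\<not> ?thesis"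
  define N where "N n = (SUP x\<in>{x\<in>X. p x \<le> 1}. norm (F n x))" for n
  have F_diff: "F n (\<lambda>t. x t - y t) = F n x - F n y" if "x \<in> X" "y \<in> X" for n x y
    using F_add[of x "\<lambda>t. (-1) *\<^sub>R y t" n] F_scale[of y n "-1"] scale[of y "-1"] that by simp
  have ne: "{x\<in>X. p x \<le> 1} \<noteq> {}" using zero p_scale[OF zero, of 0] by auto
  have bdd: "bdd_above ((\<lambda>x. norm (F n x)) ` {x\<in>X. p x \<le> 1})" for n
  proof -
    obtain C where C: "\<And>x. x \<in> X \<Longrightarrow> norm (F n x) \<le> C * p x" using bounded by blast
    have "norm (F n x) \<le> \<bar>C\<bar>" if "x \<in> X" "p x \<le> 1" for x
    proof -
      have "C * p x \<le> \<bar>C\<bar> * 1" using that p_nonneg[of x] by (intro mult_mono) auto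
      then show ?thesis using C[of x] that by simp
    qed
    then show ?thesis by (intro bdd_aboveI[of _ "\<bar>C\<bar>"]) auto
  qed
  have N: "norm (F n x) \<le> N n * p x" if x: "x \<in> X" for n x
  proof (cases "p x = 0")
    case True
    then show ?thesis using bounded[of n] x by auto
  next
    case False
    then have px: "p x > 0" using p_nonneg[OF x] by simp
    have "norm (F n (\<lambda>t. (1 / p x) *\<^sub>R x t)) \<le> N n"
      unfolding N_def using px x by (intro cSUP_upper[OF _ bdd]) (auto simp: scale p_scale)
    then show ?thesis using px x by (simp add: F_scale field_simps)
  qed
  have "\<exists>n. N n > 4 ^ k" for k :: nat
  proof (rule ccontr)
    assume "\<nexists>n. N n > 4 ^ k"
    then have "norm (F n x) \<le> 4 ^ k * p x" if "x \<in> X" for n x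
      using N[OF that, of n] mult_right_mono[OF _ p_nonneg[OF that], of "N n" "4 ^ k"]
      by (meson le_less_linear order_trans)
    then show False using unbounded by blast
  qed
  \<comment> \<open>Growth like 4^k outweighs the coefficients 3^(-k) of the series.\<close>
  then obtain n where n: "\<And>k. N (n k) > 4 ^ k" by metis
  \<comment> \<open>The fraction 3/4 has to exceed 1/2: the tail after term k has seminorm at most
    3^(-k)/2, so a quarter of 3^(-k) N (n k) survives, and this is more than (4/3)^k / 4.\<close>
  have "\<exists>y. y \<in> X \<and> p y \<le> 1 \<and> norm (F (n k) y) > 3 / 4 * N (n k)" for k
  proof -
    have "N (n k) > 0" using n[of k] by (meson less_trans zero_less_numeral zero_less_power)
    then have "3 / 4 * N (n k) < N (n k)" by simp
    then show ?thesis unfolding N_def using less_cSUP_iff[OF ne bdd] by auto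
  qed
  then obtain y where y: "\<And>k. y k \<in> X" "\<And>k. p (y k) \<le> 1" "\<And>k. norm (F (n k) (y k)) > 3 / 4 * N (n k)"
    by metis
  define z where "z k = (\<lambda>t. (1 / 3) ^ k *\<^sub>R y k t)" for k
  have z: "z k \<in> X" for k using y scale by (simp add: z_def)
  \<comment> \<open>The sign is chosen such that \<open>F (n k)\<close> is at least as large in norm
    on the new partial sum as on the new term alone; earlier terms cannot cancel it.\<close>
  define v where "v = rec_nat (\<lambda>_. 0) (\<lambda>k x. if norm (F (n k) (\<lambda>t. x t + z k t)) \<ge> norm (F (n k) (\<lambda>t. x t - z k t))
    then (\<lambda>t. x t + z k t) else (\<lambda>t. x t - z k t))"
  have v0: "v 0 = (\<lambda>_. 0)" and
    vS: "v (Suc k) = (if norm (F (n k) (\<lambda>t. v k t + z k t)) \<ge> norm (F (n k) (\<lambda>t. v k t - z k t))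
      then (\<lambda>t. v k t + z k t) else (\<lambda>t. v k t - z k t))" for k
    by (simp_all add: v_def)
  have v: "v k \<in> X" for k by (induction k) (auto simp: v0 vS zero add diff z)
  have step: "p (\<lambda>t. v (Suc k) t - v k t) \<le> 1 * (1 / 3) ^ k" for k
  proof -
    have "p (\<lambda>t. v (Suc k) t - v k t) = p (z k)"
      using p_scale[OF z, where c="-1"] by (auto simp: vS)
    also have "\<dots> = (1 / 3) ^ k * p (y k)" using p_scale[OF y(1)] by (simp add: z_def)
    also have "\<dots> \<le> (1 / 3) ^ k * 1" using y(2) by (intro mult_left_mono) auto
    finally show ?thesis by simp
  qed
  have large: "norm (F (n k) (v (Suc k))) \<ge> norm (F (n k) (z k))" for k
  proof -
    have "F (n k) (\<lambda>t. v k t + z k t) - F (n k) (\<lambda>t. v k t - z k t) = 2 *\<^sub>R F (n k) (z k)"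
      by (simp add: F_add F_diff v z scaleR_2)
    then have "2 * norm (F (n k) (z k)) \<le> norm (F (n k) (\<lambda>t. v k t + z k t)) + norm (F (n k) (\<lambda>t. v k t - z k t))"
      using norm_triangle_ineq4[of "F (n k) (\<lambda>t. v k t + z k t)" "F (n k) (\<lambda>t. v k t - z k t)"] by simp
    then show ?thesis by (simp add: vS)
  qed
  obtain u where u: "u \<in> X" "\<And>k. p (\<lambda>t. v k t - u t) \<le> 1 / (1 - 1 / 3) * (1 / 3) ^ k"
    using complete[of v "1/3" 1, OF v _ _ step] by auto
  obtain C where C: "\<And>k. norm (F k u) \<le> C" using pointwise[OF u(1)] by blast
  have "(4 / 3) ^ k \<le> 4 * C" for k :: nat
  proof -
    have Npos: "N (n k) > 0" using n[of k] by (meson less_trans zero_less_numeral zero_less_power)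
    have "F (n k) (v (Suc k)) = F (n k) u + F (n k) (\<lambda>t. v (Suc k) t - u t)"
      by (simp add: F_diff[OF v u(1)])
    then have "norm (F (n k) (v (Suc k))) \<le> norm (F (n k) u) + norm (F (n k) (\<lambda>t. v (Suc k) t - u t))"
      by (simp only: norm_triangle_ineq)
    moreover have "norm (F (n k) (\<lambda>t. v (Suc k) t - u t)) \<le> N (n k) * (1 / 2 * (1 / 3) ^ k)"
    proof -
      have "norm (F (n k) (\<lambda>t. v (Suc k) t - u t)) \<le> N (n k) * p (\<lambda>t. v (Suc k) t - u t)"
        by (rule N[OF diff[OF v u(1)]])
      also have "\<dots> \<le> N (n k) * (1 / 2 * (1 / 3) ^ k)"
        using u(2)[of "Suc k"] Npos by (intro mult_left_mono) auto
      finally show ?thesis .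
    qed
    moreover have "norm (F (n k) (z k)) \<ge> (1 / 3) ^ k * (3 / 4 * N (n k))"
      using y(3)[of k] by (simp add: z_def F_scale y(1) mult_left_mono)
    ultimately have "(1 / 3) ^ k * (N (n k) / 4) \<le> C"
      using large[of k] C[of "n k"] by (simp add: algebra_simps)
    moreover have "(1 / 3) ^ k * (4 ^ k / 4) \<le> (1 / 3) ^ k * (N (n k) / 4)"
      using n[of k] by (intro mult_left_mono) auto
    ultimately have "(1 / 3) ^ k * (4 ^ k / 4) \<le> C" by linarith
    then show ?thesis by (simp add: power_divide field_simps)
  qed
  moreover obtain k :: nat where "4 * C < (4 / 3) ^ k"
    using real_arch_pow[of "4 / 3" "4 * C"] by auto
  ultimately show False by (meson not_less)
qed

text \<open>A version of the Robinson-Ursescu theorem. By Baire's theorem the closure of the image of a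
  bounded part of $U$ contains a relative neighbourhood of the given point; a convex series then
  removes the closure.\<close>

lemma bounded_preimages_near_relint:
  fixes G :: "('b \<Rightarrow> 'a) \<Rightarrow> 'h::banach"
  assumes UX: "U \<subseteq> X"
    and convex: "\<And>u v s. u \<in> U \<Longrightarrow> v \<in> U \<Longrightarrow> s \<in> {0..1} \<Longrightarrow> (\<lambda>t. (1 - s) *\<^sub>R u t + s *\<^sub>R v t) \<in> U"
    and closed: "\<And>v u. (\<And>n::nat. v n \<in> U) \<Longrightarrow> u \<in> X \<Longrightarrow> (\<lambda>n. p (\<lambda>t. v n t - u t)) \<longlonglongrightarrow> 0 \<Longrightarrow> u \<in> U"
    and affine: "\<And>u v s. u \<in> U \<Longrightarrow> v \<in> U \<Longrightarrow> s \<in> {0..1} \<Longrightarrow>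
      G (\<lambda>t. (1 - s) *\<^sub>R u t + s *\<^sub>R v t) = (1 - s) *\<^sub>R G u + s *\<^sub>R G v"
    and cont: "\<And>u v. u \<in> U \<Longrightarrow> v \<in> U \<Longrightarrow> norm (G u - G v) \<le> C * p (\<lambda>t. u t - v t)"
    and y0: "y0 \<in> relint (G ` U)"
  obtains r K where "r > 0" "\<And>y. y \<in> closure (affine hull (G ` U)) \<Longrightarrow> norm (y - y0) < r \<Longrightarrow>
    \<exists>u\<in>U. G u = y \<and> p u \<le> K"
proof -
  define W where "W = closure (affine hull (G ` U))"
  have W_affine: "(1 - a) *\<^sub>R x + a *\<^sub>R y \<in> W" if xy: "x \<in> W" "y \<in> W" for a x y
  proof -
    obtain f where f: "\<And>n::nat. f n \<in> affine hull (G ` U)" "f \<longlonglongrightarrow> x"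
      using xy(1) unfolding W_def closure_sequential by blast
    obtain g where g: "\<And>n::nat. g n \<in> affine hull (G ` U)" "g \<longlonglongrightarrow> y"
      using xy(2) unfolding W_def closure_sequential by blast
    from f g have "(\<lambda>n. (1 - a) *\<^sub>R f n + a *\<^sub>R g n) \<longlonglongrightarrow> (1 - a) *\<^sub>R x + a *\<^sub>R y"
      "\<And>n. (1 - a) *\<^sub>R f n + a *\<^sub>R g n \<in> affine hull (G ` U)"
      by (auto intro!: tendsto_intros mem_affine[OF affine_affine_hull])
    then show ?thesis
      unfolding W_def closure_sequential by (intro exI[of _ "\<lambda>n. (1 - a) *\<^sub>R f n + a *\<^sub>R g n"]) auto
  qed
  have G_W: "G u \<in> W" if "u \<in> U" for u
    unfolding W_def using that by (intro closure_subset[THEN subsetD] hull_inc) auto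
  obtain V where V: "openin (top_of_set W) V" "y0 \<in> V" "V \<subseteq> G ` U"
    using y0 unfolding relint_def W_def by blast
  then obtain r0 where r0: "r0 > 0" "ball y0 r0 \<inter> W \<subseteq> V" and y0W: "y0 \<in> W"
    unfolding openin_contains_ball by (meson subsetD)
  \<comment> \<open>Countably many of these bounded parts exhaust the image of \<open>U\<close>, so
    by Baire the closure of one of them has interior points relative to \<open>W\<close> near
    \<open>y0\<close>.\<close>
  define Q where "Q k = G ` {u \<in> U. p u \<le> k}" for k :: real
  have Q_mono: "Q k \<subseteq> Q l" if "k \<le> l" for k l using that by (auto simp: Q_def)
  have Q_convex: "convex (Q k)" for k
  proof (rule convexI)
    fix x y and a b :: real assume "x \<in> Q k" "y \<in> Q k" and ab: "0 \<le> a" "0 \<le> b" "a + b = 1"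
    then obtain u v where u: "u \<in> U" "p u \<le> k" "x = G u" and v: "v \<in> U" "p v \<le> k" "y = G v"
      by (auto simp: Q_def)
    have a: "a = 1 - b" "b \<in> {0..1}" using ab by auto
    let ?w = "\<lambda>t. (1 - b) *\<^sub>R u t + b *\<^sub>R v t"
    have "p ?w \<le> p (\<lambda>t. (1 - b) *\<^sub>R u t) + p (\<lambda>t. b *\<^sub>R v t)"
      using u v UX by (intro p_add scale) auto
    also have "\<dots> = (1 - b) * p u + b * p v" using u v UX ab by (simp add: p_scale subset_iff)
    also have "\<dots> \<le> (1 - b) * k + b * k" using u v ab by (intro add_mono mult_left_mono) auto
    finally have "p ?w \<le> k" by (simp add: algebra_simps)
    then have "G ?w \<in> Q k" using convex[OF u(1) v(1) a(2)] by (auto simp: Q_def)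
    then show "a *\<^sub>R x + b *\<^sub>R y \<in> Q k"
      using affine[OF u(1) v(1) a(2)] u v a(1) by simp
  qed
  have "\<exists>k::nat. \<exists>y1 \<epsilon>. \<epsilon> > 0 \<and> y1 \<in> W \<inter> ball y0 r0 \<and> W \<inter> ball y1 \<epsilon> \<subseteq> closure (Q (real k))"
  proof (rule ccontr)
    assume contra: "\<not> ?thesis"
    \<comment> \<open>A relatively open part of the closed set \<open>W\<close> is completely
      metrizable. The affine hull itself may fail to be closed, which is why its closure is used
      throughout.\<close>
    define Y where "Y = top_of_set (W \<inter> ball y0 r0)"
    define T where "T k = closure (Q (real k)) \<inter> (W \<inter> ball y0 r0)" for k :: nat
    have top: "topspace Y = W \<inter> ball y0 r0" by (simp add: Y_def)
    have "completely_metrizable_space (top_of_set W)"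
      using completely_metrizable_space_closedin[OF completely_metrizable_space_euclidean, of W]
      by (simp add: W_def)
    then have "completely_metrizable_space Y"
      using completely_metrizable_space_openin[of "top_of_set W" "W \<inter> ball y0 r0"]
      by (simp add: Y_def openin_open_Int subtopology_subtopology Int_absorb1)
    then have "Y interior_of \<Union>(range T) = {}"
    proof (intro Baire_category_alt)
      fix S assume "S \<in> range T"
      then obtain k where S: "S = T k" by auto
      have "Y interior_of T k = {}"
      proof (rule ccontr)
        assume "Y interior_of T k \<noteq> {}"
        then obtain y1 where y1: "y1 \<in> Y interior_of T k" by blast
        then obtain O' where O': "openin Y O'" "y1 \<in> O'" "O' \<subseteq> T k" by (auto simp: interior_of_def)
        have "openin (top_of_set W) O'"
          using O'(1) openin_open_Int[of "ball y0 r0" W] openin_trans unfolding Y_def by blast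
        then obtain \<epsilon> where "\<epsilon> > 0" "ball y1 \<epsilon> \<inter> W \<subseteq> O'"
          using O'(2) unfolding openin_contains_ball by blast
        moreover have "y1 \<in> W \<inter> ball y0 r0" using O' by (auto simp: T_def)
        moreover have "W \<inter> ball y1 \<epsilon> \<subseteq> closure (Q (real k))"
          using calculation(2) O'(3) by (auto simp: T_def)
        ultimately show False using contra by blast
      qed
      moreover have "closedin Y (T k)"
        unfolding Y_def T_def by (subst Int_commute) (intro closedin_closed_Int closed_closure)
      ultimately show "closedin Y S \<and> Y interior_of S = {}" by (simp add: S)
    qed auto
    moreover have "\<Union>(range T) = topspace Y"
    proof -
      have "y \<in> \<Union>(range T)" if y: "y \<in> W \<inter> ball y0 r0" for y
      proof -
        obtain u where u: "u \<in> U" "y = G u" using y r0(2) V(3) by blast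
        obtain k :: nat where "p u \<le> real k" using real_arch_simple by blast
        then have "y \<in> Q (real k)" using u by (auto simp: Q_def)
        then show ?thesis using y closure_subset by (force simp: T_def)
      qed
      then show ?thesis unfolding top by (auto simp: T_def)
    qed
    ultimately have "topspace Y = {}" by simp
    then show False using y0W r0(1) by (auto simp: top)
  qed
  then obtain k :: nat and y1 \<epsilon> where \<epsilon>: "\<epsilon> > 0" and y1: "y1 \<in> W" and k: "W \<inter> ball y1 \<epsilon> \<subseteq> closure (Q (real k))"
    by blast
  \<comment> \<open>The point \<open>z\<close> below lies on the line from \<open>y1\<close> through
    \<open>y0\<close>, beyond \<open>y0\<close> by \<delta> times their distance. The choice of
    \<delta> keeps it within r0/2 of \<open>y0\<close>, so it is attained. The 1 in \<open>m\<close>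
    covers the case y1 = y0.\<close>
  define m where "m = norm (y1 - y0) + 1"
  have m: "m > 0" by (simp add: m_def add_nonneg_pos)
  define \<delta> where "\<delta> = r0 / (2 * m)"
  have \<delta>: "\<delta> > 0" using r0(1) m by (simp add: \<delta>_def)
  define z where "z = (1 - (1 + \<delta>)) *\<^sub>R y1 + (1 + \<delta>) *\<^sub>R y0"
  have "z - y0 = - (\<delta> *\<^sub>R (y1 - y0))" by (simp add: z_def algebra_simps)
  then have "norm (z - y0) = \<delta> * norm (y1 - y0)" using \<delta> by simp
  also have "\<dots> \<le> \<delta> * m" using \<delta> by (intro mult_left_mono) (auto simp: m_def)
  also have "\<dots> = r0 / 2" using m by (simp add: \<delta>_def)
  finally have "dist y0 z < r0" using r0(1) by (simp add: dist_norm norm_minus_commute)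
  moreover have "z \<in> W" unfolding z_def by (rule W_affine[OF y1 y0W])
  ultimately obtain us where us: "us \<in> U" "z = G us" using r0(2) V(3) by force
  define K where "K = max (real k) (p us)"
  have zQ: "z \<in> Q K" using us by (auto simp: Q_def K_def)
  have Kc: "W \<inter> ball y1 \<epsilon> \<subseteq> closure (Q K)"
    using k closure_mono[OF Q_mono[of "real k" K]] by (auto simp: K_def)
  \<comment> \<open>Here y0 = z + \<tau> (y1 - z): the homothety with centre \<open>z\<close> and
    ratio \<tau> carries the ball around \<open>y1\<close> to one of radius \<rho> around
    \<open>y0\<close>, and convexity keeps its points of \<open>W\<close> in the closure of
    \<open>Q K\<close>.\<close>
  define \<tau> where "\<tau> = \<delta> / (1 + \<delta>)"
  have \<tau>: "0 < \<tau>" "\<tau> < 1" using \<delta> by (auto simp: \<tau>_def)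
  define \<rho> where "\<rho> = \<tau> * \<epsilon>"
  have \<rho>: "\<rho> > 0" using \<tau> \<epsilon> by (simp add: \<rho>_def)
  have y0_eq: "y0 = (1 - \<tau>) *\<^sub>R z + \<tau> *\<^sub>R y1"
  proof -
    have "(1 + \<delta>) *\<^sub>R ((1 - \<tau>) *\<^sub>R z + \<tau> *\<^sub>R y1) = z + \<delta> *\<^sub>R y1"
    proof -
      have "(1 + \<delta>) * (1 - \<tau>) = 1" "(1 + \<delta>) * \<tau> = \<delta>" using \<delta> by (auto simp: \<tau>_def field_simps)
      then show ?thesis by (simp add: scaleR_add_right)
    qed
    also have "\<dots> = (1 + \<delta>) *\<^sub>R y0" by (simp add: z_def algebra_simps)
    finally show ?thesis using \<delta> by simp
  qed
  have dense: "y \<in> closure (Q K)" if y: "y \<in> W" "norm (y - y0) < \<rho>" for y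
  proof -
    define y2 where "y2 = (1 - 1 / \<tau>) *\<^sub>R z + (1 / \<tau>) *\<^sub>R y"
    have "y2 \<in> W" unfolding y2_def using G_W us y by (intro W_affine) auto
    have "\<tau> *\<^sub>R (y2 - y1) = y - y0"
      using \<tau> by (subst y0_eq) (simp add: y2_def algebra_simps)
    then have "norm (y - y0) = \<tau> * norm (y2 - y1)" using \<tau> by (metis abs_of_pos norm_scaleR)
    then have "norm (y2 - y1) < \<epsilon>" using y(2) \<tau> by (simp add: \<rho>_def)
    then have "y2 \<in> closure (Q K)" using \<open>y2 \<in> W\<close> Kc by (auto simp: dist_norm norm_minus_commute)
    moreover have "z \<in> closure (Q K)" using zQ closure_subset by blast
    ultimately have "(1 - \<tau>) *\<^sub>R z + \<tau> *\<^sub>R y2 \<in> closure (Q K)"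
      using convex_closure[OF Q_convex] \<tau> by (intro convexD) auto
    moreover have "(1 - \<tau>) *\<^sub>R z + \<tau> *\<^sub>R y2 = y" using \<tau> by (simp add: y2_def algebra_simps)
    ultimately show ?thesis by simp
  qed
  \<comment> \<open>Write \<open>y\<close> as the midpoint of \<open>G u\<close> and a remainder. If
    \<open>G u\<close> approximates the reflection of \<open>y0\<close> in \<open>y\<close>, the
    remainder is as close to \<open>y0\<close> as \<open>y\<close> was required to be, so the step
    can be iterated.\<close>
  have select: "\<exists>u. u \<in> U \<and> p u \<le> K \<and> norm (2 *\<^sub>R y - G u - y0) < \<rho> / 2"
    if y: "y \<in> W" "norm (y - y0) < \<rho> / 2" for y
  proof -
    have "(1 - 2) *\<^sub>R y0 + 2 *\<^sub>R y \<in> W" by (rule W_affine[OF y0W y(1)])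
    moreover have "(1 - 2) *\<^sub>R y0 + 2 *\<^sub>R y - y0 = 2 *\<^sub>R (y - y0)"
      by (simp add: algebra_simps scaleR_2)
    ultimately have "(1 - 2) *\<^sub>R y0 + 2 *\<^sub>R y \<in> closure (Q K)" using y(2) by (intro dense) auto
    then obtain x where "x \<in> Q K" "dist x ((1 - 2) *\<^sub>R y0 + 2 *\<^sub>R y) < \<rho> / 2"
      using \<rho> by (meson closure_approachable half_gt_zero)
    then show ?thesis
      by (auto simp: Q_def dist_norm norm_minus_commute algebra_simps)
  qed
  show ?thesis
  proof (rule that[of "\<rho> / 2" "3 * K"])
    show "\<rho> / 2 > 0" using \<rho> by simp
    fix y assume "y \<in> closure (affine hull (G ` U))" and y_near: "norm (y - y0) < \<rho> / 2"
    then have yW: "y \<in> W" by (simp add: W_def)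
    obtain ch where ch: "\<And>y. y \<in> W \<Longrightarrow> norm (y - y0) < \<rho> / 2 \<Longrightarrow>
        ch y \<in> U \<and> p (ch y) \<le> K \<and> norm (2 *\<^sub>R y - G (ch y) - y0) < \<rho> / 2"
      using select by metis
    define ys where "ys = rec_nat y (\<lambda>_ x. 2 *\<^sub>R x - G (ch x))"
    have ys0: "ys 0 = y" and ysS: "ys (Suc n) = 2 *\<^sub>R ys n - G (ch (ys n))" for n
      by (simp_all add: ys_def)
    have ys: "ys n \<in> W \<and> norm (ys n - y0) < \<rho> / 2" for n
    proof (induction n)
      case (Suc n)
      have "(1 - 2) *\<^sub>R G (ch (ys n)) + 2 *\<^sub>R ys n \<in> W"
        using Suc ch G_W by (intro W_affine) auto
      then show ?case using ch[of "ys n"] Suc by (simp add: ysS algebra_simps)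
    qed (use yW y_near in \<open>simp add: ys0\<close>)
    define w where "w n = ch (ys n)" for n
    have w: "w n \<in> U" "p (w n) \<le> K" for n using ch ys by (auto simp: w_def)
    \<comment> \<open>\<open>c n f\<close> is the sum of 2^(-i-1) f i over i < n plus 2^(-n) us,
      where \<open>us\<close> supplies the remaining weight. Recursion from the head reduces
      membership in \<open>U\<close> and the value of \<open>G\<close> to combinations of two
      controls.\<close>
    define c where "c = rec_nat (\<lambda>_. us) (\<lambda>_ f w t. (1 - 1 / 2) *\<^sub>R w 0 t + (1 / 2) *\<^sub>R f (\<lambda>i::nat. w (Suc i)) t)"
    have c0: "c 0 f = us" and
      cS: "c (Suc n) f = (\<lambda>t. (1 - 1 / 2) *\<^sub>R f 0 t + (1 / 2) *\<^sub>R c n (\<lambda>i. f (Suc i)) t)" for n f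
      by (simp_all add: c_def)
    have c_U: "c n f \<in> U" if "\<And>i. f i \<in> U" for n f
      using that
    proof (induction n arbitrary: f)
      case (Suc n)
      have "c n (\<lambda>i. f (Suc i)) \<in> U" using Suc by auto
      then show ?case unfolding cS using Suc.prems by (intro convex) auto
    qed (simp add: c0 us)
    have c_step: "c (Suc n) f t - c n f t = (1 / 2) ^ Suc n *\<^sub>R (f n t - us t)" for n f t
    proof (induction n arbitrary: f)
      case 0
      have "c (Suc 0) f t - c 0 f t = (1 - 1 / 2) *\<^sub>R f 0 t + (1 / 2) *\<^sub>R us t - (1 / 2 + 1 / 2) *\<^sub>R us t"
        by (simp add: cS c0)
      then show ?case unfolding scaleR_add_left by (simp add: scaleR_diff_right)
    next
      case (Suc n)
      have "c (Suc (Suc n)) f t - c (Suc n) f t =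
          (1 / 2) *\<^sub>R (c (Suc n) (\<lambda>i. f (Suc i)) t - c n (\<lambda>i. f (Suc i)) t)"
        unfolding cS[of "Suc n" f] cS[of n f] by (simp add: algebra_simps)
      then show ?case unfolding Suc by simp
    qed
    define B where "B = \<rho> / 2 + norm (y0 - G us)"
    \<comment> \<open>The offset \<open>j\<close> is needed because the recursion of
      \<open>c\<close> passes to the shifted sequence. Each step halves the error.\<close>
    have approx: "norm (ys j - G (c n (\<lambda>i. w (i + j)))) \<le> (1 / 2) ^ n * B" for n j
    proof (induction n arbitrary: j)
      case 0
      have "norm (ys j - G us) \<le> norm (ys j - y0) + norm (y0 - G us)"
        by (metis diff_add_cancel add_diff_eq norm_triangle_ineq)
      then show ?case using ys[of j] by (simp add: c0 B_def)
    next
      case (Suc n)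
      have "G (c (Suc n) (\<lambda>i. w (i + j))) = (1 - 1 / 2) *\<^sub>R G (w j) + (1 / 2) *\<^sub>R G (c n (\<lambda>i. w (i + Suc j)))"
        unfolding cS using w c_U by (subst affine) auto
      moreover have "ys j = (1 - 1 / 2) *\<^sub>R G (w j) + (1 / 2) *\<^sub>R ys (Suc j)"
        by (simp add: ysS w_def algebra_simps)
      ultimately have "ys j - G (c (Suc n) (\<lambda>i. w (i + j))) =
          (1 / 2) *\<^sub>R (ys (Suc j) - G (c n (\<lambda>i. w (i + Suc j))))"
        by (simp add: algebra_simps)
      then show ?case using Suc[of "Suc j"] by simp
    qed
    define v where "v n = c n w" for n
    have v: "v n \<in> U" for n using c_U w by (simp add: v_def)
    have step: "p (\<lambda>t. v (Suc n) t - v n t) \<le> K * (1 / 2) ^ n" for n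
    proof -
      have "p (\<lambda>t. v (Suc n) t - v n t) = (1 / 2) ^ Suc n * p (\<lambda>t. w n t - us t)"
        unfolding v_def c_step using w us UX by (subst p_scale) (auto intro!: diff)
      also have "\<dots> \<le> (1 / 2) ^ Suc n * (p (w n) + p us)"
        using w us UX by (intro mult_left_mono p_diff) auto
      also have "\<dots> \<le> (1 / 2) ^ Suc n * (K + K)"
        using w by (intro mult_left_mono add_mono) (auto simp: K_def)
      finally show ?thesis by (simp add: mult.commute)
    qed
    obtain u where u: "u \<in> X" "\<And>n. p (\<lambda>t. v n t - u t) \<le> K / (1 - 1 / 2) * (1 / 2) ^ n"
      using complete[of v "1/2" K] v UX step by auto
    have lim0: "(\<lambda>n. p (\<lambda>t. v n t - u t)) \<longlonglongrightarrow> 0"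
    proof (rule tendsto_sandwich[OF _ _ tendsto_const])
      show "(\<lambda>n. K / (1 - 1 / 2) * (1 / 2) ^ n) \<longlonglongrightarrow> 0"
        by (intro tendsto_mult_right_zero LIMSEQ_power_zero) simp
    qed (use u v UX in \<open>auto intro!: p_nonneg diff always_eventually\<close>)
    have uU: "u \<in> U" using v u(1) lim0 by (rule closed)
    have "(\<lambda>n. G (v n)) \<longlonglongrightarrow> G u"
    proof (rule Lim_null[THEN iffD2], rule Lim_null_comparison)
      show "\<forall>\<^sub>F n in sequentially. norm (G (v n) - G u) \<le> C * p (\<lambda>t. v n t - u t)"
        using cont v uU by simp
      show "(\<lambda>n. C * p (\<lambda>t. v n t - u t)) \<longlonglongrightarrow> 0" using lim0 by (rule tendsto_mult_right_zero)
    qed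
    moreover have "(\<lambda>n. G (v n)) \<longlonglongrightarrow> y"
    proof (rule Lim_null[THEN iffD2], rule Lim_null_comparison)
      show "\<forall>\<^sub>F n in sequentially. norm (G (v n) - y) \<le> (1 / 2) ^ n * B"
        using approx[of 0] by (simp add: v_def ys0 norm_minus_commute)
      show "(\<lambda>n. (1 / 2) ^ n * B) \<longlonglongrightarrow> 0"
        by (intro tendsto_mult_left_zero LIMSEQ_power_zero) simp
    qed
    ultimately have "G u = y" by (rule LIMSEQ_unique)
    \<comment> \<open>One \<open>K\<close> bounds \<open>us\<close>, and the distance from
      \<open>us\<close> to the limit is at most K / (1 - 1/2).\<close>
    moreover have "p u \<le> 3 * K"
    proof -
      have "p u \<le> p (\<lambda>t. us t - (us t - u t))" by simp
      also have "\<dots> \<le> p us + p (\<lambda>t. us t - u t)" using us u UX by (intro p_diff diff) auto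
      also have "p (\<lambda>t. us t - u t) \<le> 2 * K" using u(2)[of 0] by (simp add: v_def c0)
      finally show ?thesis by (simp add: K_def)
    qed
    ultimately show "\<exists>u\<in>U. G u = y \<and> p u \<le> 3 * K" using uU by blast
  qed
qed

end

section \<open>Two instances: L^2 over a set of finite measure, and Banach spaces\<close>

lemma complete_function_space_L2:
  assumes "J \<in> lmeasurable"
  shows "complete_function_space (L2 J :: (real \<Rightarrow> 'a::banach) set) (L2_norm J)"
proof -
  have J: "J \<in> sets lebesgue" using assms by blast
  show ?thesis
  proof
    fix v :: "nat \<Rightarrow> real \<Rightarrow> 'a" and q c :: real
    assume v: "\<And>n. v n \<in> L2 J" "0 \<le> q" "q < 1" "\<And>n. L2_norm J (\<lambda>t. v (Suc n) t - v n t) \<le> c * q ^ n"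
    show "\<exists>u\<in>L2 J. \<forall>n. L2_norm J (\<lambda>t. v n t - u t) \<le> c / (1 - q) * q ^ n"
      by (rule L2_geometric_limit[OF assms v]) blast
  qed (use L2_zero L2_plus[OF J] L2_cmult in auto)
qed

text \<open>A Banach space appears as the functions on a one-point set, so that uniform boundedness
  can be applied to the semigroup as well.\<close>

lemma complete_function_space_banach:
  "complete_function_space (UNIV :: (unit \<Rightarrow> 'a::banach) set) (\<lambda>x. norm (x ()))"
proof
  fix v :: "nat \<Rightarrow> unit \<Rightarrow> 'a" and q c :: real
  assume q: "0 \<le> q" "q < 1" and step: "\<And>n. norm (v (Suc n) () - v n ()) \<le> c * q ^ n"
  have dist: "norm (v n () - v (n + m) ()) \<le> c / (1 - q) * (q ^ n - q ^ (n + m))" for n m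
  proof (induction m)
    case (Suc m)
    have "norm (v n () - v (n + Suc m) ()) \<le> norm (v n () - v (n + m) ()) + norm (v (n + m) () - v (n + Suc m) ())"
      by (metis norm_diff_triangle_le order_refl)
    also have "norm (v (n + m) () - v (n + Suc m) ()) \<le> c * q ^ (n + m)"
      using step[of "n + m"] by (simp add: norm_minus_commute)
    finally have "norm (v n () - v (n + Suc m) ()) \<le>
        c / (1 - q) * (q ^ n - q ^ (n + m)) + c * q ^ (n + m)" using Suc by simp
    also have "\<dots> = c / (1 - q) * (q ^ n - q ^ (n + Suc m))" using q by (simp add: field_simps)
    finally show ?case .
  qed simp
  have "0 \<le> c" using order_trans[OF norm_ge_zero step[of 0]] by simp
  have "summable (\<lambda>n. v (Suc n) () - v n ())"
    using step q by (intro summable_comparison_test'[OF summable_mult[OF summable_geometric], of q 0 _ c]) auto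
  then have "convergent (\<lambda>n. \<Sum>k<n. v (Suc k) () - v k ())" by (simp add: summable_iff_convergent)
  then have "convergent (\<lambda>n. v n () - v 0 ())" by (simp add: sum_lessThan_telescope[of "\<lambda>k. v k ()"])
  then have "convergent (\<lambda>n. v n ())" by (simp add: convergent_diff_const_right_iff)
  then obtain l where l: "(\<lambda>n. v n ()) \<longlonglongrightarrow> l" by (auto simp: convergent_def)
  have "norm (v n () - l) \<le> c / (1 - q) * q ^ n" for n
  proof (rule tendsto_upperbound)
    show "(\<lambda>m. norm (v n () - v (n + m) ())) \<longlonglongrightarrow> norm (v n () - l)"
      using LIMSEQ_ignore_initial_segment[OF l, of n] by (intro tendsto_intros) (simp add: add.commute)
    show "\<forall>\<^sub>F m in sequentially. norm (v n () - v (n + m) ()) \<le> c / (1 - q) * q ^ n"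
    proof (intro always_eventually allI order_trans[OF dist])
      show "c / (1 - q) * (q ^ n - q ^ (n + m)) \<le> c / (1 - q) * q ^ n" for m
        using q \<open>0 \<le> c\<close> by (intro mult_left_mono) auto
    qed
  qed simp
  then show "\<exists>u\<in>UNIV. \<forall>n. norm (v n () - u ()) \<le> c / (1 - q) * q ^ n"
    by (intro bexI[of _ "\<lambda>_. l"]) auto
qed (auto intro: norm_triangle_ineq)

section \<open>Semigroups and extrapolation\<close>

lemma bounded_linear_scaleC: "bounded_linear (\<lambda>x::'a::complex_banach. c *\<^sub>C x)"
proof (rule bounded_linear_intro[where K="cmod c"])
  show "c *\<^sub>C (r *\<^sub>R x) = r *\<^sub>R (c *\<^sub>C x)" for r and x :: 'a
    by (metis mult.commute scaleC_of_real scaleC_scaleC)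
qed (auto simp: scaleC_add_right norm_scaleC)

lemma bounded_clinearD:
  assumes "bounded_clinear f"
  shows "bounded_linear f" "f (c *\<^sub>C x) = c *\<^sub>C f x"
  using assms by (auto simp: bounded_clinear_def clinear_def)

lemma dense_range_eq:
  fixes f g :: "'e::real_normed_vector \<Rightarrow> 'b::real_normed_vector"
  assumes "closure (range \<iota>) = UNIV" "continuous_on UNIV f" "continuous_on UNIV g"
    and "\<And>x. f (\<iota> x) = g (\<iota> x)"
  shows "f e = g e"
proof -
  have "closed {e. f e = g e}" using assms(2,3) by (intro closed_Collect_eq)
  moreover have "range \<iota> \<subseteq> {e. f e = g e}" using assms(4) by auto
  ultimately have "closure (range \<iota>) \<subseteq> {e. f e = g e}" by (rule closure_minimal[rotated])
  then show ?thesis using assms(1) by auto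
qed

lemma dense_extension:
  fixes \<iota> :: "'h::complex_banach \<Rightarrow> 'e::complex_banach" and G :: "'h \<Rightarrow> 'b::complex_banach"
  assumes \<iota>: "clinear \<iota>" "closure (range \<iota>) = UNIV"
    and G: "clinear G" and K: "K \<ge> 0" "\<And>x. norm (G x) \<le> K * norm (\<iota> x)"
  shows "\<exists>!E. bounded_clinear E \<and> (\<forall>x. E (\<iota> x) = G x)"
proof (rule ex_ex1I)
  interpret \<iota>: linear \<iota> using \<iota>(1) by (simp add: clinear_def)
  interpret G: linear G using G by (simp add: clinear_def)
  have G_diff: "norm (G x - G y) \<le> K * norm (\<iota> x - \<iota> y)" for x y
    using K(2)[of "x - y"] by (simp add: G.diff \<iota>.diff)
  \<comment> \<open>The bound makes \<open>G x\<close> depend on \<iota> x only, so the choice made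
    by \<open>inv\<close> does not matter even if \<iota> is not injective.\<close>
  define g where "g e = G (inv \<iota> e)" for e
  have g: "g (\<iota> x) = G x" for x
    using G_diff[of "inv \<iota> (\<iota> x)" x] by (simp add: g_def f_inv_into_f)
  have "K-lipschitz_on (range \<iota>) g"
    using K(1) G_diff by (auto intro!: lipschitz_onI simp: g dist_norm)
  then obtain h where h: "K-lipschitz_on (closure (range \<iota>)) h" "\<And>e. e \<in> range \<iota> \<Longrightarrow> h e = g e"
    using lipschitz_extend_closure by metis
  have h_\<iota>: "h (\<iota> x) = G x" for x using h(2) g by simp
  have cont: "continuous_on UNIV h" using h(1) lipschitz_on_continuous_on \<iota>(2) by metis
  have cont': "continuous_on UNIV (\<lambda>e. h (f e))" if "continuous_on UNIV f" for f :: "'e \<Rightarrow> 'e"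
    by (rule continuous_on_compose2[OF cont that]) simp
  have h_add: "h (a + b) = h a + h b" for a b
  proof -
    \<comment> \<open>Density is used for one variable at a time: here \<open>b\<close> becomes
      arbitrary while the other summand stays in the range, and then that summand is released
      too.\<close>
    have *: "h (\<iota> x + b) = h (\<iota> x) + h b" for x
    proof (rule dense_range_eq[OF \<iota>(2), where f="\<lambda>b. h (\<iota> x + b)" and g="\<lambda>b. h (\<iota> x) + h b"])
      show "h (\<iota> x + \<iota> y) = h (\<iota> x) + h (\<iota> y)" for y
        using h_\<iota>[of "x + y"] by (simp add: h_\<iota> \<iota>.add G.add)
    qed (intro cont' cont continuous_on_add continuous_on_const continuous_on_id)+
    show ?thesis
    proof (rule dense_range_eq[OF \<iota>(2), where f="\<lambda>a. h (a + b)" and g="\<lambda>a. h a + h b"])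
      show "h (\<iota> x + b) = h (\<iota> x) + h b" for x by (rule *)
    qed (intro cont' cont continuous_on_add continuous_on_const continuous_on_id)+
  qed
  have h_scaleC: "h (c *\<^sub>C a) = c *\<^sub>C h a" for c a
  proof (rule dense_range_eq[OF \<iota>(2), where f="\<lambda>a. h (c *\<^sub>C a)" and g="\<lambda>a. c *\<^sub>C h a"])
    show "h (c *\<^sub>C \<iota> x) = c *\<^sub>C h (\<iota> x)" for x
    proof -
      have "\<iota> (c *\<^sub>C x) = c *\<^sub>C \<iota> x" "G (c *\<^sub>C x) = c *\<^sub>C G x"
        using \<iota>(1) G by (auto simp: clinear_def)
      then show ?thesis using h_\<iota>[of "c *\<^sub>C x"] h_\<iota>[of x] by simp
    qed
  qed (intro cont' cont linear_continuous_on bounded_linear_scaleC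
      bounded_linear.continuous_on[OF bounded_linear_scaleC])+
  have "bounded_linear h"
  proof (rule bounded_linear_intro[where K=K])
    show "h (r *\<^sub>R a) = r *\<^sub>R h a" for r a
      using h_scaleC[of "complex_of_real r" a] by (simp add: scaleC_of_real)
    have "h 0 = 0" using h_add[of 0 0] by simp
    then show "norm (h a) \<le> norm a * K" for a
      using lipschitz_onD[OF h(1), of a 0] \<iota>(2) by (simp add: dist_norm mult.commute)
  qed (rule h_add)
  then have "bounded_clinear h"
    by (auto simp: bounded_clinear_def clinear_def h_scaleC bounded_linear.linear)
  then show "\<exists>E. bounded_clinear E \<and> (\<forall>x. E (\<iota> x) = G x)" using h_\<iota> by blast
next
  fix E E' assume E: "bounded_clinear E \<and> (\<forall>x. E (\<iota> x) = G x)" and E': "bounded_clinear E' \<and> (\<forall>x. E' (\<iota> x) = G x)"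
  show "E = E'"
  proof
    show "E e = E' e" for e
    proof (rule dense_range_eq[OF \<iota>(2)])
      show "continuous_on UNIV E" "continuous_on UNIV E'"
        using E E' by (auto intro: linear_continuous_on bounded_clinearD(1))
    qed (use E E' in simp)
  qed
qed

locale c0_semigroup =
  fixes S :: "real \<Rightarrow> 'h::complex_banach \<Rightarrow> 'h"
  assumes semigroup: "strongly_continuous_semigroup S"
begin

lemma bounded_linear: "0 \<le> t \<Longrightarrow> bounded_linear (S t)"
  and scaleC: "0 \<le> t \<Longrightarrow> S t (c *\<^sub>C x) = c *\<^sub>C S t x"
  and clinear: "0 \<le> t \<Longrightarrow> clinear (S t)"
  and S_0 [simp]: "S 0 x = x"
  and S_add: "0 \<le> s \<Longrightarrow> 0 \<le> t \<Longrightarrow> S (s + t) x = S s (S t x)"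
  and tendsto_0: "((\<lambda>t. S t x) \<longlongrightarrow> x) (at_right 0)"
  using semigroup by (auto simp: strongly_continuous_semigroup_def bounded_clinear_def clinear_def)

lemma near_0:
  assumes "e > 0"
  obtains d where "d > 0" "\<And>t. 0 \<le> t \<Longrightarrow> t < d \<Longrightarrow> norm (S t x - x) < e"
proof -
  have "\<forall>\<^sub>F t in at_right 0. dist (S t x) x < e" using tendstoD[OF tendsto_0 assms] .
  then obtain d where d: "d > 0" "\<And>t. 0 < t \<Longrightarrow> t < d \<Longrightarrow> dist (S t x) x < e"
    unfolding eventually_at_right_field by auto
  have "norm (S t x - x) < e" if "0 \<le> t" "t < d" for t
    using d(2)[of t] that assms by (cases "t = 0") (auto simp: dist_norm)
  then show ?thesis using that d(1) by blast
qed

text \<open>Otherwise there are times tending to 0 along which the operator norms are unbounded.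
  Strong continuity at 0 bounds the orbit of each vector along these times, against the uniform
  boundedness principle.\<close>

lemma bounded_near_0: "\<exists>d>0. \<exists>C. \<forall>t\<in>{0..d}. \<forall>x. norm (S t x) \<le> C * norm x"
proof (rule ccontr)
  assume *: "\<not> ?thesis"
  have "\<exists>t x. 0 \<le> t \<and> t \<le> 1 / real (Suc n) \<and> norm (S t x) > real n * norm x" for n
  proof -
    have "1 / real (Suc n) > 0" by simp
    then show ?thesis using * by (meson atLeastAtMost_iff not_less)
  qed
  then obtain t x where t: "\<And>n. 0 \<le> t n" "\<And>n. t n \<le> 1 / real (Suc n)"
    and x: "\<And>n. norm (S (t n) (x n)) > real n * norm (x n)" by metis
  interpret X: complete_function_space "UNIV :: (unit \<Rightarrow> 'h) set" "\<lambda>x. norm (x ())"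
    by (rule complete_function_space_banach)
  have t0: "t \<longlonglongrightarrow> 0"
    by (rule tendsto_sandwich[OF _ _ tendsto_const LIMSEQ_inverse_real_of_nat])
      (use t in \<open>auto simp: inverse_eq_divide\<close>)
  have "\<exists>C. \<forall>n. \<forall>x\<in>UNIV. norm (S (t n) (x ())) \<le> C * norm (x ())"
  proof (rule X.uniform_boundedness)
    fix n and y z :: "unit \<Rightarrow> 'h" and c :: real
    interpret S: bounded_linear "S (t n)" by (rule bounded_linear[OF t(1)])
    show "S (t n) (y () + z ()) = S (t n) (y ()) + S (t n) (z ())" by (rule S.add)
    show "S (t n) (c *\<^sub>R y ()) = c *\<^sub>R S (t n) (y ())" by (rule S.scale)
    show "\<exists>C. \<forall>x\<in>UNIV. norm (S (t n) (x ())) \<le> C * norm (x ())"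
      using S.bounded by (metis mult.commute)
  next
    fix y :: "unit \<Rightarrow> 'h"
    have "(\<lambda>n. S (t n) (y ())) \<longlonglongrightarrow> y ()"
    proof (rule LIMSEQ_I)
      fix e :: real assume "e > 0"
      then obtain d where d: "d > 0" "\<And>t. 0 \<le> t \<Longrightarrow> t < d \<Longrightarrow> norm (S t (y ()) - y ()) < e"
        using near_0 by metis
      obtain N where "\<And>n. n \<ge> N \<Longrightarrow> \<bar>t n\<bar> < d" using LIMSEQ_D[OF t0 d(1)] by auto
      then show "\<exists>no. \<forall>n\<ge>no. norm (S (t n) (y ()) - y ()) < e"
        using d(2) t(1) by (intro exI[of _ N]) (auto simp: abs_less_iff)
    qed
    then show "\<exists>C. \<forall>n. norm (S (t n) (y ())) \<le> C"
      using convergentI convergent_imp_Bseq by (metis BseqE)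
  qed
  then obtain C where C: "\<And>n x. norm (S (t n) x) \<le> C * norm x" by fastforce
  obtain n :: nat where "C \<le> real n" using real_arch_simple by blast
  then have "C * norm (x n) \<le> real n * norm (x n)" by (rule mult_right_mono) simp
  then show False using C[of n "x n"] x[of n] by linarith
qed

lemma bounded_on_interval: "\<exists>M\<ge>1. \<forall>t\<in>{0..T}. \<forall>x. norm (S t x) \<le> M * norm x"
proof -
  obtain d C where d: "d > 0" and C: "\<And>t x. 0 \<le> t \<Longrightarrow> t \<le> d \<Longrightarrow> norm (S t x) \<le> C * norm x"
    using bounded_near_0 by force
  define M where "M = max 1 C"
  have M: "norm (S t x) \<le> M * norm x" if "0 \<le> t" "t \<le> d" for t x
    using C[OF that, of x] mult_right_mono[of C M "norm x"] by (simp add: M_def)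
  have M1: "M \<ge> 1" by (simp add: M_def)
  have *: "\<forall>t\<in>{0..real n * d}. \<forall>x. norm (S t x) \<le> M ^ n * norm x" for n
  proof (induction n)
    case (Suc n)
    show ?case
    proof (intro ballI allI)
      fix t x assume t: "t \<in> {0..real (Suc n) * d}"
      show "norm (S t x) \<le> M ^ Suc n * norm x"
      proof (cases "t \<le> d")
        case True
        have "M * norm x \<le> M ^ Suc n * norm x" using M1 by (intro mult_right_mono) auto
        then show ?thesis using M[of t x] True t by auto
      next
        case False
        have "S t x = S d (S (t - d) x)" using S_add[of d "t - d" x] False d by simp
        also have "norm \<dots> \<le> M * norm (S (t - d) x)" using M d by simp
        also have "norm (S (t - d) x) \<le> M ^ n * norm x"
          using Suc t False by (auto simp: algebra_simps)
        finally show ?thesis using M1 by (simp add: mult.assoc)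
      qed
    qed
  qed simp
  obtain n :: nat where "T / d \<le> real n" using real_arch_simple by blast
  then have "T \<le> real n * d" using d by (simp add: field_simps)
  then show ?thesis using *[of n] M1 by (intro exI[of _ "M ^ n"]) auto
qed

lemma continuous: "continuous_on {0..} (\<lambda>t. S t x)"
  unfolding continuous_on_iff
proof (intro ballI allI impI)
  fix t e :: real assume t: "t \<in> {0..}" and e: "e > 0"
  obtain M where M: "M \<ge> 1" "\<And>s x. 0 \<le> s \<Longrightarrow> s \<le> t + 1 \<Longrightarrow> norm (S s x) \<le> M * norm x"
    using bounded_on_interval[of "t + 1"] by force
  obtain d where d: "d > 0" "\<And>s. 0 \<le> s \<Longrightarrow> s < d \<Longrightarrow> norm (S s x - x) < e / M"
    using near_0[of "e / M" x] e M by auto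
  \<comment> \<open>Continuity from the left and from the right both reduce to an increment starting
    at the smaller time \<open>r\<close>, where the bound on [0, t + 1] allows \<open>S r\<close> to
    be factored out.\<close>
  have *: "norm (S (r + h) x - S r x) < e" if "0 \<le> r" "r \<le> t + 1" "0 \<le> h" "h < d" for r h
  proof -
    interpret S: bounded_linear "S r" by (rule bounded_linear[OF that(1)])
    have "S (r + h) x - S r x = S r (S h x - x)" using S_add that by (simp add: S.diff)
    then have "norm (S (r + h) x - S r x) \<le> M * norm (S h x - x)" using M that by simp
    also have "\<dots> < e" using d(2)[of h] that M by (simp add: field_simps)
    finally show ?thesis .
  qed
  show "\<exists>d>0. \<forall>s\<in>{0..}. dist s t < d \<longrightarrow> dist (S s x) (S t x) < e"
  proof (intro exI[of _ "min d 1"] conjI ballI impI)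
    fix s assume s: "s \<in> {0..}" "dist s t < min d 1"
    show "dist (S s x) (S t x) < e"
    proof (cases "s \<le> t")
      case True
      then show ?thesis using *[of s "t - s"] s by (auto simp: dist_norm norm_minus_commute)
    next
      case False
      then show ?thesis using *[of t "s - t"] s t by (auto simp: dist_norm)
    qed
  qed (use d in simp)
qed

lemma generator_tendsto:
  assumes "x \<in> generator_dom S"
  shows "((\<lambda>t. (S t x - x) /\<^sub>R t) \<longlongrightarrow> generator S x) (at_right 0)"
  using assms unfolding generator_dom_def generator_def
  by (auto intro: tendsto_Lim[THEN arg_cong, THEN subst] simp: tendsto_Lim)

lemma generator_invariant:
  assumes x: "x \<in> generator_dom S" and t: "0 \<le> t"
  shows "S t x \<in> generator_dom S" and "generator S (S t x) = S t (generator S x)"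
proof -
  interpret S: bounded_linear "S t" by (rule bounded_linear[OF t])
  have "((\<lambda>h. S t ((S h x - x) /\<^sub>R h)) \<longlongrightarrow> S t (generator S x)) (at_right 0)"
    by (rule S.tendsto[OF generator_tendsto[OF x]])
  moreover have "\<forall>\<^sub>F h in at_right 0. S t ((S h x - x) /\<^sub>R h) = (S h (S t x) - S t x) /\<^sub>R h"
    unfolding eventually_at_right_field
    using S_add[OF t, of _ x] S_add[of _ t x] t
    by (intro exI[of _ 1]) (auto simp: S.scale S.diff add.commute)
  ultimately have *: "((\<lambda>h. (S h (S t x) - S t x) /\<^sub>R h) \<longlongrightarrow> S t (generator S x)) (at_right 0)"
    by (rule Lim_transform_eventually)
  then show "S t x \<in> generator_dom S" by (auto simp: generator_dom_def)
  show "generator S (S t x) = S t (generator S x)"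
    unfolding generator_def[of S "S t x"] by (rule tendsto_Lim[OF _ *]) simp
qed

end

section \<open>The extrapolation space seen through the isometry \<open>J\<close>\<close>

locale extrapolated_semigroup = c0_semigroup S
  for S :: "real \<Rightarrow> 'h::complex_banach \<Rightarrow> 'h" +
  fixes \<beta> :: complex and \<iota> :: "'h \<Rightarrow> 'e::complex_banach"
  assumes extrapolation: "extrapolation_space S \<beta> \<iota>"
begin

abbreviation R where "R \<equiv> resolvent S \<beta>"

lemma bij: "bij_betw (\<lambda>x. \<beta> *\<^sub>C x - generator S x) (generator_dom S) UNIV"
  and R_clinear: "bounded_clinear R"
  and \<iota>_clinear: "clinear \<iota>"
  and norm_\<iota>: "norm (\<iota> x) = norm (R x)"
  and dense: "closure (range \<iota>) = UNIV"
  using extrapolation by (auto simp: extrapolation_space_def resolvent_set_def)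

lemma R_dom: "R y \<in> generator_dom S"
  and R_eq: "\<beta> *\<^sub>C R y - generator S (R y) = y"
  using bij unfolding resolvent_def bij_betw_def by (auto intro: inv_into_into f_inv_into_f)

lemma R_eqI: "x \<in> generator_dom S \<Longrightarrow> \<beta> *\<^sub>C x - generator S x = y \<Longrightarrow> R y = x"
  using bij unfolding resolvent_def bij_betw_def by (auto intro: inv_into_f_f)

lemma R_inj: "R x = R y \<Longrightarrow> x = y"
  by (metis R_eq)

lemma range_R: "x \<in> generator_dom S \<longleftrightarrow> x \<in> range R"
  using R_dom R_eqI by (metis rangeI image_iff)

lemma R_commute:
  assumes "0 \<le> t"
  shows "R (S t y) = S t (R y)"
proof (rule R_eqI)
  interpret S: bounded_linear "S t" by (rule bounded_linear[OF assms])
  show "\<beta> *\<^sub>C S t (R y) - generator S (S t (R y)) = S t y"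
    using R_eq[of y] generator_invariant(2)[OF R_dom assms, of y] scaleC[OF assms]
    by (metis S.diff)
qed (rule generator_invariant(1)[OF R_dom assms])

lemma \<iota>_inj: "\<iota> x = \<iota> y \<Longrightarrow> x = y"
proof -
  interpret \<iota>: linear \<iota> using \<iota>_clinear by (simp add: clinear_def)
  interpret R: bounded_linear R using R_clinear by (rule bounded_clinearD)
  assume "\<iota> x = \<iota> y"
  then have "norm (R (x - y)) = 0" by (simp flip: norm_\<iota> add: \<iota>.diff)
  then show ?thesis using R_inj[of x y] by (simp add: R.diff)
qed

text \<open>The resolvent, extended to the extrapolation space; \<open>dense_extension\<close>
  justifies the definite description. It identifies that space isometrically with a subspace of
  \<open>'h\<close>.\<close>

definition J :: "'e \<Rightarrow> 'h" where
  "J = (THE E. bounded_clinear E \<and> (\<forall>x. E (\<iota> x) = R x))"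

lemma J_props: "bounded_clinear J \<and> (\<forall>x. J (\<iota> x) = R x)"
  unfolding J_def
proof (rule theI'[OF dense_extension[OF \<iota>_clinear dense, of _ 1]])
  show "clinear R" using R_clinear by (simp add: bounded_clinear_def)
qed (auto simp: norm_\<iota>)

lemma J_bounded_linear: "bounded_linear J"
  and J_\<iota>: "J (\<iota> x) = R x"
  using J_props bounded_clinearD(1) by auto

lemma norm_J: "norm (J e) = norm e"
  by (rule dense_range_eq[OF dense])
    (auto simp: J_\<iota> norm_\<iota> intro!: continuous_on_norm linear_continuous_on[OF J_bounded_linear] continuous_on_id)

lemma dist_J: "norm (J x - J y) = norm (x - y)"
proof -
  interpret J: bounded_linear J by (rule J_bounded_linear)
  show ?thesis using norm_J[of "x - y"] by (simp add: J.diff)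
qed

lemma J_inj: "J x = J y \<Longrightarrow> x = y"
  using dist_J[of x y] by simp

text \<open>The generator domain is the range of the resolvent, and \<open>J\<close> is injective.
  So a vector of the extrapolation space belongs to H exactly if its image lies in a subspace that
  the semigroup leaves invariant.\<close>

lemma J_in_dom_iff: "J e \<in> generator_dom S \<longleftrightarrow> e \<in> range \<iota>"
proof
  assume "J e \<in> generator_dom S"
  then obtain x where "J e = R x" using range_R by auto
  then have "e = \<iota> x" using J_inj J_\<iota> by simp
  then show "e \<in> range \<iota>" by simp
qed (use J_\<iota> R_dom in auto)

lemma extended_semigroup_props:
  assumes "0 \<le> t"
  shows "bounded_clinear (extended_semigroup S \<iota> t) \<and> (\<forall>x. extended_semigroup S \<iota> t (\<iota> x) = \<iota> (S t x))"
proof -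
  obtain M where M: "M \<ge> 1" "\<And>x. norm (S t x) \<le> M * norm x"
    using bounded_on_interval[of t] assms by force
  show ?thesis
    unfolding extended_semigroup_def
  proof (rule theI'[OF dense_extension[OF \<iota>_clinear dense, of _ M]])
    show "clinear (\<lambda>x. \<iota> (S t x))"
      using \<iota>_clinear clinear[OF assms] linear_compose[of "S t" \<iota>]
      by (auto simp: clinear_def o_def)
    show "norm (\<iota> (S t x)) \<le> M * norm (\<iota> x)" for x
      by (simp add: norm_\<iota> R_commute[OF assms] M)
  qed (use M in auto)
qed

lemma extended_semigroup_linear:
  "0 \<le> t \<Longrightarrow> bounded_linear (extended_semigroup S \<iota> t)"
  using extended_semigroup_props bounded_clinearD(1) by blast

lemma J_extended_semigroup:
  assumes "0 \<le> t"
  shows "J (extended_semigroup S \<iota> t e) = S t (J e)"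
proof (rule dense_range_eq[OF dense])
  show "continuous_on UNIV (\<lambda>e. J (extended_semigroup S \<iota> t e))"
    by (intro linear_continuous_on bounded_linear_compose[OF J_bounded_linear] extended_semigroup_linear assms)
  show "continuous_on UNIV (\<lambda>e. S t (J e))"
    by (intro linear_continuous_on bounded_linear_compose[OF bounded_linear[OF assms]] J_bounded_linear)
  show "J (extended_semigroup S \<iota> t (\<iota> x)) = S t (J (\<iota> x))" for x
    using extended_semigroup_props[OF assms] by (simp add: J_\<iota> R_commute[OF assms])
qed

text \<open>Difference quotients replace the unbounded generator in y = \<beta> R y - A R y, so
  \<open>y\<close> is a limit of bounded operators applied to \<open>R y\<close>.\<close>

lemma resolvent_recovery:
  "(\<lambda>n. \<beta> *\<^sub>C R y - real (Suc n) *\<^sub>R (S (1 / real (Suc n)) (R y) - R y)) \<longlonglongrightarrow> y"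
proof -
  have "filterlim (\<lambda>n. 1 / real (Suc n)) (at_right 0) sequentially"
    unfolding filterlim_at using LIMSEQ_inverse_real_of_nat by (auto simp: inverse_eq_divide)
  from filterlim_compose[OF generator_tendsto[OF R_dom] this]
  have "(\<lambda>n. real (Suc n) *\<^sub>R (S (1 / real (Suc n)) (R y) - R y)) \<longlonglongrightarrow> generator S (R y)"
    by simp
  then have "(\<lambda>n. \<beta> *\<^sub>C R y - real (Suc n) *\<^sub>R (S (1 / real (Suc n)) (R y) - R y)) \<longlonglongrightarrow> \<beta> *\<^sub>C R y - generator S (R y)"
    by (intro tendsto_intros)
  then show ?thesis by (simp add: R_eq)
qed

end

section \<open>Input maps\<close>

lemma L2_cong:
  assumes "u \<in> L2 J" "\<And>t. t \<in> J \<Longrightarrow> v t = u t"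
  shows "v \<in> L2 J" and "L2_norm J v = L2_norm J u"
proof -
  have "strongly_measurable (lebesgue_on J) u" using assms(1) by (simp add: L2_def)
  then have "strongly_measurable (lebesgue_on J) v"
    by (rule strongly_measurable_cong_AE) (rule AE_I2, simp add: assms(2))
  moreover have "integrable (lebesgue_on J) (\<lambda>t. (norm (v t))\<^sup>2) \<longleftrightarrow> integrable (lebesgue_on J) (\<lambda>t. (norm (u t))\<^sup>2)"
    using assms(2) by (intro Bochner_Integration.integrable_cong) auto
  ultimately show "v \<in> L2 J" using assms(1) by (simp add: L2_def)
  show "L2_norm J v = L2_norm J u"
    unfolding L2_norm_def using assms(2) by (intro arg_cong[where f=sqrt] Bochner_Integration.integral_cong) auto
qed

lemma L2_const:
  assumes "J \<in> lmeasurable"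
  shows "(\<lambda>_. c) \<in> L2 J"
  using assms by (auto simp: L2_def intro!: strongly_measurable_simple finite_measure_lebesgue_on
      finite_measure.integrable_const)

locale control_system = extrapolated_semigroup S \<beta> \<iota>
  for S :: "real \<Rightarrow> 'h::complex_hilbert \<Rightarrow> 'h" and \<beta> and \<iota> :: "'h \<Rightarrow> 'e::complex_banach" +
  fixes B :: "'u::complex_banach \<Rightarrow> 'e"
  assumes admissible: "admissible_control S \<iota> B"
begin

lemma B_bounded_linear: "bounded_linear B"
  using admissible by (auto simp: admissible_control_def bounded_clinear_def)

definition b :: "'u \<Rightarrow> 'h" where "b v = J (B v)"

lemma b_bounded_linear: "bounded_linear b"
  unfolding b_def[abs_def] by (rule bounded_linear_compose[OF J_bounded_linear B_bounded_linear])

text \<open>By \<open>norm_J\<close> its norm is the norm of the input integral in the extrapolation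
  space. Weakly it is the integral of S (t - \<sigma>) (b (u \<sigma>)), and
  \<open>R_input_map\<close> will show that it is the resolvent of the input map.\<close>

definition K :: "real \<Rightarrow> (real \<Rightarrow> 'u) \<Rightarrow> 'h" where
  "K t u = J (input_integral S \<iota> B t u)"

lemma integrand_bound:
  obtains C where "C \<ge> 0" "\<And>t \<sigma> v. 0 < \<sigma> \<Longrightarrow> \<sigma> < t \<Longrightarrow> t \<le> T \<Longrightarrow> norm (S (t - \<sigma>) (b v)) \<le> C * norm v"
proof -
  obtain M where M: "M \<ge> 1" "\<And>s x. 0 \<le> s \<Longrightarrow> s \<le> T \<Longrightarrow> norm (S s x) \<le> M * norm x"
    using bounded_on_interval[of T] by force
  obtain L where L: "L > 0" "\<And>v. norm (b v) \<le> norm v * L"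
    using bounded_linear.pos_bounded[OF b_bounded_linear] by blast
  have "norm (S (t - \<sigma>) (b v)) \<le> M * L * norm v" if "0 < \<sigma>" "\<sigma> < t" "t \<le> T" for t \<sigma> v
  proof -
    have "norm (S (t - \<sigma>) (b v)) \<le> M * norm (b v)" using M(2) that by simp
    also have "\<dots> \<le> M * (norm v * L)" using L M by (intro mult_left_mono) auto
    finally show ?thesis by (simp add: ac_simps)
  qed
  then show ?thesis using that[of "M * L"] M L by simp
qed

text \<open>\<open>J\<close> commutes with the semigroups, so it turns the integrand into S (t -
  \<sigma>) (b (u \<sigma>)), which can be estimated in H. On the way the Bochner integral is shown
  to exist and to be unique, so that the description in \<open>bochner\<close> denotes it.\<close>

lemma K_functional:
  fixes g :: "'h \<Rightarrow> real"
  assumes t: "0 \<le> t" and u: "u \<in> L2 {0<..<t}" and g: "bounded_linear g"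
  shows "has_bochner_integral (lebesgue_on {0<..<t}) (\<lambda>\<sigma>. g (S (t - \<sigma>) (b (u \<sigma>)))) (g (K t u))"
proof -
  let ?J = "{0<..<t}" and ?f = "\<lambda>\<sigma>. extended_semigroup S \<iota> (t - \<sigma>) (B (u \<sigma>))"
  have Js: "?J \<in> sets lebesgue" and Jm: "?J \<in> lmeasurable" by auto
  have J_f: "J (?f \<sigma>) = S (t - \<sigma>) (b (u \<sigma>))" if "\<sigma> \<in> ?J" for \<sigma>
    using that by (simp add: J_extended_semigroup b_def)
  have sm: "strongly_measurable (lebesgue_on ?J) ?f"
  proof (rule strongly_measurable_parametric[where V="\<lambda>\<sigma> v. extended_semigroup S \<iota> (t - \<sigma>) (B v)"])
    show "strongly_measurable (lebesgue_on ?J) u" using u by (simp add: L2_def)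
    show "strongly_measurable (lebesgue_on ?J) (\<lambda>\<sigma>. extended_semigroup S \<iota> (t - \<sigma>) (B c))" for c
    proof (rule strongly_measurable_continuous)
      have "continuous_on ?J (\<lambda>\<sigma>. S (t - \<sigma>) (b c))"
        by (rule continuous_on_compose2[OF continuous[of "b c"]]) (auto intro!: continuous_intros)
      then have "continuous_on ?J (\<lambda>\<sigma>. J (extended_semigroup S \<iota> (t - \<sigma>) (B c)))"
        by (rule continuous_on_eq) (simp add: J_extended_semigroup b_def)
      then show "continuous_on ?J (\<lambda>\<sigma>. extended_semigroup S \<iota> (t - \<sigma>) (B c))"
        by (simp add: continuous_on_iff dist_norm dist_J)
    qed
    show "continuous_on UNIV (\<lambda>v. extended_semigroup S \<iota> (t - \<sigma>) (B v))" if "\<sigma> \<in> space (lebesgue_on ?J)" for \<sigma>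
      using that by (intro linear_continuous_on bounded_linear_compose[OF extended_semigroup_linear B_bounded_linear]) auto
  qed
  have int: "integrable (lebesgue_on ?J) (\<lambda>\<sigma>. norm (?f \<sigma>))"
  proof -
    obtain C where C: "C \<ge> 0" "\<And>\<sigma> v. 0 < \<sigma> \<Longrightarrow> \<sigma> < t \<Longrightarrow> norm (S (t - \<sigma>) (b v)) \<le> C * norm v"
      using integrand_bound[of t] by (metis order_refl)
    have "integrable (lebesgue_on ?J) (\<lambda>\<sigma>. norm (u \<sigma>))"
      using L2_integrable_mult(1)[OF Js u L2_const[OF Jm, of "1::real"]] by simp
    then have "integrable (lebesgue_on ?J) (\<lambda>\<sigma>. C * norm (u \<sigma>))" by simp
    then show ?thesis
    proof (rule Bochner_Integration.integrable_bound)
      show "(\<lambda>\<sigma>. norm (?f \<sigma>)) \<in> borel_measurable (lebesgue_on ?J)"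
        by (rule measurable_compose[OF borel_measurable_of_strongly_measurable[OF Js sm] borel_measurable_norm])
      have "norm (?f \<sigma>) \<le> C * norm (u \<sigma>)" if "\<sigma> \<in> ?J" for \<sigma>
        using C(2)[of \<sigma> "u \<sigma>"] J_f[OF that] norm_J[of "?f \<sigma>"] that by simp
      then show "AE \<sigma> in lebesgue_on ?J. norm (norm (?f \<sigma>)) \<le> norm (C * norm (u \<sigma>))"
        using C(1) by (intro AE_I2) (simp add: abs_mult)
    qed
  qed
  have functional: "has_bochner_integral (lebesgue_on ?J) (\<lambda>\<sigma>. g (S (t - \<sigma>) (b (u \<sigma>)))) (g (J I))"
    if I: "has_bochner (lebesgue_on ?J) ?f I" and g: "bounded_linear g" for I and g :: "'h \<Rightarrow> real"
  proof -
    have "has_bochner_integral (lebesgue_on ?J) (\<lambda>\<sigma>. g (J (?f \<sigma>))) (g (J I))"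
      by (rule has_bochner_bounded_linear[OF I bounded_linear_compose[OF g J_bounded_linear]])
    then show ?thesis
      by (subst (asm) has_bochner_integral_cong[where g="\<lambda>\<sigma>. g (S (t - \<sigma>) (b (u \<sigma>)))"]) (auto simp: J_f)
  qed
  \<comment> \<open>Uniqueness is obtained in H: inner products separate the images under
    \<open>J\<close>, and \<open>J\<close> is injective.\<close>
  have "\<exists>!I. has_bochner (lebesgue_on ?J) ?f I"
  proof (rule ex_ex1I)
    show "\<exists>I. has_bochner (lebesgue_on ?J) ?f I" by (rule has_bochner_exists[OF Js sm int])
    fix I I' assume I: "has_bochner (lebesgue_on ?J) ?f I" and I': "has_bochner (lebesgue_on ?J) ?f I'"
    have "inner h (J I) = inner h (J I')" for h
      using functional[OF I bounded_linear_inner_right, of h] functional[OF I' bounded_linear_inner_right, of h]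
      by (rule has_bochner_integral_eq)
    then have "J I = J I'" using vector_eq_ldot[of "J I" "J I'"] by blast
    then show "I = I'" by (rule J_inj)
  qed
  then have "has_bochner (lebesgue_on ?J) ?f (input_integral S \<iota> B t u)"
    unfolding input_integral_def bochner_def by (rule theI')
  from functional[OF this g] show ?thesis by (simp add: K_def)
qed

lemma K_functional_lebesgue:
  fixes g :: "'h \<Rightarrow> real"
  assumes "0 \<le> t" "u \<in> L2 {0<..<t}" "bounded_linear g"
  shows "integrable lebesgue (\<lambda>\<sigma>. indicator {0<..<t} \<sigma> * g (S (t - \<sigma>) (b (u \<sigma>))))"
    and "g (K t u) = (LINT \<sigma>|lebesgue. indicator {0<..<t} \<sigma> * g (S (t - \<sigma>) (b (u \<sigma>))))"
  using K_functional[OF assms] by (auto simp: has_bochner_integral_iff integrable_restrict_space integral_restrict_space)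

lemma K_eqI:
  assumes "0 \<le> t" "u \<in> L2 {0<..<t}"
    and "\<And>h. inner h y = (LINT \<sigma>|lebesgue. indicator {0<..<t} \<sigma> * inner h (S (t - \<sigma>) (b (u \<sigma>))))"
  shows "K t u = y"
proof -
  have "inner h (K t u) = inner h y" for h
    using K_functional_lebesgue(2)[OF assms(1,2) bounded_linear_inner_right, of h] assms(3)[of h] by simp
  then show ?thesis using vector_eq_ldot[of "K t u" y] by blast
qed

lemma K_cong:
  assumes "0 \<le> t" "u \<in> L2 {0<..<t}" "\<And>\<sigma>. 0 < \<sigma> \<Longrightarrow> \<sigma> < t \<Longrightarrow> v \<sigma> = u \<sigma>"
  shows "K t v = K t u"
proof (rule K_eqI[OF assms(1)])
  show "v \<in> L2 {0<..<t}" using L2_cong(1)[OF assms(2)] assms(3) by simp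
  fix h
  have "inner h (K t u) = (LINT \<sigma>|lebesgue. indicator {0<..<t} \<sigma> * inner h (S (t - \<sigma>) (b (u \<sigma>))))"
    by (rule K_functional_lebesgue(2)[OF assms(1,2) bounded_linear_inner_right])
  also have "\<dots> = (LINT \<sigma>|lebesgue. indicator {0<..<t} \<sigma> * inner h (S (t - \<sigma>) (b (v \<sigma>))))"
    using assms(3) by (intro Bochner_Integration.integral_cong) (auto simp: indicator_def)
  finally show "inner h (K t u) = (LINT \<sigma>|lebesgue. indicator {0<..<t} \<sigma> * inner h (S (t - \<sigma>) (b (v \<sigma>))))" .
qed

lemma K_add:
  assumes t: "0 \<le> t" and u: "u \<in> L2 {0<..<t}" and v: "v \<in> L2 {0<..<t}"
  shows "K t (\<lambda>\<sigma>. u \<sigma> + v \<sigma>) = K t u + K t v"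
proof (rule K_eqI[OF t])
  interpret b: bounded_linear b by (rule b_bounded_linear)
  show "(\<lambda>\<sigma>. u \<sigma> + v \<sigma>) \<in> L2 {0<..<t}" using u v by (intro L2_plus) auto
  fix h
  note bl = bounded_linear_inner_right[of h]
  have "inner h (K t u + K t v) = (LINT \<sigma>|lebesgue. indicator {0<..<t} \<sigma> * inner h (S (t - \<sigma>) (b (u \<sigma>))) +
      indicator {0<..<t} \<sigma> * inner h (S (t - \<sigma>) (b (v \<sigma>))))"
    using K_functional_lebesgue[OF t u bl] K_functional_lebesgue[OF t v bl]
    by (subst Bochner_Integration.integral_add) (auto simp: inner_add_right)
  also have "\<dots> = (LINT \<sigma>|lebesgue. indicator {0<..<t} \<sigma> * inner h (S (t - \<sigma>) (b (u \<sigma> + v \<sigma>))))"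
    by (intro Bochner_Integration.integral_cong)
      (auto simp: indicator_def b.add linear_add[OF bounded_linear.linear[OF bounded_linear]] inner_add_right)
  finally show "inner h (K t u + K t v) =
      (LINT \<sigma>|lebesgue. indicator {0<..<t} \<sigma> * inner h (S (t - \<sigma>) (b (u \<sigma> + v \<sigma>))))" .
qed

lemma K_scale:
  assumes t: "0 \<le> t" and u: "u \<in> L2 {0<..<t}"
  shows "K t (\<lambda>\<sigma>. c *\<^sub>R u \<sigma>) = c *\<^sub>R K t u"
proof (rule K_eqI[OF t])
  interpret b: bounded_linear b by (rule b_bounded_linear)
  show "(\<lambda>\<sigma>. c *\<^sub>R u \<sigma>) \<in> L2 {0<..<t}" using u by (rule L2_cmult)
  fix h
  have "inner h (c *\<^sub>R K t u) = (LINT \<sigma>|lebesgue. c * (indicator {0<..<t} \<sigma> * inner h (S (t - \<sigma>) (b (u \<sigma>)))))"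
    using K_functional_lebesgue(2)[OF t u bounded_linear_inner_right, of h] by simp
  also have "\<dots> = (LINT \<sigma>|lebesgue. indicator {0<..<t} \<sigma> * inner h (S (t - \<sigma>) (b (c *\<^sub>R u \<sigma>))))"
    by (intro Bochner_Integration.integral_cong)
      (auto simp: indicator_def b.scale linear_scale[OF bounded_linear.linear[OF bounded_linear]])
  finally show "inner h (c *\<^sub>R K t u) =
      (LINT \<sigma>|lebesgue. indicator {0<..<t} \<sigma> * inner h (S (t - \<sigma>) (b (c *\<^sub>R u \<sigma>))))" .
qed

text \<open>Test \<open>K T u\<close> against itself and divide by its norm. This is boundedness in
  the weaker norm of the extrapolation space; the bound in H comes later from uniform
  boundedness.\<close>

lemma K_bound: "\<exists>C. \<forall>u\<in>L2 {0<..<T}. 0 \<le> T \<longrightarrow> norm (K T u) \<le> C * L2_norm {0<..<T} u"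
proof -
  let ?J = "{0<..<T}"
  have Js: "?J \<in> sets lebesgue" and Jm: "?J \<in> lmeasurable" by auto
  obtain C where C: "C \<ge> 0" "\<And>\<sigma> v. 0 < \<sigma> \<Longrightarrow> \<sigma> < T \<Longrightarrow> norm (S (T - \<sigma>) (b v)) \<le> C * norm v"
    using integrand_bound[of T] by (metis order_refl)
  note one = L2_const[OF Jm, of "1::real"]
  have "norm (K T u) \<le> C * L2_norm ?J (\<lambda>_. 1::real) * L2_norm ?J u" if u: "u \<in> L2 ?J" and T: "0 \<le> T" for u
  proof -
    define y where "y = K T u"
    note hb = K_functional[OF T u bounded_linear_inner_right[of y]]
    have int: "integrable (lebesgue_on ?J) (\<lambda>\<sigma>. norm y * C * (norm (u \<sigma>) * norm (1::real)))"
      using L2_integrable_mult(1)[OF Js u one] by (intro integrable_mult_right) auto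
    have "norm y * norm y = (LINT \<sigma>|lebesgue_on ?J. inner y (S (T - \<sigma>) (b (u \<sigma>))))"
      using hb by (simp add: has_bochner_integral_iff y_def power2_eq_square flip: power2_norm_eq_inner)
    also have "\<dots> \<le> (LINT \<sigma>|lebesgue_on ?J. norm y * C * (norm (u \<sigma>) * norm (1::real)))"
    proof (rule integral_mono[OF _ int])
      show "integrable (lebesgue_on ?J) (\<lambda>\<sigma>. inner y (S (T - \<sigma>) (b (u \<sigma>))))"
        using hb by (simp add: has_bochner_integral_iff)
      fix \<sigma> assume "\<sigma> \<in> space (lebesgue_on ?J)"
      then have "norm (S (T - \<sigma>) (b (u \<sigma>))) \<le> C * norm (u \<sigma>)" using C(2) by simp
      then have "norm y * norm (S (T - \<sigma>) (b (u \<sigma>))) \<le> norm y * (C * norm (u \<sigma>))"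
        by (intro mult_left_mono) auto
      then show "inner y (S (T - \<sigma>) (b (u \<sigma>))) \<le> norm y * C * (norm (u \<sigma>) * norm (1::real))"
        using norm_cauchy_schwarz[of y "S (T - \<sigma>) (b (u \<sigma>))"] by (simp add: mult.assoc)
    qed
    also have "\<dots> = norm y * C * (LINT \<sigma>|lebesgue_on ?J. norm (u \<sigma>) * norm (1::real))" by simp
    also have "\<dots> \<le> norm y * C * (L2_norm ?J u * L2_norm ?J (\<lambda>_. 1::real))"
      using C(1) L2_integrable_mult(2)[OF Js u one] by (intro mult_left_mono) auto
    finally have "norm y * norm y \<le> norm y * (C * L2_norm ?J (\<lambda>_. 1::real) * L2_norm ?J u)"
      by (simp add: ac_simps)
    then show ?thesis
      using C(1) by (cases "y = 0") (auto simp: y_def mult_le_cancel_left)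
  qed
  then show ?thesis by blast
qed

lemma L2_on: "u \<in> L2 UNIV \<Longrightarrow> u \<in> L2 {a<..<c::real}"
  by (rule L2_restrict) auto

lemma L2_causal_shift:
  assumes u: "u \<in> L2 UNIV"
  shows "(\<lambda>s. indicator {0<..} (s + a) *\<^sub>R u (s + a)) \<in> L2 UNIV"
    and "L2_norm UNIV (\<lambda>s. indicator {0<..} (s + a) *\<^sub>R u (s + a)) \<le> L2_norm UNIV u"
proof -
  have J: "{0::real<..} \<in> sets lebesgue" by auto
  note w = L2_extend[OF J L2_restrict(1)[OF J u]]
  show "(\<lambda>s. indicator {0<..} (s + a) *\<^sub>R u (s + a)) \<in> L2 UNIV"
    using L2_UNIV_shift(1)[OF w(1), of a] .
  show "L2_norm UNIV (\<lambda>s. indicator {0<..} (s + a) *\<^sub>R u (s + a)) \<le> L2_norm UNIV u"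
    using L2_UNIV_shift(2)[OF w(1), of a] w(2) L2_restrict(2)[OF J u] by simp
qed

text \<open>Waiting for the time r - t and then applying \<open>u\<close> has the same effect at
  time \<open>r\<close> as \<open>u\<close> has at time \<open>t\<close>. Before the start the
  control is 0 and contributes nothing to the integral.\<close>

lemma K_delay:
  assumes u: "u \<in> L2 UNIV" and t: "0 \<le> t" "t \<le> r"
  shows "K r (\<lambda>s. indicator {0<..} (s + (t - r)) *\<^sub>R u (s + (t - r))) = K t u"
proof (rule K_eqI)
  show "0 \<le> r" using t by simp
  show "(\<lambda>s. indicator {0<..} (s + (t - r)) *\<^sub>R u (s + (t - r))) \<in> L2 {0<..<r}"
    by (rule L2_on[OF L2_causal_shift(1)[OF u]])
  interpret b: bounded_linear b by (rule b_bounded_linear)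
  fix h
  let ?f = "\<lambda>\<sigma>. indicator {0<..<t} \<sigma> * inner h (S (t - \<sigma>) (b (u \<sigma>)))"
  have S0: "S s 0 = 0" if "0 \<le> s" for s
    using linear_0[OF bounded_linear.linear[OF bounded_linear[OF that]]] .
  have "inner h (K t u) = (LINT \<sigma>|lebesgue. ?f \<sigma>)"
    by (rule K_functional_lebesgue(2)[OF t(1) L2_on[OF u] bounded_linear_inner_right])
  also have "\<dots> = (LINT s|lebesgue. ?f ((t - r) + s))"
    using lebesgue_integral_real_affine[of 1 ?f "t - r"] by simp
  also have "\<dots> = (LINT s|lebesgue. indicator {0<..<r} s *
      inner h (S (r - s) (b (indicator {0<..} (s + (t - r)) *\<^sub>R u (s + (t - r))))))"
  proof (intro Bochner_Integration.integral_cong refl)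
    fix s
    show "?f ((t - r) + s) = indicator {0<..<r} s *
      inner h (S (r - s) (b (indicator {0<..} (s + (t - r)) *\<^sub>R u (s + (t - r)))))"
    proof (cases "0 < s + (t - r)")
      case True
      have "t - (t - r + s) = r - s" "t - r + s = s + (t - r)" by auto
      then show ?thesis using True t by (auto simp: indicator_def add.commute)
    next
      case False
      then show ?thesis using t S0[of "r - s"] by (auto simp: indicator_def b.zero)
    qed
  qed
  finally show "inner h (K t u) = (LINT s|lebesgue. indicator {0<..<r} s *
      inner h (S (r - s) (b (indicator {0<..} (s + (t - r)) *\<^sub>R u (s + (t - r))))))" .
qed

text \<open>The cocycle identity: the effect of the control up to time \<open>t\<close> is
  transported by the semigroup for the time \<open>s\<close>, and the remaining control acts from a
  fresh start.\<close>

lemma K_split: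
  assumes u: "u \<in> L2 UNIV" and t: "0 \<le> t" and s: "0 \<le> s"
  shows "K (s + t) u = S s (K t u) + K s (\<lambda>\<sigma>. u (\<sigma> + t))"
proof (rule K_eqI)
  show st: "0 \<le> s + t" using s t by simp
  show "u \<in> L2 {0<..<s + t}" by (rule L2_on[OF u])
  fix h
  define G where "G \<sigma> = inner h (S (s + t - \<sigma>) (b (u \<sigma>)))" for \<sigma>
  have bl: "bounded_linear (\<lambda>x. inner h (S s x))"
    by (rule bounded_linear_compose[OF bounded_linear_inner_right bounded_linear[OF s]])
  have eq1: "indicator {0<..<t} \<sigma> * inner h (S s (S (t - \<sigma>) (b (u \<sigma>)))) = indicator {0<..<t} \<sigma> * G \<sigma>" for \<sigma>
    using S_add[OF s, of "t - \<sigma>" "b (u \<sigma>)"] by (auto simp: indicator_def G_def add_diff_eq)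
  note first = K_functional_lebesgue[OF t L2_on[OF u] bl, unfolded eq1]
  let ?F = "\<lambda>x. indicator {t<..<s + t} x * G x"
  have eq2: "indicator {0<..<s} \<sigma> * inner h (S (s - \<sigma>) (b (u (\<sigma> + t)))) = ?F (t + 1 * \<sigma>)" for \<sigma>
    by (auto simp: indicator_def G_def add.commute)
  note second = K_functional_lebesgue[OF s L2_on[OF L2_UNIV_shift(1)[OF u]] bounded_linear_inner_right[of h],
      of t, unfolded eq2]
  have intF: "integrable lebesgue ?F"
    using second(1) lebesgue_integrable_real_affine_iff[of 1 ?F t] by simp
  have "inner h (S s (K t u) + K s (\<lambda>\<sigma>. u (\<sigma> + t))) =
      (LINT \<sigma>|lebesgue. indicator {0<..<t} \<sigma> * G \<sigma>) + (LINT \<sigma>|lebesgue. ?F \<sigma>)"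
    using first(2) second(2) lebesgue_integral_real_affine[of 1 ?F t] by (simp add: inner_add_right)
  also have "\<dots> = (LINT \<sigma>|lebesgue. indicator {0<..<t} \<sigma> * G \<sigma> + ?F \<sigma>)"
    by (rule Bochner_Integration.integral_add[OF first(1) intF, symmetric])
  also have "\<dots> = (LINT \<sigma>|lebesgue. indicator {0<..<s + t} \<sigma> * G \<sigma>)"
  proof (rule integral_cong_AE)
    show "(\<lambda>\<sigma>. indicator {0<..<t} \<sigma> * G \<sigma> + ?F \<sigma>) \<in> borel_measurable lebesgue"
      using Bochner_Integration.integrable_add[OF first(1) intF] by (rule borel_measurable_integrable)
    show "(\<lambda>\<sigma>. indicator {0<..<s + t} \<sigma> * G \<sigma>) \<in> borel_measurable lebesgue"
      using K_functional_lebesgue(1)[OF st L2_on[OF u] bounded_linear_inner_right[of h]]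
      unfolding G_def by (rule borel_measurable_integrable)
    \<comment> \<open>The open intervals (0, t) and (t, s + t) miss the single time
      \<open>t\<close>, a null set.\<close>
    have "AE \<sigma> in lebesgue. \<sigma> \<notin> {t}"
      by (rule AE_not_in) (simp flip: negligible_iff_null_sets)
    then show "AE \<sigma> in lebesgue. indicator {0<..<t} \<sigma> * G \<sigma> + ?F \<sigma> = indicator {0<..<s + t} \<sigma> * G \<sigma>"
    proof eventually_elim
      case (elim \<sigma>)
      then show ?case using s t by (auto simp: indicator_def)
    qed
  qed
  finally show "inner h (S s (K t u) + K s (\<lambda>\<sigma>. u (\<sigma> + t))) =
      (LINT \<sigma>|lebesgue. indicator {0<..<s + t} \<sigma> * inner h (S (s + t - \<sigma>) (b (u \<sigma>))))"
    unfolding G_def .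
qed

lemma generator_dom_add: "x \<in> generator_dom S \<Longrightarrow> y \<in> generator_dom S \<Longrightarrow> x + y \<in> generator_dom S"
  using range_R linear_add[OF bounded_linear.linear[OF bounded_clinearD(1)[OF R_clinear]]]
  by (metis rangeE rangeI)

text \<open>Admissibility speaks of one time \<open>r\<close>. By \<open>K_split\<close> the
  property passes from a time to its double, as the generator domain is a subspace invariant under
  the semigroup. Any \<open>t\<close> lies below some 2^n r, and \<open>K_delay\<close> reduces it
  to that time.\<close>

lemma K_in_dom:
  assumes u: "u \<in> L2 UNIV" and t: "0 \<le> t"
  shows "K t u \<in> generator_dom S"
proof -
  obtain r where r: "r > 0" "\<And>u. u \<in> L2 {0<..} \<Longrightarrow> input_integral S \<iota> B r u \<in> range \<iota>"
    using admissible by (auto simp: admissible_control_def)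
  have "\<forall>u\<in>L2 UNIV. K (2 ^ n * r) u \<in> generator_dom S" for n
  proof (induction n)
    case 0
    show ?case using r(2) L2_restrict(1)[of "{0<..}"] by (auto simp: K_def J_in_dom_iff)
  next
    case (Suc n)
    have pos: "0 \<le> 2 ^ n * r" using r(1) by simp
    have double: "2 ^ Suc n * r = 2 ^ n * r + 2 ^ n * r" by simp
    show ?case
    proof
      fix u :: "real \<Rightarrow> 'u" assume u: "u \<in> L2 UNIV"
      show "K (2 ^ Suc n * r) u \<in> generator_dom S"
        unfolding double K_split[OF u pos pos]
        using Suc u L2_UNIV_shift(1)[OF u] pos by (intro generator_dom_add generator_invariant(1)) auto
    qed
  qed
  then have dom: "K (2 ^ n * r) v \<in> generator_dom S" if "v \<in> L2 UNIV" for n v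
    using that by blast
  obtain n where "t / r < 2 ^ n" using real_arch_pow[of 2 "t / r"] by auto
  then have le: "t \<le> 2 ^ n * r" using r(1) by (simp add: field_simps)
  show ?thesis using dom[OF L2_causal_shift(1)[OF u], of n "t - 2 ^ n * r"] unfolding K_delay[OF u t le] .
qed

lemma K_extend:
  assumes u: "u \<in> L2 {0<..<T}" and t: "0 \<le> t" "t \<le> T"
  shows "u \<in> L2 {0<..<t}" and "K t u = K t (\<lambda>\<sigma>. indicator {0<..<T} \<sigma> *\<^sub>R u \<sigma>)"
proof -
  have J: "{0<..<T} \<in> sets lebesgue" by simp
  note w = L2_on[OF L2_extend(1)[OF J u], of 0 t]
  have eq: "u \<sigma> = indicator {0<..<T} \<sigma> *\<^sub>R u \<sigma>" if "0 < \<sigma>" "\<sigma> < t" for \<sigma> using that t by simp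
  show "u \<in> L2 {0<..<t}" using eq by (intro L2_cong(1)[OF w]) simp
  show "K t u = K t (\<lambda>\<sigma>. indicator {0<..<T} \<sigma> *\<^sub>R u \<sigma>)" by (rule K_cong[OF t(1) w eq])
qed

text \<open>The input integral lies in the range of \<iota>, so \<open>inv\<close> returns a genuine
  preimage. As \<open>R\<close> is injective, identities for the input map can now be derived from
  those for \<open>K\<close>.\<close>

lemma R_input_map:
  assumes "u \<in> L2 {0<..<T}" "0 \<le> t" "t \<le> T"
  shows "R (input_map S \<iota> B t u) = K t u"
proof -
  have "K t u \<in> generator_dom S"
    using K_extend(2)[OF assms] K_in_dom[OF L2_extend(1)[OF _ assms(1)] assms(2)] by simp
  then have "input_integral S \<iota> B t u \<in> range \<iota>" by (simp add: K_def J_in_dom_iff)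
  then show ?thesis
    unfolding input_map_def K_def by (metis J_\<iota> f_inv_into_f)
qed

lemma input_map_add:
  assumes "u \<in> L2 {0<..<T}" "v \<in> L2 {0<..<T}" "0 \<le> t" "t \<le> T"
  shows "input_map S \<iota> B t (\<lambda>\<sigma>. u \<sigma> + v \<sigma>) = input_map S \<iota> B t u + input_map S \<iota> B t v"
proof (rule R_inj)
  interpret R: bounded_linear R by (rule bounded_clinearD(1)[OF R_clinear])
  show "R (input_map S \<iota> B t (\<lambda>\<sigma>. u \<sigma> + v \<sigma>)) = R (input_map S \<iota> B t u + input_map S \<iota> B t v)"
    using R_input_map[OF L2_plus(1)[OF _ assms(1,2)] assms(3,4)]
      R_input_map[OF assms(1,3,4)] R_input_map[OF assms(2,3,4)]
      K_add[OF assms(3) K_extend(1)[OF assms(1,3,4)] K_extend(1)[OF assms(2,3,4)]]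
    by (simp add: R.add)
qed

lemma input_map_scale:
  assumes "u \<in> L2 {0<..<T}" "0 \<le> t" "t \<le> T"
  shows "input_map S \<iota> B t (\<lambda>\<sigma>. c *\<^sub>R u \<sigma>) = c *\<^sub>R input_map S \<iota> B t u"
proof (rule R_inj)
  interpret R: bounded_linear R by (rule bounded_clinearD(1)[OF R_clinear])
  show "R (input_map S \<iota> B t (\<lambda>\<sigma>. c *\<^sub>R u \<sigma>)) = R (c *\<^sub>R input_map S \<iota> B t u)"
    using R_input_map[OF L2_cmult(1)[OF assms(1)] assms(2,3)] R_input_map[OF assms]
      K_scale[OF assms(2) K_extend(1)[OF assms]]
    by (simp add: R.scale)
qed

text \<open>The input map is the pointwise limit of bounded operators obtained by replacing the
  generator in $F u = (\beta - A) K u$ by difference quotients of the semigroup.\<close>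

lemma input_map_bounded_at:
  assumes T: "0 \<le> T"
  shows "\<exists>C. \<forall>u\<in>L2 {0<..<T}. norm (input_map S \<iota> B T u) \<le> C * L2_norm {0<..<T} u"
proof -
  let ?J = "{0<..<T}"
  have Js: "?J \<in> sets lebesgue" and Jm: "?J \<in> lmeasurable" by auto
  interpret X: complete_function_space "L2 ?J :: (real \<Rightarrow> 'u) set" "L2_norm ?J"
    by (rule complete_function_space_L2[OF Jm])
  define P where "P n y = \<beta> *\<^sub>C y - real (Suc n) *\<^sub>R (S (1 / real (Suc n)) y - y)" for n and y :: 'h
  have P: "bounded_linear (P n)" for n
    unfolding P_def[abs_def]
    by (intro bounded_linear_sub bounded_linear_scaleC bounded_linear_compose[OF bounded_linear_scaleR_right]
        bounded_linear bounded_linear_ident) simp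
  have lim: "(\<lambda>n. P n (K T u)) \<longlonglongrightarrow> input_map S \<iota> B T u" if "u \<in> L2 ?J" for u
    using resolvent_recovery[of "input_map S \<iota> B T u"] R_input_map[OF that T order_refl] by (simp add: P_def)
  have "\<exists>C. \<forall>n. \<forall>u\<in>L2 ?J. norm (P n (K T u)) \<le> C * L2_norm ?J u"
  proof (rule X.uniform_boundedness)
    fix n and u v :: "real \<Rightarrow> 'u" and c :: real
    interpret P: bounded_linear "P n" by (rule P)
    show "P n (K T (\<lambda>t. u t + v t)) = P n (K T u) + P n (K T v)" if "u \<in> L2 ?J" "v \<in> L2 ?J"
      using that by (simp add: K_add T P.add)
    show "P n (K T (\<lambda>t. c *\<^sub>R u t)) = c *\<^sub>R P n (K T u)" if "u \<in> L2 ?J"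
      using that by (simp add: K_scale T P.scale)
    show "\<exists>C. \<forall>u\<in>L2 ?J. norm (P n (K T u)) \<le> C * L2_norm ?J u"
    proof -
      obtain C where C: "\<And>u. u \<in> L2 ?J \<Longrightarrow> norm (K T u) \<le> C * L2_norm ?J u" using K_bound[of T] T by blast
      obtain L where L: "L > 0" "\<And>y. norm (P n y) \<le> norm y * L" using P.pos_bounded by blast
      have "norm (P n (K T u)) \<le> L * C * L2_norm ?J u" if "u \<in> L2 ?J" for u
      proof -
        have "norm (P n (K T u)) \<le> norm (K T u) * L" by (rule L(2))
        also have "\<dots> \<le> C * L2_norm ?J u * L" using C[OF that] L(1) by (intro mult_right_mono) auto
        finally show ?thesis by (simp add: ac_simps)
      qed
      then show ?thesis by blast
    qed
  next
    fix u :: "real \<Rightarrow> 'u" assume "u \<in> L2 ?J"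
    then show "\<exists>C. \<forall>n. norm (P n (K T u)) \<le> C"
      using convergentI[OF lim] convergent_imp_Bseq BseqE by metis
  qed
  then obtain C where C: "\<And>n u. u \<in> L2 ?J \<Longrightarrow> norm (P n (K T u)) \<le> C * L2_norm ?J u" by blast
  have "norm (input_map S \<iota> B T u) \<le> C * L2_norm ?J u" if "u \<in> L2 ?J" for u
    using tendsto_norm[OF lim[OF that]] by (rule tendsto_upperbound) (use C[OF that] in auto)
  then show ?thesis by blast
qed

text \<open>A control on (0, t), delayed by T - t, has the same effect at time \<open>T\<close> and
  no larger norm. Hence the bound at \<open>T\<close> serves all earlier times.\<close>

lemma input_map_bounded:
  assumes T: "0 \<le> T"
  obtains C where "C \<ge> 0"
    "\<And>t u. u \<in> L2 {0<..<T} \<Longrightarrow> 0 \<le> t \<Longrightarrow> t \<le> T \<Longrightarrow> norm (input_map S \<iota> B t u) \<le> C * L2_norm {0<..<T} u"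
proof -
  let ?J = "{0<..<T}"
  have Js: "?J \<in> sets lebesgue" by simp
  obtain C where C: "\<And>u. u \<in> L2 ?J \<Longrightarrow> norm (input_map S \<iota> B T u) \<le> C * L2_norm ?J u"
    using input_map_bounded_at[OF T] by blast
  have "norm (input_map S \<iota> B t u) \<le> \<bar>C\<bar> * L2_norm ?J u" if u: "u \<in> L2 ?J" and t: "0 \<le> t" "t \<le> T" for t u
  proof -
    let ?e = "\<lambda>\<sigma>. indicator ?J \<sigma> *\<^sub>R u \<sigma>"
    let ?v = "\<lambda>s. indicator {0<..} (s + (t - T)) *\<^sub>R ?e (s + (t - T))"
    note e = L2_extend[OF Js u]
    note v = L2_causal_shift[OF e(1), of "t - T"]
    have "R (input_map S \<iota> B t u) = K t u" by (rule R_input_map[OF u t])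
    also have "\<dots> = K t ?e" by (rule K_extend(2)[OF u t])
    also have "\<dots> = K T ?v" by (rule K_delay[OF e(1) t, symmetric])
    also have "\<dots> = R (input_map S \<iota> B T ?v)"
      by (rule R_input_map[OF L2_restrict(1)[OF Js v(1)] T order_refl, symmetric])
    finally have "R (input_map S \<iota> B t u) = R (input_map S \<iota> B T ?v)" .
    then have "norm (input_map S \<iota> B t u) = norm (input_map S \<iota> B T ?v)" by (rule R_inj[THEN arg_cong])
    also have "\<dots> \<le> C * L2_norm ?J ?v" by (rule C[OF L2_restrict(1)[OF Js v(1)]])
    also have "\<dots> \<le> \<bar>C\<bar> * L2_norm ?J ?v" by (intro mult_right_mono) auto
    also have "L2_norm ?J ?v \<le> L2_norm ?J u"
      using L2_restrict(2)[OF Js v(1)] v(2) e(2) by linarith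
    finally show ?thesis by (simp add: mult_left_mono)
  qed
  then show ?thesis using that[of "\<bar>C\<bar>"] by simp
qed

end

section \<open>The cost functional\<close>

lemma distX_eq:
  "distX T z w = (SUP t\<in>{0..T}. norm (fst z t - fst w t)) + L2_norm {0<..<T} (\<lambda>t. snd z t - snd w t)"
  by (simp add: distX_def case_prod_beta)

lemma norm_le_SUP:
  fixes x y :: "real \<Rightarrow> 'a::real_normed_vector"
  assumes "continuous_on {0..T} x" "continuous_on {0..T} y" "t \<in> {0..T}"
  shows "norm (x t - y t) \<le> (SUP t\<in>{0..T}. norm (x t - y t))"
proof (rule cSUP_upper[OF assms(3)])
  have "compact ((\<lambda>t. norm (x t - y t)) ` {0..T})"
    using assms(1,2) by (intro compact_continuous_image continuous_intros) auto
  then show "bdd_above ((\<lambda>t. norm (x t - y t)) ` {0..T})"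
    by (rule bounded_imp_bdd_above[OF compact_imp_bounded])
qed

lemma distX_refl: "0 < T \<Longrightarrow> distX T z z = 0"
  by (simp add: distX_eq L2_norm_zero)

lemma distX_sym: "distX T z w = distX T w z"
  unfolding distX_eq L2_norm_minus_commute[of _ "snd z"] by (simp add: norm_minus_commute)

lemma distX_ge:
  assumes "0 < T" "z \<in> spaceX T" "w \<in> spaceX T"
  shows "t \<in> {0..T} \<Longrightarrow> norm (fst z t - fst w t) \<le> distX T z w"
    and "L2_norm {0<..<T} (\<lambda>t. snd z t - snd w t) \<le> distX T z w"
proof -
  have cont: "continuous_on {0..T} (fst z)" "continuous_on {0..T} (fst w)"
    using assms by (auto simp: spaceX_def)
  show "norm (fst z t - fst w t) \<le> distX T z w" if "t \<in> {0..T}"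
    using norm_le_SUP[OF cont that] L2_norm_nonneg[of "{0<..<T}" "\<lambda>t. snd z t - snd w t"]
    unfolding distX_eq by linarith
  have "0 \<le> norm (fst z 0 - fst w 0)" by simp
  also have "\<dots> \<le> (SUP t\<in>{0..T}. norm (fst z t - fst w t))"
    using assms(1) by (intro norm_le_SUP cont) auto
  finally show "L2_norm {0<..<T} (\<lambda>t. snd z t - snd w t) \<le> distX T z w"
    unfolding distX_eq by simp
qed

lemma distX_triangle:
  assumes T: "0 < T" and X: "z1 \<in> spaceX T" "z2 \<in> spaceX T" "z3 \<in> spaceX T"
  shows "distX T z1 z3 \<le> distX T z1 z2 + distX T z2 z3"
proof -
  have cont: "continuous_on {0..T} (fst z1)" "continuous_on {0..T} (fst z2)" "continuous_on {0..T} (fst z3)"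
    and L2: "snd z1 \<in> L2 {0<..<T}" "snd z2 \<in> L2 {0<..<T}" "snd z3 \<in> L2 {0<..<T}"
    using X by (auto simp: spaceX_def)
  have "(SUP t\<in>{0..T}. norm (fst z1 t - fst z3 t)) \<le>
      (SUP t\<in>{0..T}. norm (fst z1 t - fst z2 t)) + (SUP t\<in>{0..T}. norm (fst z2 t - fst z3 t))"
  proof (rule cSUP_least)
    fix t assume t: "t \<in> {0..T}"
    have "norm (fst z1 t - fst z3 t) \<le> norm (fst z1 t - fst z2 t) + norm (fst z2 t - fst z3 t)"
      by (metis norm_diff_triangle_le order_refl)
    then show "norm (fst z1 t - fst z3 t) \<le>
      (SUP t\<in>{0..T}. norm (fst z1 t - fst z2 t)) + (SUP t\<in>{0..T}. norm (fst z2 t - fst z3 t))"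
      using norm_le_SUP[OF cont(1,2) t] norm_le_SUP[OF cont(2,3) t] by linarith
  qed (use T in auto)
  then show ?thesis
    using L2_norm_triangle[OF _ L2] unfolding distX_eq by force
qed

section \<open>Integrability of the running cost and Lipschitz continuity of the cost on bounded
  sets\<close>

lemma GDERIV_lipschitz:
  fixes f :: "'a::real_inner \<Rightarrow> real"
  assumes "\<And>x. norm x \<le> r \<Longrightarrow> GDERIV f x :> g x" "\<And>x. norm x \<le> r \<Longrightarrow> norm (g x) \<le> K"
    and xy: "norm x \<le> r" "norm y \<le> r"
  shows "\<bar>f x - f y\<bar> \<le> K * norm (x - y)"
proof -
  have "norm (f x - f y) \<le> K * norm (x - y)"
  proof (rule differentiable_bound[of "cball 0 r"])
    fix z :: 'a assume z: "z \<in> cball 0 r"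
    then have nz: "norm z \<le> r" by simp
    show "(f has_derivative (\<lambda>h. inner h (g z))) (at z within cball 0 r)"
      using assms(1)[OF nz] by (auto simp: gderiv_def intro: has_derivative_at_withinI)
    show "onorm (\<lambda>h. inner h (g z)) \<le> K"
    proof (rule onorm_bound)
      show "0 \<le> K" using order_trans[OF norm_ge_zero assms(2)[OF nz]] .
      fix h
      have "norm (inner h (g z)) \<le> norm h * norm (g z)" using Cauchy_Schwarz_ineq2[of h "g z"] by simp
      also have "\<dots> \<le> norm h * K" using assms(2)[OF nz] by (rule mult_left_mono) simp
      finally show "norm (inner h (g z)) \<le> K * norm h" by (simp add: mult.commute)
    qed
  qed (use xy in auto)
  then show ?thesis by simp
qed

lemma cost_integrable:
  fixes \<theta> :: "'h::real_normed_vector \<Rightarrow> 'u::real_normed_vector \<Rightarrow> real \<Rightarrow> real"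
  assumes T: "0 < T"
    and theta_cont: "continuous_on (UNIV \<times> UNIV \<times> {0..T}) (\<lambda>(x, u, t). \<theta> x u t)"
    and theta_growth:
      "\<And>r. r > 0 \<Longrightarrow> \<exists>C>0. \<exists>\<omega>. integrable (lebesgue_on {0<..<T}) \<omega> \<and>
         (AE t in lebesgue_on {0<..<T}. \<omega> t \<ge> 0) \<and>
         (\<forall>x u. \<forall>t\<in>{0<..<T}. norm x \<le> r \<longrightarrow> \<bar>\<theta> x u t\<bar> \<le> C * (norm u)\<^sup>2 + \<omega> t)"
    and x: "continuous_on {0..T} x" and u: "u \<in> L2 {0<..<T}"
  shows "integrable (lebesgue_on {0<..<T}) (\<lambda>t. \<theta> (x t) (u t) t)"
proof -
  let ?J = "{0<..<T}"
  have J: "?J \<in> sets lebesgue" by simp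
  have cont: "continuous_on D (\<lambda>p. \<theta> (a p) (b p) (c p))"
    if "continuous_on D a" "continuous_on D b" "continuous_on D c" "\<And>p. p \<in> D \<Longrightarrow> c p \<in> {0..T}"
    for D :: "'d::topological_space set" and a b c
  proof -
    have "continuous_on D (\<lambda>p. (a p, b p, c p))" using that(1-3) by (intro continuous_on_Pair)
    moreover have "(\<lambda>p. (a p, b p, c p)) ` D \<subseteq> UNIV \<times> UNIV \<times> {0..T}" using that(4) by blast
    ultimately show ?thesis using continuous_on_compose2[OF theta_cont] by fastforce
  qed
  have sm: "strongly_measurable (lebesgue_on ?J) (\<lambda>t. \<theta> (x t) (u t) t)"
  proof (rule strongly_measurable_parametric[where V="\<lambda>t v. \<theta> (x t) v t"])
    show "strongly_measurable (lebesgue_on ?J) (\<lambda>t. \<theta> (x t) c t)" for c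
      by (intro strongly_measurable_continuous cont continuous_on_subset[OF x] continuous_on_const continuous_on_id)
        auto
    show "continuous_on UNIV (\<lambda>v. \<theta> (x t) v t)" if "t \<in> space (lebesgue_on ?J)" for t
      using that by (intro cont continuous_on_const continuous_on_id) auto
  qed (use u in \<open>simp add: L2_def\<close>)
  obtain r where r: "r > 0" "\<And>t. t \<in> {0..T} \<Longrightarrow> norm (x t) \<le> r"
    using compact_continuous_image[OF x compact_Icc] compact_imp_bounded bounded_pos
    by (metis imageI)
  obtain C \<omega> where C: "C > 0" and \<omega>: "integrable (lebesgue_on ?J) \<omega>"
    and le: "\<And>x u t. t \<in> ?J \<Longrightarrow> norm x \<le> r \<Longrightarrow> \<bar>\<theta> x u t\<bar> \<le> C * (norm u)\<^sup>2 + \<omega> t"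
    using theta_growth[OF r(1)] by metis
  have "integrable (lebesgue_on ?J) (\<lambda>t. C * (norm (u t))\<^sup>2 + \<omega> t)"
    using u \<omega> by (auto simp: L2_def)
  then show ?thesis
  proof (rule Bochner_Integration.integrable_bound)
    show "(\<lambda>t. \<theta> (x t) (u t) t) \<in> borel_measurable (lebesgue_on ?J)"
      by (rule borel_measurable_of_strongly_measurable[OF J sm])
    show "AE t in lebesgue_on ?J. norm (\<theta> (x t) (u t) t) \<le> norm (C * (norm (u t))\<^sup>2 + \<omega> t)"
    proof (rule AE_I2)
      fix t assume "t \<in> space (lebesgue_on ?J)"
      then show "norm (\<theta> (x t) (u t) t) \<le> norm (C * (norm (u t))\<^sup>2 + \<omega> t)"
        using le[of t "x t" "u t"] r(2)[of t] by auto
    qed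
  qed
qed

text \<open>The state is changed first and then the control. The gradient in the state has an L^1
  bound, paired with the sup distance of the states; the gradient in the control has an L^2 bound,
  paired by Cauchy-Schwarz with the L^2 distance of the controls. Accordingly the first may grow
  quadratically in the control and the second linearly.\<close>

lemma cost_lipschitz:
  fixes \<theta> :: "'h::real_inner \<Rightarrow> 'u::real_inner \<Rightarrow> real \<Rightarrow> real"
  assumes T: "0 < T" and r: "r > 0"
    and int: "\<And>x u. continuous_on {0..T} x \<Longrightarrow> u \<in> L2 {0<..<T} \<Longrightarrow>
      integrable (lebesgue_on {0<..<T}) (\<lambda>t. \<theta> (x t) (u t) t)"
    and grad_x: "\<And>x u t. t \<in> {0..T} \<Longrightarrow> GDERIV (\<lambda>y. \<theta> y u t) x :> grad_x x u t"
    and grad_u: "\<And>x u t. t \<in> {0..T} \<Longrightarrow> GDERIV (\<lambda>v. \<theta> x v t) u :> grad_u x u t"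
    and grad_growth:
      "\<exists>C>0. \<exists>\<omega> \<eta>. integrable (lebesgue_on {0<..<T}) \<omega> \<and>
         (AE t in lebesgue_on {0<..<T}. \<omega> t \<ge> 0) \<and>
         \<eta> \<in> L2 {0<..<T} \<and> (AE t in lebesgue_on {0<..<T}. \<eta> t \<ge> 0) \<and>
         (\<forall>x u. \<forall>t\<in>{0<..<T}. norm x \<le> r \<longrightarrow>
            norm (grad_x x u t) \<le> C * (norm u)\<^sup>2 + \<omega> t \<and>
            norm (grad_u x u t) \<le> C * norm u + \<eta> t)"
  shows "\<exists>L\<ge>0. \<forall>z\<in>spaceX T. \<forall>w\<in>spaceX T. (\<forall>t\<in>{0..T}. norm (fst z t) \<le> r) \<longrightarrow> (\<forall>t\<in>{0..T}. norm (fst w t) \<le> r) \<longrightarrow>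
    L2_norm {0<..<T} (snd z) \<le> M \<longrightarrow> L2_norm {0<..<T} (snd w) \<le> M \<longrightarrow> cost \<theta> T z - cost \<theta> T w \<le> L * distX T z w"
proof -
  let ?J = "{0<..<T}"
  have J: "?J \<in> sets lebesgue" by simp
  obtain C \<omega> and \<eta> :: "real \<Rightarrow> real" where C: "C > 0" and \<omega>: "integrable (lebesgue_on ?J) \<omega>"
    "AE t in lebesgue_on ?J. \<omega> t \<ge> 0" and \<eta>: "\<eta> \<in> L2 ?J"
    and gx: "\<And>x u t. t \<in> ?J \<Longrightarrow> norm x \<le> r \<Longrightarrow> norm (grad_x x u t) \<le> C * (norm u)\<^sup>2 + \<omega> t"
    and gu: "\<And>x u t. t \<in> ?J \<Longrightarrow> norm x \<le> r \<Longrightarrow> norm (grad_u x u t) \<le> C * norm u + \<eta> t"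
    using grad_growth by metis
  \<comment> \<open>The first two terms bound the state gradient in L^1, the last two the control
    gradient in L^2; the factor 2 comes from estimating a maximum of two control norms by their
    sum.\<close>
  define L where "L = C * M\<^sup>2 + (LINT t|lebesgue_on ?J. \<omega> t) + 2 * C * \<bar>M\<bar> + L2_norm ?J \<eta>"
  have \<omega>0: "0 \<le> (LINT t|lebesgue_on ?J. \<omega> t)" using \<omega>(2) by (rule integral_nonneg_AE)
  show ?thesis
  proof (intro exI[of _ L] conjI ballI impI)
    show "0 \<le> L" using C \<omega>0 by (simp add: L_def)
    fix z w :: "(real \<Rightarrow> 'h) \<times> (real \<Rightarrow> 'u)"
    assume zw: "z \<in> spaceX T" "w \<in> spaceX T" and br: "\<forall>t\<in>{0..T}. norm (fst z t) \<le> r" "\<forall>t\<in>{0..T}. norm (fst w t) \<le> r"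
      and bM: "L2_norm ?J (snd z) \<le> M" "L2_norm ?J (snd w) \<le> M"
    define x u y v where "x = fst z" and "u = snd z" and "y = fst w" and "v = snd w"
    have x: "continuous_on {0..T} x" and y: "continuous_on {0..T} y" and u: "u \<in> L2 ?J" and v: "v \<in> L2 ?J"
      using zw by (auto simp: spaceX_def x_def u_def y_def v_def)
    have M0: "M \<ge> 0" using order_trans[OF L2_norm_nonneg bM(1)] .
    define D where "D = (SUP t\<in>{0..T}. norm (x t - y t))"
    define w' where "w' t = u t - v t" for t
    have w': "w' \<in> L2 ?J" unfolding w'_def[abs_def] by (rule L2_minus[OF J u v])
    have D: "norm (x t - y t) \<le> D" if "t \<in> {0..T}" for t
      unfolding D_def by (rule norm_le_SUP[OF x y that])
    have D0: "D \<ge> 0" using order_trans[OF norm_ge_zero D[of 0]] T by simp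
    define h where "h t = D * (C * (norm (u t))\<^sup>2 + \<omega> t) +
      (C * (norm (w' t) * norm (u t)) + C * (norm (w' t) * norm (v t)) + norm (w' t) * norm (\<eta> t))" for t
    note i = L2_integrable_mult(1)[OF J w' u] L2_integrable_mult(1)[OF J w' v] L2_integrable_mult(1)[OF J w' \<eta>]
    have u2: "integrable (lebesgue_on ?J) (\<lambda>t. (norm (u t))\<^sup>2)" using u by (simp add: L2_def)
    have h_int: "integrable (lebesgue_on ?J) h"
      unfolding h_def[abs_def] using i u2 \<omega>(1) by auto
    have pointwise: "\<theta> (x t) (u t) t - \<theta> (y t) (v t) t \<le> h t" if t: "t \<in> ?J" for t
    proof -
      have t': "t \<in> {0..T}" using t by auto
      have xr: "norm (x t) \<le> r" "norm (y t) \<le> r" using br t' by (auto simp: x_def y_def)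
      have "\<bar>\<theta> (x t) (u t) t - \<theta> (y t) (u t) t\<bar> \<le> (C * (norm (u t))\<^sup>2 + \<omega> t) * norm (x t - y t)"
        by (rule GDERIV_lipschitz[OF grad_x[OF t'] gx[OF t] xr])
      also have "\<dots> \<le> (C * (norm (u t))\<^sup>2 + \<omega> t) * D"
        using D[OF t'] order_trans[OF norm_ge_zero gx[OF t xr(1)]] by (rule mult_left_mono)
      finally have 1: "\<theta> (x t) (u t) t - \<theta> (y t) (u t) t \<le> D * (C * (norm (u t))\<^sup>2 + \<omega> t)"
        by (simp add: mult.commute)
      \<comment> \<open>Both control values, and the segment between them, lie in the ball of radius
        \<open>m\<close>, on which the growth condition bounds the gradient by a constant.\<close>
      define m where "m = max (norm (u t)) (norm (v t))"
      have "\<bar>\<theta> (y t) (u t) t - \<theta> (y t) (v t) t\<bar> \<le> (C * m + \<bar>\<eta> t\<bar>) * norm (u t - v t)"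
      proof (rule GDERIV_lipschitz[where r=m])
        show "GDERIV (\<lambda>v. \<theta> (y t) v t) a :> grad_u (y t) a t" for a by (rule grad_u[OF t'])
        show "norm (grad_u (y t) a t) \<le> C * m + \<bar>\<eta> t\<bar>" if "norm a \<le> m" for a
          using gu[OF t xr(2), of a] mult_left_mono[OF that, of C] C by linarith
      qed (auto simp: m_def)
      also have "\<dots> \<le> (C * (norm (u t) + norm (v t)) + \<bar>\<eta> t\<bar>) * norm (u t - v t)"
        using C by (intro mult_right_mono add_right_mono mult_left_mono) (auto simp: m_def)
      finally have "\<theta> (y t) (u t) t - \<theta> (y t) (v t) t \<le>
          C * (norm (w' t) * norm (u t)) + C * (norm (w' t) * norm (v t)) + norm (w' t) * norm (\<eta> t)"
        by (simp add: w'_def algebra_simps)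
      with 1 show ?thesis unfolding h_def by linarith
    qed
    have "cost \<theta> T z - cost \<theta> T w = (LINT t|lebesgue_on ?J. \<theta> (x t) (u t) t - \<theta> (y t) (v t) t)"
      using int[OF x u] int[OF y v]
      by (simp add: cost_def case_prod_beta x_def u_def y_def v_def)
    also have "\<dots> \<le> (LINT t|lebesgue_on ?J. h t)"
      using pointwise int[OF x u] int[OF y v] h_int by (intro integral_mono) auto
    also have "\<dots> = D * (C * (L2_norm ?J u)\<^sup>2 + (LINT t|lebesgue_on ?J. \<omega> t)) +
        (C * (LINT t|lebesgue_on ?J. norm (w' t) * norm (u t)) + C * (LINT t|lebesgue_on ?J. norm (w' t) * norm (v t)) +
          (LINT t|lebesgue_on ?J. norm (w' t) * norm (\<eta> t)))"
      unfolding h_def L2_norm_squared using i u2 \<omega>(1) by simp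
    also have "\<dots> \<le> D * L + L2_norm ?J w' * L"
    proof (rule add_mono)
      have "C * (L2_norm ?J u)\<^sup>2 \<le> C * M\<^sup>2"
        using bM(1) C by (intro mult_left_mono power_mono) (auto simp: u_def)
      then have "C * (L2_norm ?J u)\<^sup>2 + (LINT t|lebesgue_on ?J. \<omega> t) \<le> L"
        using C L2_norm_nonneg[of ?J \<eta>] by (simp add: L_def add_increasing2)
      then show "D * (C * (L2_norm ?J u)\<^sup>2 + (LINT t|lebesgue_on ?J. \<omega> t)) \<le> D * L"
        using D0 by (rule mult_left_mono)
      have a: "(LINT t|lebesgue_on ?J. norm (w' t) * norm (u t)) \<le> L2_norm ?J w' * M"
        using L2_integrable_mult(2)[OF J w' u] bM(1) mult_left_mono[of "L2_norm ?J u" M "L2_norm ?J w'"]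
        by (simp add: u_def)
      have b: "(LINT t|lebesgue_on ?J. norm (w' t) * norm (v t)) \<le> L2_norm ?J w' * M"
        using L2_integrable_mult(2)[OF J w' v] bM(2) mult_left_mono[of "L2_norm ?J v" M "L2_norm ?J w'"]
        by (simp add: v_def)
      have "C * (LINT t|lebesgue_on ?J. norm (w' t) * norm (u t)) + C * (LINT t|lebesgue_on ?J. norm (w' t) * norm (v t)) +
          (LINT t|lebesgue_on ?J. norm (w' t) * norm (\<eta> t)) \<le>
          C * (L2_norm ?J w' * M) + C * (L2_norm ?J w' * M) + L2_norm ?J w' * L2_norm ?J \<eta>"
        using a b C L2_integrable_mult(2)[OF J w' \<eta>] by (intro add_mono mult_left_mono) auto
      also have "\<dots> = L2_norm ?J w' * (2 * C * \<bar>M\<bar> + L2_norm ?J \<eta>)" using M0 by (simp add: algebra_simps)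
      also have "\<dots> \<le> L2_norm ?J w' * L"
        using C \<omega>0 by (intro mult_left_mono) (auto simp: L_def)
      finally show "C * (LINT t|lebesgue_on ?J. norm (w' t) * norm (u t)) + C * (LINT t|lebesgue_on ?J. norm (w' t) * norm (v t)) +
          (LINT t|lebesgue_on ?J. norm (w' t) * norm (\<eta> t)) \<le> L2_norm ?J w' * L" .
    qed
    also have "\<dots> = L * distX T z w"
      by (simp add: distX_eq D_def w'_def[abs_def] x_def y_def u_def v_def algebra_simps)
    finally show "cost \<theta> T z - cost \<theta> T w \<le> L * distX T z w" .
  qed
qed

section \<open>Descent paths in the control system and the reduction to the abstract
  principle\<close>

theorem theorem8:
  fixes S :: "real \<Rightarrow> 'h::complex_hilbert \<Rightarrow> 'h"
    and \<iota> :: "'h \<Rightarrow> 'e::complex_banach"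
    and B :: "'u::complex_hilbert \<Rightarrow> 'e"
    and \<beta> :: complex
    and T :: real
    and x0 xT :: 'h
    and U :: "(real \<Rightarrow> 'u) set"
    and \<theta> :: "'h \<Rightarrow> 'u \<Rightarrow> real \<Rightarrow> real"
    and grad_x :: "'h \<Rightarrow> 'u \<Rightarrow> real \<Rightarrow> 'h"
    and grad_u :: "'h \<Rightarrow> 'u \<Rightarrow> real \<Rightarrow> 'u"
  defines "A \<equiv> trajectories S \<iota> B T x0 U"
    and "I \<equiv> cost \<theta> T"
    and "\<phi> \<equiv> terminal_error T xT"
    and "R \<equiv> reachable_set S \<iota> B T x0 U"
  assumes semigroup: "strongly_continuous_semigroup S"
    and extrapolation: "extrapolation_space S \<beta> \<iota>"
    and admissible: "admissible_control S \<iota> B"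
    and T_pos: "T > 0"
    and U: "U \<subseteq> L2 {0<..<T}" "L2_closed {0<..<T} U" "L2_convex U"
    and theta_cont: "continuous_on (UNIV \<times> UNIV \<times> {0..T}) (\<lambda>(x, u, t). \<theta> x u t)"
    and theta_growth:
      "\<And>r. r > 0 \<Longrightarrow> \<exists>C>0. \<exists>\<omega>. integrable (lebesgue_on {0<..<T}) \<omega> \<and>
         (AE t in lebesgue_on {0<..<T}. \<omega> t \<ge> 0) \<and>
         (\<forall>x u. \<forall>t\<in>{0<..<T}. norm x \<le> r \<longrightarrow> \<bar>\<theta> x u t\<bar> \<le> C * (norm u)\<^sup>2 + \<omega> t)"
    and bounded_or_coercive:
      "L2_bounded {0<..<T} U \<or>
       (\<exists>C>0. \<exists>\<omega>. integrable (lebesgue_on {0<..<T}) \<omega> \<and>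
         (\<forall>x u. \<forall>t\<in>{0..T}. \<theta> x u t \<ge> C * (norm u)\<^sup>2 + \<omega> t))"
    and grad_x: "\<And>x u t. t \<in> {0..T} \<Longrightarrow> GDERIV (\<lambda>y. \<theta> y u t) x :> grad_x x u t"
    and grad_u: "\<And>x u t. t \<in> {0..T} \<Longrightarrow> GDERIV (\<lambda>v. \<theta> x v t) u :> grad_u x u t"
    and grad_x_cont: "continuous_on (UNIV \<times> UNIV \<times> {0..T}) (\<lambda>(x, u, t). grad_x x u t)"
    and grad_u_cont: "continuous_on (UNIV \<times> UNIV \<times> {0..T}) (\<lambda>(x, u, t). grad_u x u t)"
    and grad_growth:
      "\<And>r. r > 0 \<Longrightarrow> \<exists>C>0. \<exists>\<omega> \<eta>. integrable (lebesgue_on {0<..<T}) \<omega> \<and>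
         (AE t in lebesgue_on {0<..<T}. \<omega> t \<ge> 0) \<and>
         \<eta> \<in> L2 {0<..<T} \<and> (AE t in lebesgue_on {0<..<T}. \<eta> t \<ge> 0) \<and>
         (\<forall>x u. \<forall>t\<in>{0<..<T}. norm x \<le> r \<longrightarrow>
            norm (grad_x x u t) \<le> C * (norm u)\<^sup>2 + \<omega> t \<and>
            norm (grad_u x u t) \<le> C * norm u + \<eta> t)"
    and optimal_exists: "\<exists>z. globally_optimal I (feasible_set A \<phi>) z"
    and relint_nonempty: "relint R \<noteq> {}"
    and target_relint: "xT \<in> relint R"
  shows "\<forall>c::real. \<exists>lam0\<ge>0. \<forall>lam\<ge>lam0.
    completely_exact (distX T) A I \<phi> lam (sublevel A (penalty I \<phi> lam) c)"
proof -
  interpret control_system S \<beta> \<iota> B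
    using semigroup extrapolation admissible by unfold_locales
  let ?J = "{0<..<T}"
  have J: "?J \<in> sets lebesgue" and Jm: "?J \<in> lmeasurable" by auto
  interpret X: complete_function_space "L2 ?J :: (real \<Rightarrow> 'u) set" "L2_norm ?J"
    by (rule complete_function_space_L2[OF Jm])
  define F where "F = input_map S \<iota> B"
  obtain CF where CF: "CF \<ge> 0"
    "\<And>t u. u \<in> L2 ?J \<Longrightarrow> 0 \<le> t \<Longrightarrow> t \<le> T \<Longrightarrow> norm (F t u) \<le> CF * L2_norm ?J u"
    unfolding F_def using input_map_bounded[of T] T_pos by (metis less_imp_le)
  have F_add: "F t (\<lambda>\<sigma>. u \<sigma> + v \<sigma>) = F t u + F t v" if "u \<in> L2 ?J" "v \<in> L2 ?J" "t \<in> {0..T}" for t u v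
    unfolding F_def using that by (intro input_map_add) auto
  have F_scale: "F t (\<lambda>\<sigma>. c *\<^sub>R u \<sigma>) = c *\<^sub>R F t u" if "u \<in> L2 ?J" "t \<in> {0..T}" for t u c
    unfolding F_def using that by (intro input_map_scale) auto
  have F_diff: "F t (\<lambda>\<sigma>. u \<sigma> - v \<sigma>) = F t u - F t v" if "u \<in> L2 ?J" "v \<in> L2 ?J" "t \<in> {0..T}" for t u v
    using F_add[of u "\<lambda>\<sigma>. (-1) *\<^sub>R v \<sigma>" t] F_scale[of v t "-1"] X.scale[of v "-1"] that by simp
  have F_convex: "F t (\<lambda>\<sigma>. (1 - s) *\<^sub>R u \<sigma> + s *\<^sub>R v \<sigma>) = (1 - s) *\<^sub>R F t u + s *\<^sub>R F t v"
    if "u \<in> L2 ?J" "v \<in> L2 ?J" "t \<in> {0..T}" for t u v s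
    using that by (simp add: F_add F_scale X.scale)
  have F_dist: "norm (F t u - F t v) \<le> CF * L2_norm ?J (\<lambda>\<sigma>. u \<sigma> - v \<sigma>)"
    if "u \<in> L2 ?J" "v \<in> L2 ?J" "t \<in> {0..T}" for t u v
    using CF(2)[OF X.diff[OF that(1,2)], of t] F_diff[OF that] that(3) by simp
  define y0 where "y0 t = S t x0" for t
  have y0_cont: "continuous_on {0..T} y0"
    unfolding y0_def by (rule continuous_on_subset[OF continuous]) auto
  define V where "V = {u \<in> U. continuous_on {0..T} (\<lambda>t. F t u)}"
  have V_U: "V \<subseteq> U" and V_L2: "V \<subseteq> L2 ?J" using U(1) by (auto simp: V_def)
  have A_iff: "(x, u) \<in> A \<longleftrightarrow> u \<in> V \<and> (\<forall>t\<in>{0..T}. x t = y0 t + F t u)" for x u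
  proof -
    have "continuous_on {0..T} x \<longleftrightarrow> continuous_on {0..T} (\<lambda>t. F t u)"
      if "\<forall>t\<in>{0..T}. x t = y0 t + F t u"
    proof
      assume "continuous_on {0..T} x"
      then have c: "continuous_on {0..T} (\<lambda>t. x t - y0 t)" using y0_cont by (intro continuous_intros)
      show "continuous_on {0..T} (\<lambda>t. F t u)" by (rule continuous_on_eq[OF c]) (simp add: that)
    next
      assume "continuous_on {0..T} (\<lambda>t. F t u)"
      then have c: "continuous_on {0..T} (\<lambda>t. y0 t + F t u)" using y0_cont by (intro continuous_intros)
      show "continuous_on {0..T} x" by (rule continuous_on_eq[OF c]) (simp add: that)
    qed
    then show ?thesis
      using U(1) by (auto simp: A_def trajectories_def spaceX_def V_def y0_def F_def)
  qed
  have A_X: "A \<subseteq> spaceX T" by (auto simp: A_def trajectories_def)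
  define G where "G u = y0 T + F T u" for u
  have R_eq: "R = G ` V"
  proof -
    have "(\<lambda>t. y0 t + F t u, u) \<in> A" if "u \<in> V" for u using that A_iff by simp
    then have "G u \<in> R" if "u \<in> V" for u
      using that unfolding R_def reachable_set_def A_def G_def by force
    moreover have "x \<in> G ` V" if "x \<in> R" for x
      using that A_iff T_pos unfolding R_def reachable_set_def A_def[symmetric] G_def by auto
    ultimately show ?thesis by blast
  qed
  have V_convex: "(\<lambda>t. (1 - s) *\<^sub>R u t + s *\<^sub>R v t) \<in> V" if uv: "u \<in> V" "v \<in> V" and s: "s \<in> {0..1}" for u v s
  proof -
    have "continuous_on {0..T} (\<lambda>t. (1 - s) *\<^sub>R F t u + s *\<^sub>R F t v)"
      using uv by (auto simp: V_def intro!: continuous_intros)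
    then have "continuous_on {0..T} (\<lambda>t. F t (\<lambda>\<sigma>. (1 - s) *\<^sub>R u \<sigma> + s *\<^sub>R v \<sigma>))"
      by (rule continuous_on_eq) (use F_convex[OF subsetD[OF V_L2 uv(1)] subsetD[OF V_L2 uv(2)]] in simp)
    then show ?thesis using U(3) uv s by (auto simp: V_def L2_convex_def)
  qed
  \<comment> \<open>\<open>CF\<close> does not depend on \<open>t\<close>, so L^2 convergence of the
    controls makes the functions t \<mapsto> F t (v n) converge uniformly, and continuity
    survives.\<close>
  have V_closed: "u \<in> V" if v: "\<And>n::nat. v n \<in> V" and u: "u \<in> L2 ?J"
    and lim: "(\<lambda>n. L2_norm ?J (\<lambda>t. v n t - u t)) \<longlonglongrightarrow> 0" for v u
  proof -
    have "u \<in> U" using U(2) v u lim V_U unfolding L2_closed_def by blast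
    moreover have "continuous_on {0..T} (\<lambda>t. F t u)"
    proof (rule uniform_limit_theorem)
      show "uniform_limit {0..T} (\<lambda>n t. F t (v n)) (\<lambda>t. F t u) sequentially"
      proof (rule uniform_limitI)
        fix e :: real assume "e > 0"
        moreover have "(\<lambda>n. CF * L2_norm ?J (\<lambda>t. v n t - u t)) \<longlonglongrightarrow> 0"
          using lim by (rule tendsto_mult_right_zero)
        ultimately have "\<forall>\<^sub>F n in sequentially. CF * L2_norm ?J (\<lambda>t. v n t - u t) < e"
          by (simp add: order_tendstoD)
        then show "\<forall>\<^sub>F n in sequentially. \<forall>t\<in>{0..T}. dist (F t (v n)) (F t u) < e"
        proof eventually_elim
          case (elim n)
          then show ?case using F_dist[OF subsetD[OF V_L2 v[of n]] u] by (force simp: dist_norm)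
        qed
      qed
    qed (use v in \<open>auto simp: V_def\<close>)
    ultimately show ?thesis by (simp add: V_def)
  qed
  have T_mem: "T \<in> {0..T}" using T_pos by simp
  obtain r K where r: "r > 0" and preimage: "\<And>y. y \<in> closure (affine hull R) \<Longrightarrow> norm (y - xT) < r \<Longrightarrow>
      \<exists>u\<in>V. G u = y \<and> L2_norm ?J u \<le> K"
  proof (rule X.bounded_preimages_near_relint[OF V_L2 V_convex V_closed, where G=G and C=CF and ?y0.0=xT])
    show "G (\<lambda>t. (1 - s) *\<^sub>R u t + s *\<^sub>R v t) = (1 - s) *\<^sub>R G u + s *\<^sub>R G v" if "u \<in> V" "v \<in> V" for u v s
      using that V_L2 F_convex[OF _ _ T_mem] by (auto simp: G_def algebra_simps subset_iff)
    show "norm (G u - G v) \<le> CF * L2_norm ?J (\<lambda>t. u t - v t)" if "u \<in> V" "v \<in> V" for u v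
      using that V_L2 F_dist[OF _ _ T_mem] by (auto simp: G_def subset_iff)
    show "xT \<in> relint (G ` V)" using target_relint by (simp add: R_eq)
  qed (auto simp: R_eq)
  define \<nu> where "\<nu> = (\<lambda>z :: (real \<Rightarrow> 'h) \<times> (real \<Rightarrow> 'u). L2_norm ?J (snd z))"
  have A_E: "snd z \<in> V" "snd z \<in> L2 ?J" "continuous_on {0..T} (fst z)" "z \<in> spaceX T"
    "\<And>t. t \<in> {0..T} \<Longrightarrow> fst z t = y0 t + F t (snd z)" if "z \<in> A" for z
    using that A_iff[of "fst z" "snd z"] A_X V_L2 by (auto simp: spaceX_def)
  have dist_A: "distX T z w \<le> (CF + 1) * L2_norm ?J (\<lambda>t. snd z t - snd w t)" if z: "z \<in> A" and w: "w \<in> A" for z w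
  proof -
    have "(SUP t\<in>{0..T}. norm (fst z t - fst w t)) \<le> CF * L2_norm ?J (\<lambda>t. snd z t - snd w t)"
    proof (rule cSUP_least)
      show "norm (fst z t - fst w t) \<le> CF * L2_norm ?J (\<lambda>t. snd z t - snd w t)" if "t \<in> {0..T}" for t
        using F_dist[OF A_E(2)[OF z] A_E(2)[OF w] that] A_E(5)[OF z that] A_E(5)[OF w that] by simp
    qed (use T_pos in auto)
    then show ?thesis by (simp add: distX_eq algebra_simps)
  qed
  have int: "integrable (lebesgue_on ?J) (\<lambda>t. \<theta> (x t) (u t) t)"
    if "continuous_on {0..T} x" "u \<in> L2 ?J" for x u
    by (rule cost_integrable[OF T_pos theta_cont theta_growth that])
  show ?thesis
  proof (rule completely_exact_of_descent_paths[where \<nu>=\<nu>])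
    show "distX T z z = 0" for z :: "(real \<Rightarrow> 'h) \<times> (real \<Rightarrow> 'u)" using T_pos by (rule distX_refl)
    show "distX T z w = distX T w z" for z w :: "(real \<Rightarrow> 'h) \<times> (real \<Rightarrow> 'u)" by (rule distX_sym)
    show "distX T z1 z3 \<le> distX T z1 z2 + distX T z2 z3" if "z1 \<in> A" "z2 \<in> A" "z3 \<in> A" for z1 z2 z3
      using distX_triangle[OF T_pos] that A_X by blast
    show "0 \<le> \<phi> z" for z by (simp add: \<phi>_def terminal_error_def case_prod_beta)
    show "\<phi> z - \<phi> w \<le> distX T z w" if "z \<in> A" "w \<in> A" for z w
    proof -
      have "\<phi> z - \<phi> w \<le> norm (fst z T - fst w T)"
        using norm_triangle_ineq2[of "fst z T - xT" "fst w T - xT"]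
        by (simp add: \<phi>_def terminal_error_def case_prod_beta)
      then show ?thesis using distX_ge(1)[OF T_pos A_E(4)[OF that(1)] A_E(4)[OF that(2)] T_mem] by linarith
    qed
    show "\<nu> z - \<nu> w \<le> distX T z w" if "z \<in> A" "w \<in> A" for z w
    proof -
      have "\<nu> z \<le> \<nu> w + L2_norm ?J (\<lambda>t. snd z t - snd w t)"
        using X.p_add[OF A_E(2)[OF that(2)] X.diff[OF A_E(2)[OF that(1)] A_E(2)[OF that(2)]]]
        by (simp add: \<nu>_def)
      then show ?thesis using distX_ge(2)[OF T_pos A_E(4)[OF that(1)] A_E(4)[OF that(2)]] by linarith
    qed
    show "\<exists>L\<ge>0. \<forall>z\<in>A. \<forall>w\<in>A. \<nu> z \<le> M \<longrightarrow> \<nu> w \<le> M \<longrightarrow> I z - I w \<le> L * distX T z w" for M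
    proof -
      obtain MS where MS: "MS \<ge> 1" "\<And>t x. 0 \<le> t \<Longrightarrow> t \<le> T \<Longrightarrow> norm (S t x) \<le> MS * norm x"
        using bounded_on_interval[of T] by force
      \<comment> \<open>A bound for all states generated by controls of norm at most
        \<open>M\<close>; the 1 makes the radius positive.\<close>
      define \<rho> where "\<rho> = MS * norm x0 + CF * \<bar>M\<bar> + 1"
      have \<rho>: "\<rho> > 0" using MS CF by (simp add: \<rho>_def add_nonneg_pos)
      have bound: "norm (fst z t) \<le> \<rho>" if "z \<in> A" "\<nu> z \<le> M" "t \<in> {0..T}" for z t
      proof -
        have "norm (fst z t) \<le> norm (y0 t) + norm (F t (snd z))"
          using A_E(5)[OF that(1,3)] norm_triangle_ineq by simp
        also have "norm (y0 t) \<le> MS * norm x0" using MS(2) that(3) by (simp add: y0_def)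
        also have "norm (F t (snd z)) \<le> CF * L2_norm ?J (snd z)" using CF(2) A_E(2) that by simp
        also have "\<dots> \<le> CF * \<bar>M\<bar>" using that(2) CF(1) by (intro mult_left_mono) (auto simp: \<nu>_def)
        finally show ?thesis by (simp add: \<rho>_def)
      qed
      obtain L where "L \<ge> 0" "\<forall>z\<in>spaceX T. \<forall>w\<in>spaceX T. (\<forall>t\<in>{0..T}. norm (fst z t) \<le> \<rho>) \<longrightarrow> (\<forall>t\<in>{0..T}. norm (fst w t) \<le> \<rho>) \<longrightarrow>
          L2_norm ?J (snd z) \<le> M \<longrightarrow> L2_norm ?J (snd w) \<le> M \<longrightarrow> cost \<theta> T z - cost \<theta> T w \<le> L * distX T z w"
        using cost_lipschitz[OF T_pos \<rho> int grad_x grad_u grad_growth[OF \<rho>], of M] by blast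
      then show ?thesis
        using bound A_X by (intro exI[of _ L]) (auto simp: \<nu>_def I_def subset_iff)
    qed
    show "\<exists>M. \<forall>z\<in>A. I z < c \<longrightarrow> \<nu> z \<le> M" for c
      using bounded_or_coercive
    proof
      assume "L2_bounded ?J U"
      then show ?thesis using A_E(1) V_U unfolding L2_bounded_def \<nu>_def by blast
    next
      assume "\<exists>C>0. \<exists>\<omega>. integrable (lebesgue_on ?J) \<omega> \<and>
         (\<forall>x u. \<forall>t\<in>{0..T}. \<theta> x u t \<ge> C * (norm u)\<^sup>2 + \<omega> t)"
      then obtain C \<omega> where C: "C > 0" and \<omega>: "integrable (lebesgue_on ?J) \<omega>"
        and ge: "\<And>x u t. t \<in> {0..T} \<Longrightarrow> \<theta> x u t \<ge> C * (norm u)\<^sup>2 + \<omega> t" by blast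
      define W where "W = (LINT t|lebesgue_on ?J. \<omega> t)"
      have "\<nu> z \<le> sqrt ((c - W) / C)" if z: "z \<in> A" "I z < c" for z
      proof -
        have u2: "integrable (lebesgue_on ?J) (\<lambda>t. (norm (snd z t))\<^sup>2)"
          using A_E(2)[OF z(1)] by (simp add: L2_def)
        have "C * (\<nu> z)\<^sup>2 + W = (LINT t|lebesgue_on ?J. C * (norm (snd z t))\<^sup>2 + \<omega> t)"
          using u2 \<omega> by (simp add: \<nu>_def L2_norm_squared W_def)
        also have "\<dots> \<le> (LINT t|lebesgue_on ?J. \<theta> (fst z t) (snd z t) t)"
          using u2 \<omega> int[OF A_E(3,2)[OF z(1)]] ge by (intro integral_mono) auto
        also have "\<dots> = I z" by (simp add: I_def cost_def case_prod_beta)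
        finally have "(\<nu> z)\<^sup>2 \<le> (c - W) / C" using z(2) C by (simp add: field_simps)
        then show ?thesis by (rule real_le_rsqrt)
      qed
      then show ?thesis by blast
    qed
    show "\<exists>D>0. \<exists>r>0. \<exists>M'. \<forall>z\<in>A. \<nu> z \<le> M \<longrightarrow> 0 < \<phi> z \<longrightarrow>
      (\<exists>p. \<exists>\<sigma>>0. \<phi> (p \<sigma>) = 0 \<and> (\<forall>s\<in>{0..\<sigma>}. p s \<in> A \<and> \<nu> (p s) \<le> M' \<and> distX T (p s) z \<le> s * D \<and>
          \<phi> (p s) \<le> \<phi> z - s * r))" for M
    proof -
      \<comment> \<open>Trajectories are at most CF + 1 times as far apart as their controls, and
        those at the two ends of a path have norms at most |M| and |K|. The final 1 makes
        \<open>D\<close> positive.\<close>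
      define D where "D = (CF + 1) * (\<bar>M\<bar> + \<bar>K\<bar>) + 1"
      have D: "D > 0" using CF(1) unfolding D_def by (intro add_nonneg_pos mult_nonneg_nonneg) auto
      have "\<exists>p. \<exists>\<sigma>>0. \<phi> (p \<sigma>) = 0 \<and> (\<forall>s\<in>{0..\<sigma>}. p s \<in> A \<and> \<nu> (p s) \<le> \<bar>M\<bar> + \<bar>K\<bar> \<and>
          distX T (p s) z \<le> s * D \<and> \<phi> (p s) \<le> \<phi> z - s * (r / 2))"
        if z: "z \<in> A" "\<nu> z \<le> M" "0 < \<phi> z" for z
      proof -
        define q where "q = fst z T - xT"
        have q: "\<phi> z = norm q" by (simp add: \<phi>_def terminal_error_def case_prod_beta q_def)
        have q_pos: "norm q > 0" using z q by simp
        \<comment> \<open>The overshooting target, at distance r/2 from \<open>xT\<close> on the ray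
          from x(T) through \<open>xT\<close>. It lies on the line through two reachable points,
          hence in the affine hull, and within the radius \<open>r\<close> of bounded
          preimages.\<close>
        define h where "h = xT - (r / 2 / norm q) *\<^sub>R q"
        have "xT \<in> R" using target_relint by (auto simp: relint_def)
        moreover have "fst z T \<in> R"
          unfolding R_def reachable_set_def A_def[symmetric] using z(1) by (cases z) auto
        ultimately have "(1 + r / 2 / norm q) *\<^sub>R xT + (- (r / 2 / norm q)) *\<^sub>R fst z T \<in> affine hull R"
          by (intro mem_affine[OF affine_affine_hull] hull_inc) auto
        moreover have "(1 + r / 2 / norm q) *\<^sub>R xT + (- (r / 2 / norm q)) *\<^sub>R fst z T = h"
          by (simp add: h_def q_def algebra_simps)
        ultimately have "h \<in> closure (affine hull R)" using closure_subset by auto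
        moreover have "norm (h - xT) < r" using q_pos r by (simp add: h_def)
        ultimately obtain v where v: "v \<in> V" "G v = h" "L2_norm ?J v \<le> K" using preimage by blast
        let ?x = "fst z" and ?u = "snd z"
        define p where "p s = (\<lambda>t. (1 - s) *\<^sub>R ?x t + s *\<^sub>R (y0 t + F t v), \<lambda>t. (1 - s) *\<^sub>R ?u t + s *\<^sub>R v t)" for s
        \<comment> \<open>The segment of final states has length norm q + r/2 and passes through
          \<open>xT\<close> after the length norm q.\<close>
        define \<sigma> where "\<sigma> = norm q / (norm q + r / 2)"
        have sum_pos: "norm q + r / 2 > 0" using q_pos r by linarith
        have \<sigma>: "0 < \<sigma>" "\<sigma> \<le> 1" and \<sigma>_eq: "\<sigma> * (norm q + r / 2) = norm q"
          using q_pos r sum_pos divide_pos_pos[OF q_pos sum_pos] unfolding \<sigma>_def by (simp_all add: divide_le_eq)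
        have u: "?u \<in> V" "?u \<in> L2 ?J" "v \<in> L2 ?J" using A_E z v V_L2 by auto
        have p_A: "p s \<in> A" if s: "s \<in> {0..1}" for s
          unfolding p_def A_iff
        proof (intro conjI ballI V_convex[OF u(1) v(1) s])
          fix t assume t: "t \<in> {0..T}"
          show "(1 - s) *\<^sub>R ?x t + s *\<^sub>R (y0 t + F t v) = y0 t + F t (\<lambda>t. (1 - s) *\<^sub>R ?u t + s *\<^sub>R v t)"
            using A_E(5)[OF z(1) t] F_convex[OF u(2,3) t] by (simp add: algebra_simps)
        qed
        \<comment> \<open>The final states stay on the line through \<open>xT\<close> with direction
          \<open>q\<close>, so \<phi> is affine along the path up to \<sigma>. Its rate of decrease
          exceeds r/2 however small norm q is.\<close>
        have \<phi>_p: "\<phi> (p s) = norm q - s * (norm q + r / 2)" if s: "0 \<le> s" "s \<le> \<sigma>" for s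
        proof -
          have le: "s * (norm q + r / 2) \<le> norm q"
            using mult_right_mono[OF s(2), of "norm q + r / 2"] \<sigma>_eq q_pos r by simp
          have "(1 - s) *\<^sub>R ?x T + s *\<^sub>R (y0 T + F T v) - xT = (1 - s) *\<^sub>R q + s *\<^sub>R (h - xT)"
            using v(2) by (simp add: G_def q_def algebra_simps)
          also have "\<dots> = (1 - s - s * (r / 2) / norm q) *\<^sub>R q"
            by (simp add: h_def algebra_simps)
          also have "1 - s - s * (r / 2) / norm q = (norm q - s * (norm q + r / 2)) / norm q"
            using q_pos by (simp add: field_simps)
          finally show ?thesis
            using le q_pos by (simp add: \<phi>_def terminal_error_def p_def)
        qed
        show ?thesis
        proof (rule exI[of _ p], rule exI[of _ \<sigma>], intro conjI ballI)
          show "0 < \<sigma>" by (rule \<sigma>)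
          show "\<phi> (p \<sigma>) = 0" using \<phi>_p[of \<sigma>] \<sigma> \<sigma>_eq by simp
          fix s assume "s \<in> {0..\<sigma>}"
          then have s: "0 \<le> s" "s \<le> \<sigma>" "s \<in> {0..1}" using \<sigma> by auto
          show "p s \<in> A" by (rule p_A[OF s(3)])
          show "\<nu> (p s) \<le> \<bar>M\<bar> + \<bar>K\<bar>"
          proof -
            have "\<nu> (p s) \<le> (1 - s) * L2_norm ?J ?u + s * L2_norm ?J v"
              using X.p_add[OF X.scale[OF u(2), of "1 - s"] X.scale[OF u(3), of s]] s(3)
              by (simp add: \<nu>_def p_def X.p_scale[OF u(2)] X.p_scale[OF u(3)])
            also have "\<dots> \<le> 1 * \<bar>M\<bar> + 1 * \<bar>K\<bar>"
              using s(3) z(2) v(3) by (intro add_mono mult_mono) (auto simp: \<nu>_def)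
            finally show ?thesis by simp
          qed
          show "distX T (p s) z \<le> s * D"
          proof -
            have "distX T (p s) z \<le> (CF + 1) * L2_norm ?J (\<lambda>t. snd (p s) t - snd z t)"
              by (rule dist_A[OF p_A[OF s(3)] z(1)])
            also have "(\<lambda>t. snd (p s) t - snd z t) = (\<lambda>t. s *\<^sub>R (v t - ?u t))"
              by (auto simp: p_def algebra_simps)
            also have "L2_norm ?J (\<lambda>t. s *\<^sub>R (v t - ?u t)) = s * L2_norm ?J (\<lambda>t. v t - ?u t)"
              using X.p_scale[OF X.diff[OF u(3,2)], of s] s by simp
            also have "\<dots> \<le> s * (\<bar>M\<bar> + \<bar>K\<bar>)"
              using X.p_diff[OF u(3,2)] s z(2) v(3) by (intro mult_left_mono) (auto simp: \<nu>_def)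
            also have "(CF + 1) * (s * (\<bar>M\<bar> + \<bar>K\<bar>)) \<le> s * D"
              using s by (simp add: D_def algebra_simps)
            finally show ?thesis using CF(1) by (simp add: mult_left_mono)
          qed
          show "\<phi> (p s) \<le> \<phi> z - s * (r / 2)"
            using \<phi>_p[OF s(1,2)] q mult_nonneg_nonneg[OF s(1) norm_ge_zero[of q]] by (simp add: algebra_simps)
        qed
      qed
      moreover have "r / 2 > 0" using r by simp
      ultimately show ?thesis using D by blast
    qed
    show "\<exists>z. globally_optimal I (feasible_set A \<phi>) z" by (rule optimal_exists)
  qed
qed

end
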